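(* (a) The set $\{P_n^{-m}|_{L_{\widehat{\mathbb{C}}}} : m\in\mathbb{N}_0,\ n\in\mathbb{Z},\ |n|\le m\}$ is a Schauder basis of $\mathcal{A}(\widehat{\mathbb{C}})$. (b) The set $\{P_n^{-m}|_{L_{\mathbb{D}}} : m\in\mathbb{N}_0,\ n\in\mathbb{Z},\ |n|\le m\}$ is a Schauder basis of $\mathcal{A}(\mathbb{D})$.
   Context: $\mathbb{N}_0=\{0,1,2,\dots\}$, $\mathbb{D}$ is the open unit disk, $\widehat{\mathbb{C}}=\mathbb{C}\cup\{\infty\}$ is the Riemann sphere, with the conventions $\infty\cdot 0=0\cdot\infty=1$ and $\infty\cdot z=z\cdot\infty=\infty$ for $z\in\widehat{\mathbb{C}}\setminus\{0\}$. $\Omega=\{(z,w)\in\widehat{\mathbb{C}}^2 : z\cdot w\ne 1\}$, an open subset of $\widehat{\mathbb{C}}^2$. $\mathcal{H}(\Omega)$ is the Fréchet space of holomorphic functions $\Omega\to\mathbb{C}$ with the topology of locally uniform convergence. $L_{\widehat{\mathbb{C}}}=\{(z,-\overline z):z\in\widehat{\mathbb{C}}\}\subseteq\Omega$ is identified with $\widehat{\mathbb{C}}$ via $z\leftrightarrow(z,-\overline z)$, and $L_{\mathbb{D}}=\{(z,\overline z):z\in\mathbb{D}\}\subseteq\Omega$ is identified with $\mathbb{D}$ via $z\leftrightarrow(z,\overline z)$; restrictions of functions on $\Omega$ to these sets are thus regarded as functions on $\widehat{\mathbb{C}}$, resp. $\mathbb{D}$. Define $\mathcal{A}(\widehat{\mathbb{C}})=\{f\in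 C^\infty(\widehat{\mathbb{C}}): f=F|_{L_{\widehat{\mathbb{C}}}}\text{ for some }F\in\mathcal{H}(\Omega)\}$ and $\mathcal{A}(\mathbb{D})=\{f\in C^\infty(\mathbb{D}): f=F|_{L_{\mathbb{D}}}\text{ for some }F\in\mathcal{H}(\Omega)\}$. By the identity principle $F$ is uniquely determined by $f$ in both cases, and both spaces carry the Fréchet topology transported from $\mathcal{H}(\Omega)$ by the bijection $F\mapsto f$. Poisson Fourier modes: for $m\in\mathbb{N}_0$, $n\in\mathbb{Z}$, $P_n^{-m}:\Omega\to\mathbb{C}$ is $$P_n^{-m}(z,w)=(-1)^n\binom{m}{|n|}(1-zw)^{-m}\,{}_2F_1(-m,|n|-m;|n|+1;zw)\cdot\begin{cases}w^n & n\ge 0\\ z^{|n|} & n\le 0\end{cases}$$ with $\binom{m}{|n|}=0$ if $|n|>m$ and ${}_2F_1(a,b;c;t)=\sum_{k\ge0}\frac{(a)_k(b)_k}{(c)_k}\frac{t^k}{k!}$ (a finite sum here), $(a)_k=a(a+1)\cdots(a+k-1)$. Equivalently, for $n\ge0$, $P_n^{-m}(z,w)=(-1)^n\sum_{k=0}^{m-n}\binom{m}{k+n}\binom{m}{k}\frac{z^kw^{k+n}}{(1-zw)^m}=P_{-n}^{-m}(w,z)$. At points of $\Omega$ with a coordinate equal to $\infty$ the formulas are understood via the (unique) holomorphic extension. *)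

theory Defs
  imports "HOL-Analysis.Analysis"
begin

section \<open>The Riemann sphere and the domain Omega\<close>

text \<open>\<^term>\<open>None\<close> is the point at infinity.\<close>
type_synonym sphere = "complex option"

definition sphere_topology :: "sphere topology" where
  "sphere_topology = Alexandroff_compactification euclidean"

fun sphere_mult :: "sphere \<Rightarrow> sphere \<Rightarrow> sphere" where
  "sphere_mult (Some z) (Some w) = Some (z * w)"
| "sphere_mult None (Some w) = (if w = 0 then Some 1 else None)"
| "sphere_mult (Some z) None = (if z = 0 then Some 1 else None)"
| "sphere_mult None None = None"

definition Omega :: "(sphere \<times> sphere) set" where
  "Omega = {(z, w). sphere_mult z w \<noteq> Some 1}"

text \<open>The inverses of the two standard charts \<open>z\<close> and \<open>1/z\<close>.\<close>
definition sphere_params :: "(complex \<Rightarrow> sphere) set" where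
  "sphere_params = {Some, \<lambda>u. if u = 0 then None else Some (1 / u)}"

section \<open>Holomorphic and smooth functions\<close>

text \<open>Complex differentiability of a function of two variables on an open set: the total derivative
  exists and is complex linear.\<close>
definition holomorphic2_on :: "(complex \<times> complex \<Rightarrow> complex) \<Rightarrow> (complex \<times> complex) set \<Rightarrow> bool" where
  "holomorphic2_on f S \<longleftrightarrow>
     (\<forall>p\<in>S. \<exists>a b. (f has_derivative (\<lambda>h. a * fst h + b * snd h)) (at p))"

text \<open>Functions on \<^term>\<open>Omega\<close> are represented as total functions that are \<^term>\<open>undefined\<close>
  outside, so that equality in this set is equality on \<^term>\<open>Omega\<close>.\<close>
definition hol_Omega :: "(sphere \<times> sphere \<Rightarrow> complex) set" where
  "hol_Omega = {F \<in> extensional Omega.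
     \<forall>\<phi>\<in>sphere_params. \<forall>\<psi>\<in>sphere_params.
       holomorphic2_on (\<lambda>(u, v). F (\<phi> u, \<psi> v)) {(u, v). (\<phi> u, \<psi> v) \<in> Omega}}"

text \<open>Locally uniform convergence on the locally compact space \<^term>\<open>Omega\<close> is uniform convergence
  on its compact subsets.\<close>
definition hol_Omega_topology :: "(sphere \<times> sphere \<Rightarrow> complex) topology" where
  "hol_Omega_topology = topology_generated_by
     {{F \<in> hol_Omega. \<forall>p\<in>K. dist (F p) (G p) < e} | K G e.
        compactin (prod_topology sphere_topology sphere_topology) K \<and> K \<subseteq> Omega \<and>
        G \<in> hol_Omega \<and> 0 < (e::real)}"

text \<open>Real differentiability of order \<open>k\<close> on an open subset of the plane; \<open>fx\<close> and \<open>fy\<close> are the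
  partial derivatives with respect to the real and the imaginary part.\<close>
fun C_k_on :: "nat \<Rightarrow> (complex \<Rightarrow> complex) \<Rightarrow> complex set \<Rightarrow> bool" where
  "C_k_on 0 f S \<longleftrightarrow> continuous_on S f"
| "C_k_on (Suc k) f S \<longleftrightarrow>
     (\<exists>fx fy. (\<forall>z\<in>S. (f has_derivative (\<lambda>h. of_real (Re h) * fx z + of_real (Im h) * fy z)) (at z)) \<and>
              C_k_on k fx S \<and> C_k_on k fy S)"

definition smooth_plane_on :: "(complex \<Rightarrow> complex) \<Rightarrow> complex set \<Rightarrow> bool" where
  "smooth_plane_on f S \<longleftrightarrow> (\<forall>k. C_k_on k f S)"

definition smooth_sphere :: "(sphere \<Rightarrow> complex) \<Rightarrow> bool" where
  "smooth_sphere f \<longleftrightarrow> (\<forall>\<phi>\<in>sphere_params. smooth_plane_on (f \<circ> \<phi>) UNIV)"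

section \<open>The spaces of restrictions\<close>

definition restrict_sphere :: "(sphere \<times> sphere \<Rightarrow> complex) \<Rightarrow> sphere \<Rightarrow> complex" where
  "restrict_sphere F = (\<lambda>z. F (z, map_option (\<lambda>x. - cnj x) z))"

definition restrict_disk :: "(sphere \<times> sphere \<Rightarrow> complex) \<Rightarrow> complex \<Rightarrow> complex" where
  "restrict_disk F = (\<lambda>z\<in>ball 0 1. F (Some z, Some (cnj z)))"

definition A_sphere :: "(sphere \<Rightarrow> complex) set" where
  "A_sphere = {f. smooth_sphere f \<and> (\<exists>F\<in>hol_Omega. f = restrict_sphere F)}"

definition A_disk :: "(complex \<Rightarrow> complex) set" where
  "A_disk = {f. smooth_plane_on f (ball 0 1) \<and> (\<exists>F\<in>hol_Omega. f = restrict_disk F)}"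

text \<open>The topologies transported by the bijections \<^term>\<open>restrict_sphere\<close> and
  \<^term>\<open>restrict_disk\<close>: they are pulled back along the maps taking \<open>f\<close> to the
  unique holomorphic \<open>F\<close> that restricts to \<open>f\<close>.\<close>
definition A_sphere_topology :: "(sphere \<Rightarrow> complex) topology" where
  "A_sphere_topology =
     pullback_topology A_sphere (the_inv_into hol_Omega restrict_sphere) hol_Omega_topology"

definition A_disk_topology :: "(complex \<Rightarrow> complex) topology" where
  "A_disk_topology =
     pullback_topology A_disk (the_inv_into hol_Omega restrict_disk) hol_Omega_topology"

section \<open>Poisson Fourier modes\<close>

definition hyp2F1 :: "complex \<Rightarrow> complex \<Rightarrow> complex \<Rightarrow> complex \<Rightarrow> complex" where
  "hyp2F1 a b c t = (\<Sum>k. pochhammer a k * pochhammer b k / pochhammer c k * (t ^ k / fact k))"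

definition PFM_formula :: "nat \<Rightarrow> int \<Rightarrow> complex \<Rightarrow> complex \<Rightarrow> complex" where
  "PFM_formula m n z w =
     (-1) powi n * of_nat (m choose nat \<bar>n\<bar>) * (1 - z * w) powi (- int m) *
     hyp2F1 (- of_nat m) (of_int (\<bar>n\<bar> - int m)) (of_int (\<bar>n\<bar> + 1)) (z * w) *
     (if n \<ge> 0 then w ^ nat n else z ^ nat \<bar>n\<bar>)"

text \<open>\<open>PFM m n\<close> is the mode with upper index \<open>-m\<close> and lower index \<open>n\<close>: the unique holomorphic
  extension of the formula from the finite points to \<^term>\<open>Omega\<close>.\<close>
definition PFM :: "nat \<Rightarrow> int \<Rightarrow> sphere \<times> sphere \<Rightarrow> complex" where
  "PFM m n = (THE F. F \<in> hol_Omega \<and>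
     (\<forall>z w. z * w \<noteq> 1 \<longrightarrow> F (Some z, Some w) = PFM_formula m n z w))"

section \<open>Schauder bases\<close>

text \<open>\<open>V\<close> is a space of complex functions on \<open>D\<close> with the pointwise operations and with topology
  \<open>T\<close>; functions are \<^term>\<open>undefined\<close> outside \<open>D\<close>, which explains the \<^term>\<open>restrict\<close>.\<close>
definition schauder_sequence ::
    "'a set \<Rightarrow> ('a \<Rightarrow> complex) set \<Rightarrow> ('a \<Rightarrow> complex) topology \<Rightarrow> (nat \<Rightarrow> 'a \<Rightarrow> complex) \<Rightarrow> bool" where
  "schauder_sequence D V T e \<longleftrightarrow>
     range e \<subseteq> V \<and>
     (\<forall>f\<in>V. \<exists>!c :: nat \<Rightarrow> complex.
        limitin T (\<lambda>N. restrict (\<lambda>x. \<Sum>k<N. c k * e k x) D) f sequentially)"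

text \<open>A set carries no order: it is a Schauder basis if it is countably infinite and each of its
  enumerations without repetition is a Schauder basis in the sense of sequences.\<close>
definition schauder_basis ::
    "'a set \<Rightarrow> ('a \<Rightarrow> complex) set \<Rightarrow> ('a \<Rightarrow> complex) topology \<Rightarrow> ('a \<Rightarrow> complex) set \<Rightarrow> bool" where
  "schauder_basis D V T B \<longleftrightarrow>
     countable B \<and> infinite B \<and> (\<forall>e. bij_betw e UNIV B \<longrightarrow> schauder_sequence D V T e)"

end

theory Submission
  imports Defs "HOL-Complex_Analysis.Complex_Analysis"
begin

text \<open>
  On the finite points of Omega put \<open>c = w / (1 - z w)\<close>, \<open>b = z / (1 - z w)\<close> and
  \<open>x = z w / (1 - z w)\<close>. These functions extend holomorphically to Omega and satisfy
  \<open>b c = x (1 + x)\<close>; they embed Omega as an affine quadric. By a Pfaff transformation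
  (\<open>PFM_eq\<close>) the mode with indices \<open>-m\<close> and \<open>n\<close> is, for \<open>n \<ge> 0\<close>, the function
  \<open>(-1)^n c^n p(1 + 2 x)\<close>, where \<open>p\<close> is the Jacobi polynomial of degree \<open>m - n\<close> with both
  parameters equal to \<open>n\<close>; for \<open>n < 0\<close> the function \<open>b\<close> replaces \<open>c\<close>. So the modes are, weight by weight under
  the rotations \<open>(z, w) \<mapsto> (z / s, s w)\<close>, a triangular change of basis from the monomials
  \<open>c^n x^k\<close> and \<open>b^n x^k\<close>.

  First every holomorphic \<open>F\<close> is expanded in these monomials. The map \<open>(z, w) \<mapsto> (z, c)\<close> identifies the
  part of Omega where \<open>z\<close> is finite with the plane \<open>\<complex>\<^sup>2\<close>. There \<open>F\<close> is an entire function
  of two variables, and since \<open>x = z c\<close> its Taylor monomials \<open>z^i c^j\<close> with \<open>i \<le> j\<close> are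
  \<open>c^(j - i) x^i\<close>. Exchanging the two coordinates gives the monomials in \<open>b\<close> and \<open>x\<close>. Both
  Taylor series, evaluated along \<open>s \<mapsto> (z / s, s w)\<close>, are Laurent series of the same function of
  \<open>s\<close>; Liouville's theorem matches their parts (\<open>weight_split\<close>), so that \<open>F\<close> is the part of
  nonnegative weight of the first series plus the part of negative weight of the second
  (\<open>mode_series_eq\<close>).

  Then \<open>x^k\<close> is expanded in Jacobi polynomials. The inverse of their coefficient matrix is
  explicit (\<open>jac_inv_coef\<close>, \<open>jac_coef_inv\<close>), and its entries as well as the
  polynomials grow at most geometrically. By Cauchy's inequality on polydiscs of arbitrary radius
  the Taylor coefficients of \<open>F\<close> decay faster than every geometric sequence. Hence the
  coefficients of \<open>F\<close> with respect to the modes exist, and the mode expansion converges absolutely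
  and uniformly on compact sets (\<open>mode_expansion\<close>, \<open>mode_expansion_bound\<close>), in
  every order of summation.

  Uniqueness holds because each coefficient is a continuous linear functional on the holomorphic
  functions (\<open>coef_bounded\<close>) and these functionals are biorthogonal to the modes
  (\<open>coef_mode_fun\<close>): the second product of the two triangular matrices is the identity too.

  Finally everything is transported to the sphere and to the disk
  (\<open>schauder_basis_of_restrictions\<close>). The two restriction maps are injective because
  \<open>w = s cnj z\<close> with \<open>s = 1\<close> or \<open>s = -1\<close> is a totally real surface, on which a
  holomorphic function of two variables cannot vanish unless it is zero. The restrictions of the
  modes are smooth since they are rational functions of \<open>z\<close> and \<open>cnj z\<close> without poles.
\<close>

section \<open>Entire functions of two variables\<close>

text \<open>The condition of \<open>holomorphic2_on\<close> at a single point, so that the rules of calculus can be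
  stated pointwise.\<close>

definition cdiff2 :: "(complex \<times> complex \<Rightarrow> complex) \<Rightarrow> complex \<times> complex \<Rightarrow> bool" where
  "cdiff2 f p \<longleftrightarrow> (\<exists>a b. (f has_derivative (\<lambda>h. a * fst h + b * snd h)) (at p))"

lemma holomorphic2_on_iff_cdiff2: "holomorphic2_on f S \<longleftrightarrow> (\<forall>p\<in>S. cdiff2 f p)"
  unfolding holomorphic2_on_def cdiff2_def ..

lemma cdiff2_const [simp]: "cdiff2 (\<lambda>_. k) p"
  unfolding cdiff2_def by (rule exI[of _ 0], rule exI[of _ 0]) simp

lemma cdiff2_fst: "cdiff2 fst p"
  unfolding cdiff2_def by (rule exI[of _ 1], rule exI[of _ 0]) (auto intro!: derivative_eq_intros)

lemma cdiff2_snd: "cdiff2 snd p"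
  unfolding cdiff2_def by (rule exI[of _ 0], rule exI[of _ 1]) (auto intro!: derivative_eq_intros)

lemma cdiff2_add:
  assumes "cdiff2 f p" "cdiff2 g p" shows "cdiff2 (\<lambda>x. f x + g x) p"
proof -
  obtain a b a' b' where "(f has_derivative (\<lambda>h. a * fst h + b * snd h)) (at p)"
    "(g has_derivative (\<lambda>h. a' * fst h + b' * snd h)) (at p)"
    using assms unfolding cdiff2_def by blast
  from has_derivative_add[OF this]
  have "((\<lambda>x. f x + g x) has_derivative (\<lambda>h. (a + a') * fst h + (b + b') * snd h)) (at p)"
    by (simp add: algebra_simps)
  then show ?thesis unfolding cdiff2_def by blast
qed

lemma cdiff2_mult:
  assumes "cdiff2 f p" "cdiff2 g p" shows "cdiff2 (\<lambda>x. f x * g x) p"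
proof -
  obtain a b a' b' where "(f has_derivative (\<lambda>h. a * fst h + b * snd h)) (at p)"
    "(g has_derivative (\<lambda>h. a' * fst h + b' * snd h)) (at p)"
    using assms unfolding cdiff2_def by blast
  from has_derivative_mult[OF this]
  have "((\<lambda>x. f x * g x) has_derivative
          (\<lambda>h. (f p * a' + a * g p) * fst h + (f p * b' + b * g p) * snd h)) (at p)"
    by (simp add: algebra_simps)
  then show ?thesis unfolding cdiff2_def by blast
qed

lemma cdiff2_field:
  assumes "cdiff2 f p" "(g has_field_derivative d) (at (f p))"
  shows "cdiff2 (\<lambda>x. g (f x)) p"
proof -
  obtain a b where "(f has_derivative (\<lambda>h. a * fst h + b * snd h)) (at p)"
    using assms unfolding cdiff2_def by blast
  from has_derivative_compose[OF this assms(2)[unfolded has_field_derivative_def]]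
  have "((\<lambda>x. g (f x)) has_derivative (\<lambda>h. (d * a) * fst h + (d * b) * snd h)) (at p)"
    by (simp add: algebra_simps)
  then show ?thesis unfolding cdiff2_def by blast
qed

lemma cdiff2_inverse:
  assumes "cdiff2 f p" "f p \<noteq> 0" shows "cdiff2 (\<lambda>x. inverse (f x)) p"
  by (rule cdiff2_field[OF assms(1) DERIV_inverse[OF assms(2)]])

lemma cdiff2_divide:
  assumes "cdiff2 f p" "cdiff2 g p" "g p \<noteq> 0" shows "cdiff2 (\<lambda>x. f x / g x) p"
  using cdiff2_mult[OF assms(1) cdiff2_inverse[OF assms(2,3)]] by (simp add: field_simps)

lemma cdiff2_diff:
  assumes "cdiff2 f p" "cdiff2 g p" shows "cdiff2 (\<lambda>x. f x - g x) p"
  using cdiff2_add[OF assms(1) cdiff2_mult[OF cdiff2_const[of "-1"] assms(2)]] by simp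

lemmas cdiff2_intros = cdiff2_const cdiff2_fst cdiff2_snd cdiff2_add cdiff2_mult cdiff2_diff
  cdiff2_divide

lemma cdiff2_compose:
  assumes "cdiff2 f p" "cdiff2 g p" "cdiff2 F (f p, g p)"
  shows "cdiff2 (\<lambda>x. F (f x, g x)) p"
proof -
  obtain a b a' b' where fg: "(f has_derivative (\<lambda>h. a * fst h + b * snd h)) (at p)"
    "(g has_derivative (\<lambda>h. a' * fst h + b' * snd h)) (at p)"
    using assms unfolding cdiff2_def by blast
  obtain A B where F: "(F has_derivative (\<lambda>h. A * fst h + B * snd h)) (at (f p, g p))"
    using assms unfolding cdiff2_def by blast
  from has_derivative_compose[OF has_derivative_Pair[OF fg] F]
  have "((\<lambda>x. F (f x, g x)) has_derivative
          (\<lambda>h. (A * a + B * a') * fst h + (A * b + B * b') * snd h)) (at p)"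
    by (simp add: algebra_simps)
  then show ?thesis unfolding cdiff2_def by blast
qed

lemma cdiff2_cong:
  assumes "cdiff2 f p" "open U" "p \<in> U" "\<And>x. x \<in> U \<Longrightarrow> f x = g x"
  shows "cdiff2 g p"
  using assms has_derivative_transform_within_open unfolding cdiff2_def by blast

lemma cdiff2_slice1:
  assumes "cdiff2 G (z, c)" shows "(\<lambda>z. G (z, c)) field_differentiable (at z)"
proof -
  obtain A B where F: "(G has_derivative (\<lambda>h. A * fst h + B * snd h)) (at (z, c))"
    using assms unfolding cdiff2_def by blast
  have "((\<lambda>z. (z, c)) has_derivative (\<lambda>h. (h, 0))) (at z)"
    by (auto intro!: derivative_eq_intros)
  from has_derivative_compose[OF this F]
  have "((\<lambda>z. G (z, c)) has_field_derivative A) (at z)"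
    by (simp add: has_field_derivative_def)
  then show ?thesis unfolding field_differentiable_def by blast
qed

lemma cdiff2_slice2:
  assumes "cdiff2 G (z, c)" shows "(\<lambda>c. G (z, c)) field_differentiable (at c)"
proof -
  obtain A B where F: "(G has_derivative (\<lambda>h. A * fst h + B * snd h)) (at (z, c))"
    using assms unfolding cdiff2_def by blast
  have "((\<lambda>c. (z, c)) has_derivative (\<lambda>h. (0, h))) (at c)"
    by (auto intro!: derivative_eq_intros)
  from has_derivative_compose[OF this F]
  have "((\<lambda>c. G (z, c)) has_field_derivative B) (at c)"
    by (simp add: has_field_derivative_def)
  then show ?thesis unfolding field_differentiable_def by blast
qed

lemma cdiff2_isCont: "cdiff2 G p \<Longrightarrow> isCont G p"
  unfolding cdiff2_def by (auto intro: has_derivative_continuous)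

definition snd_coef :: "(complex \<times> complex \<Rightarrow> complex) \<Rightarrow> nat \<Rightarrow> complex \<Rightarrow> complex" where
  "snd_coef G j z = (deriv ^^ j) (\<lambda>c. G (z, c)) 0 / fact j"

text \<open>The coefficient of \<open>z^i c^j\<close> in the double Taylor series at the origin. Iterated derivatives
  in one variable, rather than integrals over a torus, make it independent of a radius.\<close>

definition tcoef :: "(complex \<times> complex \<Rightarrow> complex) \<Rightarrow> nat \<Rightarrow> nat \<Rightarrow> complex" where
  "tcoef G i j = (deriv ^^ i) (snd_coef G j) 0 / fact i"

lemma holomorphic_slices:
  assumes "holomorphic2_on G UNIV"
  shows "(\<lambda>z. G (z, c)) holomorphic_on S" "(\<lambda>c. G (z, c)) holomorphic_on S"
  using assms cdiff2_slice1 cdiff2_slice2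
  by (auto simp: holomorphic2_on_iff_cdiff2 holomorphic_on_def field_differentiable_at_within)

lemma snd_coef_sums:
  assumes "holomorphic2_on G UNIV"
  shows "(\<lambda>j. snd_coef G j z * c ^ j) sums G (z, c)"
  using holomorphic_power_series[of "\<lambda>c. G (z, c)" 0 "norm c + 1" c] holomorphic_slices[OF assms]
  by (simp add: snd_coef_def)

lemma snd_coef_bound:
  assumes "holomorphic2_on G UNIV" "R > 0" "\<And>c. norm c = R \<Longrightarrow> norm (G (z, c)) \<le> B"
  shows "norm (snd_coef G j z) \<le> B / R ^ j"
proof -
  have "norm ((deriv ^^ j) (\<lambda>c. G (z, c)) 0) \<le> fact j * B / R ^ j"
    by (rule Cauchy_inequality)
       (use assms holomorphic_slices[OF assms(1)] in
         \<open>auto intro: holomorphic_on_imp_continuous_on\<close>)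
  then show ?thesis by (simp add: snd_coef_def norm_divide field_simps)
qed

lemma entire2_bounded:
  assumes "holomorphic2_on G UNIV"
  obtains M where "M \<ge> 0" "\<And>z c. norm z \<le> R \<Longrightarrow> norm c \<le> R \<Longrightarrow> norm (G (z, c)) \<le> M"
proof -
  have "continuous_on (cball 0 R \<times> cball 0 R) G"
    using assms cdiff2_isCont by (auto simp: holomorphic2_on_iff_cdiff2 continuous_at_imp_continuous_on)
  then have "compact (G ` (cball 0 R \<times> cball 0 R))"
    by (intro compact_continuous_image compact_Times compact_cball)
  then obtain M where M: "\<And>x. x \<in> G ` (cball 0 R \<times> cball 0 R) \<Longrightarrow> norm x \<le> M"
    using compact_imp_bounded bounded_iff by metis
  show ?thesis
    by (rule that[of "max M 0"]) (use M in \<open>force simp: le_max_iff_disj\<close>)+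
qed

text \<open>Inductively, the coefficient of index \<open>j\<close> is the limit, as \<open>h\<close> tends to \<open>0\<close>, of
  \<open>(G(z, h) - \<Sum>i<j. D i z * h^i) / h^j\<close>, where \<open>D\<close> stands for the coefficients. Cauchy's inequality
  bounds all coefficients uniformly for \<open>z\<close> in a disc, so the limit is locally uniform and
  holomorphy passes to it.\<close>

lemma snd_coef_holomorphic:
  assumes G: "holomorphic2_on G UNIV"
  shows "snd_coef G j holomorphic_on UNIV"
proof (induction j rule: less_induct)
  case (less j)
  \<comment> \<open>\<open>h n\<close> has modulus at most \<open>1/2\<close>, so the tail of the series is dominated by a geometric one.\<close>
  define h :: "nat \<Rightarrow> complex" where "h n = 1 / of_nat (n + 2)" for n
  define E where "E n z = (G (z, h n) - (\<Sum>i<j. snd_coef G i z * h n ^ i)) / h n ^ j" for n z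
  have h0: "h n \<noteq> 0" for n
    using of_nat_neq_0[of "Suc n", where 'a = complex] by (simp add: h_def)
  have hn: "norm (h n) = 1 / real (n + 2)" for n
    by (simp only: h_def norm_divide norm_of_nat norm_one)
  show ?case
  proof (rule holomorphic_uniform_sequence[where f = E])
    show "E n holomorphic_on UNIV" for n
      unfolding E_def by (intro holomorphic_intros holomorphic_slices[OF G] less.IH) (auto simp: h0)
    fix x :: complex
    define r where "r = norm x + 1"
    have r: "r \<ge> 1" by (simp add: r_def)
    obtain M where M: "M \<ge> 0" "\<And>z c. norm z \<le> r \<Longrightarrow> norm c \<le> r \<Longrightarrow> norm (G (z, c)) \<le> M"
      using entire2_bounded[OF G] by blast
    have D: "norm (snd_coef G i z) \<le> M" if "norm z \<le> r" for i z
      using snd_coef_bound[OF G zero_less_one, of z M i] M that r by simp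
    have err: "norm (E n z - snd_coef G j z) \<le> 2 * M * (1 / real (n + 2))" if z: "norm z \<le> r" for n z
    proof -
      have "(\<lambda>i. snd_coef G (i + j) z * h n ^ (i + j)) sums
              (G (z, h n) - (\<Sum>i<j. snd_coef G i z * h n ^ i))"
        by (rule sums_split_initial_segment[OF snd_coef_sums[OF G]])
      from sums_divide[OF this, of "h n ^ j"]
      have "(\<lambda>i. snd_coef G (i + j) z * h n ^ i) sums E n z"
        using h0[of n] by (simp add: E_def power_add)
      from sums_split_initial_segment[OF this, of 1]
      have s: "(\<lambda>i. snd_coef G (i + 1 + j) z * h n ^ (i + 1)) sums (E n z - snd_coef G j z)"
        by simp
      have nh: "norm (h n) \<le> 1/2" by (simp add: hn field_simps)
      have g: "(\<lambda>i. M * norm (h n) * norm (h n) ^ i) sums (M * norm (h n) * (1 / (1 - norm (h n))))"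
        using nh by (intro sums_mult geometric_sums) simp
      have le: "norm (snd_coef G (i + 1 + j) z * h n ^ (i + 1)) \<le> M * norm (h n) * norm (h n) ^ i" for i
        using D[OF z, of "i+1+j"] by (simp add: norm_mult norm_power mult_right_mono mult.assoc)
      have "norm (E n z - snd_coef G j z) \<le> M * norm (h n) * (1 / (1 - norm (h n)))"
        using le s g by (metis (no_types, lifting) ext norm_sums_le)
      also have "\<dots> \<le> M * norm (h n) * 2"
        using nh M(1) by (intro mult_left_mono) (auto simp: field_simps)
      finally show ?thesis by (simp add: hn mult.commute)
    qed
    have "uniform_limit (cball x 1) E (snd_coef G j) sequentially"
    proof (rule uniform_limitI)
      fix e :: real assume "e > 0"
      have "(\<lambda>n. 2 * M * (1 / real (n + 2))) \<longlonglongrightarrow> 0"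
        by real_asymp
      then have "\<forall>\<^sub>F n in sequentially. 2 * M * (1 / real (n + 2)) < e"
        using \<open>e > 0\<close> by (rule order_tendstoD)
      then show "\<forall>\<^sub>F n in sequentially. \<forall>z\<in>cball x 1. dist (E n z) (snd_coef G j z) < e"
      proof eventually_elim
        case (elim n)
        show ?case
        proof
          fix z assume "z \<in> cball x 1"
          then have "norm z \<le> r"
            unfolding r_def by (metis add.commute add_left_mono dist_norm mem_cball norm_minus_commute norm_triangle_sub order_trans)
          from err[OF this, of n] elim show "dist (E n z) (snd_coef G j z) < e"
            by (simp add: dist_norm)
        qed
      qed
    qed
    then show "\<exists>d>0. cball x d \<subseteq> UNIV \<and> uniform_limit (cball x d) E (snd_coef G j) sequentially"
      by (intro exI[of _ 1]) auto
  qed auto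
qed

lemma tcoef_sums:
  assumes "holomorphic2_on G UNIV"
  shows "(\<lambda>i. tcoef G i j * z ^ i) sums snd_coef G j z"
  using holomorphic_power_series[of "snd_coef G j" 0 "norm z + 1" z]
    holomorphic_on_subset[OF snd_coef_holomorphic[OF assms]]
  by (simp add: tcoef_def)

text \<open>Cauchy's inequality in each variable. The radius is arbitrary, so the coefficients of an entire
  function decay faster than every geometric sequence; all convergence below rests on this.\<close>

lemma tcoef_bound:
  assumes G: "holomorphic2_on G UNIV" and R: "R > 0"
    and B: "\<And>z c. norm z = R \<Longrightarrow> norm c = R \<Longrightarrow> norm (G (z, c)) \<le> B"
  shows "norm (tcoef G i j) \<le> B / R ^ (i + j)"
proof -
  have "norm ((deriv ^^ i) (snd_coef G j) 0) \<le> fact i * (B / R ^ j) / R ^ i"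
    using snd_coef_bound[OF G R] B holomorphic_on_subset[OF snd_coef_holomorphic[OF G]] R
    by (intro Cauchy_inequality) (auto intro: holomorphic_on_imp_continuous_on)
  then show ?thesis by (simp add: tcoef_def norm_divide field_simps power_add)
qed

lemma geometric_summable_on:
  assumes "0 \<le> r" "r < (1::real)"
  shows "(\<lambda>(i, j). r ^ i * r ^ j) summable_on (UNIV :: (nat \<times> nat) set)"
proof -
  have g: "((\<lambda>i. r ^ i) has_sum (1 / (1 - r))) UNIV"
    using assms by (intro sums_nonneg_imp_has_sum geometric_sums) auto
  have "(\<lambda>(i, j). r ^ i * r ^ j) summable_on (SIGMA i:UNIV. UNIV)"
  proof (rule summable_on_SigmaI[where g = "\<lambda>i. r ^ i * (1 / (1 - r))"])
    show "((\<lambda>y. case (x, y) of (i, j) \<Rightarrow> r ^ i * r ^ j) has_sum r ^ x * (1 / (1 - r))) UNIV" for x :: nat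
      using has_sum_cmult_right[OF g, of "r ^ x"] by simp
    show "(\<lambda>i. r ^ i * (1 / (1 - r))) summable_on UNIV"
      by (rule summable_on_cmult_left[OF has_sum_imp_summable[OF g]])
  qed (use assms in auto)
  then show ?thesis by simp
qed

lemma taylor2_abs_summable:
  assumes G: "holomorphic2_on G UNIV"
  shows "(\<lambda>(i, j). norm (tcoef G i j * z ^ i * c ^ j)) summable_on UNIV"
proof -
  \<comment> \<open>Twice the size of the arguments: the terms are then dominated by powers of \<open>1/2\<close>.\<close>
  define R where "R = 2 * (norm z + norm c + 1)"
  have R0: "R > 0" unfolding R_def by (smt (verit) norm_ge_zero)
  have R: "R > 0" "norm z / R \<le> 1/2" "norm c / R \<le> 1/2"
    using R0 by (auto simp: divide_le_eq) (auto simp: R_def)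
  obtain M where M: "M \<ge> 0" "\<And>z c. norm z \<le> R \<Longrightarrow> norm c \<le> R \<Longrightarrow> norm (G (z, c)) \<le> M"
    using entire2_bounded[OF G] by blast
  have b: "norm (tcoef G i j * z ^ i * c ^ j) \<le> M * ((1/2) ^ i * (1/2) ^ j)" for i j
  proof -
    have "norm (tcoef G i j * z ^ i * c ^ j) \<le> M / R ^ (i + j) * norm z ^ i * norm c ^ j"
      unfolding norm_mult norm_power
      by (intro mult_right_mono tcoef_bound[OF G R(1)] M(2)) auto
    also have "\<dots> = M * ((norm z / R) ^ i * (norm c / R) ^ j)"
      using R(1) by (simp add: power_add power_divide)
    also have "\<dots> \<le> M * ((1/2) ^ i * (1/2) ^ j)"
      using R M(1) by (intro mult_left_mono mult_mono power_mono) auto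
    finally show ?thesis .
  qed
  have "(\<lambda>p. M * (case p of (i, j) \<Rightarrow> (1/2) ^ i * (1/2) ^ j)) summable_on (UNIV :: (nat \<times> nat) set)"
    by (intro summable_on_cmult_right geometric_summable_on) auto
  then show ?thesis
    by (rule summable_on_comparison_test) (use b in auto)
qed

lemma taylor2_has_sum:
  assumes G: "holomorphic2_on G UNIV"
  shows "((\<lambda>(i, j). tcoef G i j * z ^ i * c ^ j) has_sum G (z, c)) UNIV"
proof -
  let ?t = "\<lambda>(i, j). tcoef G i j * z ^ i * c ^ j"
  have "?t summable_on UNIV"
    by (rule abs_summable_summable) (use taylor2_abs_summable[OF G] in \<open>simp add: case_prod_beta'\<close>)
  then have s: "(\<lambda>(j, i). tcoef G i j * z ^ i * c ^ j) summable_on UNIV \<times> UNIV"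
    using summable_on_swap[of ?t UNIV UNIV] by (simp add: case_prod_beta')
  define L where "L = infsum (\<lambda>(j, i). tcoef G i j * z ^ i * c ^ j) (UNIV \<times> UNIV)"
  have L: "((\<lambda>(j, i). tcoef G i j * z ^ i * c ^ j) has_sum L) (UNIV \<times> UNIV)"
    using s unfolding L_def by (rule has_sum_infsum)
  have inner: "((\<lambda>i. tcoef G i j * z ^ i * c ^ j) has_sum (snd_coef G j z * c ^ j)) UNIV" for j
  proof -
    have "(\<lambda>i. tcoef G i j * z ^ i * c ^ j) summable_on UNIV"
      using summable_on_SigmaD1[OF s, of j] by simp
    then obtain l where l: "((\<lambda>i. tcoef G i j * z ^ i * c ^ j) has_sum l) UNIV"
      by (auto simp: summable_on_def)
    have "(\<lambda>i. tcoef G i j * z ^ i * c ^ j) sums (snd_coef G j z * c ^ j)"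
      by (intro sums_mult2 tcoef_sums G)
    with has_sum_imp_sums[OF l] l show ?thesis using sums_unique2 by metis
  qed
  have "((\<lambda>j. snd_coef G j z * c ^ j) has_sum L) UNIV"
    using has_sum_SigmaD[OF L] inner by auto
  then have "L = G (z, c)"
    using has_sum_imp_sums snd_coef_sums[OF G] sums_unique2 by metis
  with L show ?thesis
    using has_sum_swap[of ?t UNIV UNIV "G (z, c)"] by (simp add: case_prod_beta')
qed

lemma powser_coef_unique:
  fixes f :: "complex \<Rightarrow> complex"
  assumes "\<And>c. (\<lambda>j. A j * c ^ j) sums f c"
  shows "(deriv ^^ j) f 0 / fact j = A j"
proof -
  have "f has_fps_expansion Abs_fps A"
    by (rule has_fps_expansionI) (use assms in auto)
  from fps_nth_fps_expansion[OF this, of j] show ?thesis by simp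
qed

text \<open>Linearity of the coefficients, their behaviour under rescaling of the variables and their values
  on the modes are all read off from this uniqueness.\<close>

lemma taylor2_unique:
  assumes "\<And>z c. ((\<lambda>(i, j). a i j * z ^ i * c ^ j) has_sum G (z, c)) UNIV"
  shows "tcoef G i j = a i j"
proof -
  have sw: "((\<lambda>(j, i). a i j * z ^ i * c ^ j) has_sum G (z, c)) (UNIV \<times> UNIV)" for z c
    using has_sum_swap[of "\<lambda>(i, j). a i j * z ^ i * c ^ j" UNIV UNIV] assms[of z c]
    by (simp add: case_prod_beta')
  define s where "s z j = infsum (\<lambda>i. a i j * z ^ i) UNIV" for z j
  have inner: "((\<lambda>i. a i j * z ^ i) has_sum s z j) UNIV" for z j
  proof -
    have "(\<lambda>i. a i j * z ^ i * 1 ^ j) summable_on UNIV"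
      using summable_on_SigmaD1[OF has_sum_imp_summable[OF sw[of z 1]], of j] by simp
    then show ?thesis unfolding s_def by (intro has_sum_infsum) simp
  qed
  have "((\<lambda>j. s z j * c ^ j) has_sum G (z, c)) UNIV" for z c
  proof -
    have "((\<lambda>i. a i j * z ^ i * c ^ j) has_sum s z j * c ^ j) UNIV" for j
      by (intro has_sum_cmult_left inner)
    then show ?thesis using has_sum_SigmaD[OF sw[of z c]] by auto
  qed
  then have "snd_coef G j z = s z j" for z j
    unfolding snd_coef_def by (intro powser_coef_unique has_sum_imp_sums)
  then have "(\<lambda>i. a i j * z ^ i) sums snd_coef G j z" for z j
    using has_sum_imp_sums[OF inner] by metis
  then show ?thesis unfolding tcoef_def by (intro powser_coef_unique)
qed

section \<open>Jacobi polynomials and the inverse of their coefficient matrix\<close>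

text \<open>The coefficient of \<open>x^i\<close> in the Jacobi polynomial of degree \<open>l\<close> with both parameters equal to
  \<open>n\<close>, at the argument \<open>1 + 2 x\<close>.\<close>

definition jac_coef :: "nat \<Rightarrow> nat \<Rightarrow> nat \<Rightarrow> complex" where
  "jac_coef n l i = of_nat ((n + l) choose (n + i)) * of_nat ((2 * n + l + i) choose i)"

definition jac_poly :: "nat \<Rightarrow> nat \<Rightarrow> complex \<Rightarrow> complex" where
  "jac_poly n l x = (\<Sum>i\<le>l. jac_coef n l i * x ^ i)"

text \<open>The coefficient of the Jacobi polynomial of degree \<open>l\<close> in the expansion of \<open>x^k\<close>, that is, the
  inverse of the triangular matrix formed by the \<open>jac_coef n\<close>.\<close>

definition jac_inv :: "nat \<Rightarrow> nat \<Rightarrow> nat \<Rightarrow> complex" where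
  "jac_inv n k l = (-1) ^ (k + l) * of_nat ((n + k) choose (n + l)) * of_nat (2 * n + 2 * l + 1)
     * fact (2 * n + l) * fact k / fact (2 * n + k + l + 1)"

lemma jac_coef_eq_0: "l < i \<Longrightarrow> jac_coef n l i = 0"
  by (simp add: jac_coef_def)

lemma jac_inv_eq_0: "k < l \<Longrightarrow> jac_inv n k l = 0"
  by (simp add: jac_inv_def)

text \<open>The two products of the triangular matrices lead to alternating sums of quotients of factorials,
  here of length \<open>E + r + 2\<close>. Their terms are differences of a hypergeometric sequence, so already the
  partial sums up to \<open>E\<close> have a closed form, which induction proves. Writing the length through \<open>r\<close>
  keeps the natural number subtraction harmless.\<close>

lemma alternating_partial_sum_1:
  "(\<Sum>e\<le>E. (-1) ^ e * of_nat (M + 2 * e + 1) * fact (M + e)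
      / (fact e * fact (E + 1 + r - e) * fact (M + (E + 1 + r) + e + 1)))
   = ((-1) ^ E * fact (M + E + 1)
      / (fact E * fact r * fact (M + (E + 1 + r) + E + 1) * of_nat (E + 1 + r)) :: complex)"
proof (induction E arbitrary: r)
  case 0
  have "of_nat (Suc r) \<noteq> (0::complex)" by (rule of_nat_neq_0)
  then show ?case by (simp add: field_simps)
next
  case (Suc E)
  have e1: "E + 1 + Suc r = Suc E + 1 + r" by simp
  have e2: "Suc E + 1 + r - Suc E = Suc r" by simp
  have e3: "M + (Suc E + 1 + r) + Suc E + 1 = Suc (M + (Suc E + 1 + r) + E + 1)" by simp
  have e4: "M + Suc E = M + E + 1" "M + E + 1 + 1 = Suc (M + E + 1)" by simp_all
  have step: "(-1) ^ E * A / (C * (of_nat (Suc r) * D) * B * of_nat (Suc E + 1 + r))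
     + (-1) ^ Suc E * of_nat (M + 2 * Suc E + 1) * A
       / (of_nat (Suc E) * C * (of_nat (Suc r) * D) * (of_nat (Suc (M + (Suc E + 1 + r) + E + 1)) * B))
     = (-1) ^ Suc E * (of_nat (Suc (M + E + 1)) * A)
       / (of_nat (Suc E) * C * D * (of_nat (Suc (M + (Suc E + 1 + r) + E + 1)) * B) * of_nat (Suc E + 1 + r))"
    if "B \<noteq> 0" "C \<noteq> 0" "D \<noteq> 0" for A B C D :: complex
  proof -
    have nz: "of_nat (Suc r) \<noteq> (0::complex)" "of_nat (Suc E) \<noteq> (0::complex)"
      "of_nat (Suc E + 1 + r) \<noteq> (0::complex)"
      "of_nat (Suc (M + (Suc E + 1 + r) + E + 1)) \<noteq> (0::complex)"
      unfolding of_nat_eq_0_iff by simp_all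
    show ?thesis
      using nz that by (simp add: divide_simps del: of_nat_Suc of_nat_add) (simp add: algebra_simps)
  qed
  show ?case
    unfolding sum.atMost_Suc Suc.IH[of "Suc r", unfolded e1] e2 e3 e4 fact_Suc
    by (rule step) (rule fact_nonzero)+
qed

lemma alternating_partial_sum_2:
  "(\<Sum>e\<le>E. (-1) ^ e * fact (M + (E + 1 + r) + e)
      / (fact e * fact (E + 1 + r - e) * fact (M + e + 1)))
   = ((-1) ^ E * fact (M + (E + 1 + r) + E + 1)
      / (fact E * fact r * fact (M + E + 1) * of_nat (E + 1 + r) * of_nat (M + (E + 1 + r) + 1)) :: complex)"
proof (induction E arbitrary: r)
  case 0
  have "of_nat (Suc r) \<noteq> (0::complex)" "of_nat (M + r + 2) \<noteq> (0::complex)"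
    unfolding of_nat_eq_0_iff by simp_all
  then show ?case by (simp add: divide_simps)
next
  case (Suc E)
  have e1: "E + 1 + Suc r = Suc E + 1 + r" by simp
  have e2: "Suc E + 1 + r - Suc E = Suc r" by simp
  have e3: "M + Suc E + 1 = Suc (M + E + 1)" by simp
  have e4: "M + (Suc E + 1 + r) + Suc E = M + (Suc E + 1 + r) + E + 1"
    "M + (Suc E + 1 + r) + E + 1 + 1 = Suc (M + (Suc E + 1 + r) + E + 1)" by simp_all
  have step: "(-1) ^ E * A / (C * (of_nat (Suc r) * D) * B * of_nat (Suc E + 1 + r) * of_nat (M + (Suc E + 1 + r) + 1))
     + (-1) ^ Suc E * A / (of_nat (Suc E) * C * (of_nat (Suc r) * D) * (of_nat (Suc (M + E + 1)) * B))
     = (-1) ^ Suc E * (of_nat (Suc (M + (Suc E + 1 + r) + E + 1)) * A)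
       / (of_nat (Suc E) * C * D * (of_nat (Suc (M + E + 1)) * B) * of_nat (Suc E + 1 + r) * of_nat (M + (Suc E + 1 + r) + 1))"
    if "B \<noteq> 0" "C \<noteq> 0" "D \<noteq> 0" for A B C D :: complex
  proof -
    have nz: "of_nat (Suc r) \<noteq> (0::complex)" "of_nat (Suc E) \<noteq> (0::complex)"
      "of_nat (Suc E + 1 + r) \<noteq> (0::complex)" "of_nat (Suc (M + E + 1)) \<noteq> (0::complex)"
      "of_nat (M + (Suc E + 1 + r) + 1) \<noteq> (0::complex)"
      unfolding of_nat_eq_0_iff by simp_all
    show ?thesis
      using nz that by (simp add: divide_simps del: of_nat_Suc of_nat_add) (simp add: algebra_simps)
  qed
  show ?case
    unfolding sum.atMost_Suc Suc.IH[of "Suc r", unfolded e1] e2 e3 e4 fact_Suc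
    by (rule step) (rule fact_nonzero)+
qed

lemma alternating_sum_1:
  "(\<Sum>e\<le>d. (-1) ^ e * of_nat (M + 2 * e + 1) * fact (M + e)
      / (fact e * fact (d - e) * fact (M + d + e + 1))) = (if d = 0 then 1 else 0 :: complex)"
proof (cases d)
  case 0
  have "of_nat (Suc M) \<noteq> (0::complex)" by (rule of_nat_neq_0)
  with 0 show ?thesis by simp
next
  case (Suc E)
  have e1: "E + 1 + 0 = Suc E" by simp
  have e3: "M + Suc E + Suc E + 1 = Suc (M + Suc E + E + 1)" by simp
  have e4: "M + Suc E = M + E + 1" "M + E + 1 + Suc E + 1 = Suc (M + E + 1 + E + 1)" by simp_all
  have step: "(-1) ^ E * A / (C * 1 * B * of_nat (Suc E))
     + (-1) ^ Suc E * of_nat (M + 2 * Suc E + 1) * A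
       / (of_nat (Suc E) * C * 1 * (of_nat (Suc (M + E + 1 + E + 1)) * B)) = 0"
    if "B \<noteq> 0" "C \<noteq> 0" for A B C :: complex
  proof -
    have nz: "of_nat (Suc E) \<noteq> (0::complex)" "of_nat (Suc (M + E + 1 + E + 1)) \<noteq> (0::complex)"
      unfolding of_nat_eq_0_iff by simp_all
    show ?thesis
      using nz that by (simp add: divide_simps del: of_nat_Suc of_nat_add)
  qed
  have "(\<Sum>e\<le>Suc E. (-1) ^ e * of_nat (M + 2 * e + 1) * fact (M + e)
      / (fact e * fact (Suc E - e) * fact (M + Suc E + e + 1))) = (0 :: complex)"
    unfolding sum.atMost_Suc alternating_partial_sum_1[of M E 0, unfolded e1, unfolded e4] diff_self_eq_0 e4 fact_Suc fact_0
    by (rule step) (rule fact_nonzero)+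
  with Suc show ?thesis by simp
qed

lemma alternating_sum_2:
  "(\<Sum>e\<le>d. (-1) ^ e * fact (M + d + e)
      / (fact e * fact (d - e) * fact (M + e + 1))) = (if d = 0 then 1 / of_nat (M + 1) else 0 :: complex)"
proof (cases d)
  case 0
  have "of_nat (Suc M) \<noteq> (0::complex)" by (rule of_nat_neq_0)
  with 0 show ?thesis by simp
next
  case (Suc E)
  have e1: "E + 1 + 0 = Suc E" by simp
  have e4: "M + Suc E + Suc E = M + Suc E + E + 1" "M + Suc E + 1 = Suc (M + E + 1)" by simp_all
  have step: "(-1) ^ E * A / (C * 1 * B * of_nat (Suc E) * of_nat (Suc (M + E + 1)))
     + (-1) ^ Suc E * A / (of_nat (Suc E) * C * 1 * (of_nat (Suc (M + E + 1)) * B)) = 0"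
    if "B \<noteq> 0" "C \<noteq> 0" for A B C :: complex
  proof -
    have nz: "of_nat (Suc E) \<noteq> (0::complex)" "of_nat (Suc (M + E + 1)) \<noteq> (0::complex)"
      unfolding of_nat_eq_0_iff by simp_all
    show ?thesis
      using nz that by (simp add: divide_simps del: of_nat_Suc of_nat_add)
  qed
  have "(\<Sum>e\<le>Suc E. (-1) ^ e * fact (M + Suc E + e)
      / (fact e * fact (Suc E - e) * fact (M + e + 1))) = (0 :: complex)"
    unfolding sum.atMost_Suc alternating_partial_sum_2[of M E 0, unfolded e1, unfolded e4] diff_self_eq_0 e4 fact_Suc fact_0
    by (rule step) (rule fact_nonzero)+
  with Suc show ?thesis by simp
qed

lemma jac_coef_fact:
  assumes "e \<le> d"
  shows "jac_coef n (i + d) (i + e) = fact (n + i + d) * fact (2 * n + 2 * i + d + e)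
     / (fact (n + i + e) * fact (d - e) * fact (i + e) * fact (2 * n + i + d))"
proof -
  have 1: "n + (i + d) - (n + (i + e)) = d - e" by simp
  have 2: "2 * n + (i + d) + (i + e) - (i + e) = 2 * n + i + d" by simp
  show ?thesis
    unfolding jac_coef_def using assms
    by (simp add: binomial_fact 1 2) (simp add: algebra_simps)
qed

lemma jac_inv_fact:
  assumes "e \<le> d"
  shows "jac_inv n (i + d) (i + e) = (-1) ^ (d + e) * fact (n + i + d) * of_nat (2 * n + 2 * i + 2 * e + 1)
     * fact (2 * n + i + e) * fact (i + d)
     / (fact (n + i + e) * fact (d - e) * fact (2 * n + 2 * i + d + e + 1))"
proof -
  have 1: "n + (i + d) - (n + (i + e)) = d - e" by simp
  have 2: "(-1) ^ (i + d + (i + e)) = ((-1) ^ (d + e) :: complex)"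
    by (simp add: power_add flip: power_mult_distrib)
  show ?thesis
    unfolding jac_inv_def 2 using assms
    by (simp add: binomial_fact 1) (simp add: algebra_simps)
qed

text \<open>Up to a factor that does not depend on \<open>l\<close>, the sum is the first alternating sum with
  \<open>M = 2 (n + i)\<close>.\<close>

lemma jac_inv_coef:
  assumes "i \<le> k"
  shows "(\<Sum>l\<in>{i..k}. jac_inv n k l * jac_coef n l i) = (if k = i then 1 else 0)"
proof -
  obtain d where k: "k = i + d" using assms le_Suc_ex by blast
  define K :: complex where "K = (-1) ^ d * fact (n + i + d) * fact (i + d) / (fact (n + i) * fact i)"
  have "(\<Sum>l\<in>{i..k}. jac_inv n k l * jac_coef n l i) = (\<Sum>e\<le>d. jac_inv n (i + d) (i + e) * jac_coef n (i + e) (i + 0))"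
    by (rule sum.reindex_bij_witness[where i = "\<lambda>e. i + e" and j = "\<lambda>l. l - i"]) (auto simp: k)
  also have "\<dots> = (\<Sum>e\<le>d. K * ((-1) ^ e * of_nat ((2*n+2*i) + 2 * e + 1) * fact ((2*n+2*i) + e)
      / (fact e * fact (d - e) * fact ((2*n+2*i) + d + e + 1))))"
  proof (rule sum.cong[OF refl])
    fix e assume "e \<in> {..d}"
    then have e: "e \<le> d" by simp
    show "jac_inv n (i + d) (i + e) * jac_coef n (i + e) (i + 0) = K * ((-1) ^ e * of_nat ((2*n+2*i) + 2 * e + 1) * fact ((2*n+2*i) + e)
      / (fact e * fact (d - e) * fact ((2*n+2*i) + d + e + 1)))"
      unfolding jac_inv_fact[OF e] jac_coef_fact[OF le0]
      by (simp add: K_def divide_simps power_add)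
  qed
  also have "\<dots> = K * (if d = 0 then 1 else 0)"
    by (simp only: sum_distrib_left[symmetric] alternating_sum_1)
  finally show ?thesis by (simp add: k K_def)
qed

text \<open>Up to a factor that does not depend on \<open>i\<close>, the sum is the second alternating sum with
  \<open>M = 2 (n + l')\<close>.\<close>

lemma jac_coef_inv:
  assumes "l' \<le> l"
  shows "(\<Sum>i\<in>{l'..l}. jac_coef n l i * jac_inv n i l') = (if l = l' then 1 else 0)"
proof -
  obtain d where l: "l = l' + d" using assms le_Suc_ex by blast
  define M where "M = 2 * n + 2 * l'"
  define K :: complex where "K = fact (n + l' + d) * of_nat (M + 1) * fact (2 * n + l') / (fact (n + l') * fact (2 * n + l' + d))"
  have "(\<Sum>i\<in>{l'..l}. jac_coef n l i * jac_inv n i l') = (\<Sum>e\<le>d. jac_coef n (l' + d) (l' + e) * jac_inv n (l' + e) (l' + 0))"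
    by (rule sum.reindex_bij_witness[where i = "\<lambda>e. l' + e" and j = "\<lambda>l. l - l'"]) (auto simp: l)
  also have "\<dots> = (\<Sum>e\<le>d. K * ((-1) ^ e * fact (M + d + e) / (fact e * fact (d - e) * fact (M + e + 1))))"
  proof (rule sum.cong[OF refl])
    fix e assume "e \<in> {..d}"
    then have e: "e \<le> d" by simp
    show "jac_coef n (l' + d) (l' + e) * jac_inv n (l' + e) (l' + 0) = K * ((-1) ^ e * fact (M + d + e) / (fact e * fact (d - e) * fact (M + e + 1)))"
      unfolding jac_inv_fact[OF le0] jac_coef_fact[OF e]
      by (simp add: K_def M_def divide_simps power_add)
  qed
  also have "\<dots> = K * (if d = 0 then 1 / of_nat (M + 1) else 0)"
    by (simp only: sum_distrib_left[symmetric] alternating_sum_2)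
  also have "\<dots> = (if l = l' then 1 else 0)"
    using of_nat_neq_0[of M, where 'a = complex] by (simp add: l K_def)
  finally show ?thesis .
qed

lemma power_eq_jac_poly_sum:
  "x ^ k = (\<Sum>l\<le>k. jac_inv n k l * jac_poly n l x)"
proof -
  have "(\<Sum>l\<le>k. jac_inv n k l * jac_poly n l x) = (\<Sum>l\<le>k. \<Sum>i\<le>k. jac_inv n k l * jac_coef n l i * x ^ i)"
    unfolding jac_poly_def sum_distrib_left
    by (intro sum.cong[OF refl] sum.mono_neutral_cong_left) (auto simp: jac_coef_eq_0 mult.assoc)
  also have "\<dots> = (\<Sum>i\<le>k. (\<Sum>l\<le>k. jac_inv n k l * jac_coef n l i) * x ^ i)"
    by (subst sum.swap) (simp add: sum_distrib_right)
  also have "\<dots> = (\<Sum>i\<le>k. (if k = i then 1 else 0) * x ^ i)"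
  proof (intro sum.cong[OF refl] arg_cong2[where f = times] refl)
    fix i assume i: "i \<in> {..k}"
    have "(\<Sum>l\<le>k. jac_inv n k l * jac_coef n l i) = (\<Sum>l\<in>{i..k}. jac_inv n k l * jac_coef n l i)"
      by (rule sum.mono_neutral_right) (auto simp: jac_coef_eq_0)
    then show "(\<Sum>l\<le>k. jac_inv n k l * jac_coef n l i) = (if k = i then 1 else 0)"
      using jac_inv_coef[of i k n] i by simp
  qed
  also have "\<dots> = (\<Sum>i\<in>{k}. (if k = i then 1 else 0) * x ^ i)"
    by (rule sum.mono_neutral_right) auto
  finally show ?thesis by simp
qed

text \<open>For \<open>l \<le> k\<close> the modulus without the binomial coefficient is at most \<open>1\<close>: the product
  \<open>fact (2 * n + l) * fact k\<close> is at most \<open>fact (2 * n + l + k)\<close>, and \<open>2 * n + 2 * l + 1\<close> is at most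
  the last factor \<open>2 * n + k + l + 1\<close> of the denominator.\<close>

lemma norm_jac_inv_le: "norm (jac_inv n k l) \<le> 2 ^ (n + k)"
proof (cases "l \<le> k")
  case False
  then show ?thesis by (simp add: jac_inv_eq_0)
next
  case True
  have f: "real (2 * n + 2 * l + 1) * fact (2 * n + l) * fact k \<le> fact (2 * n + k + l + 1)"
  proof -
    have "fact (2 * n + l) * fact k \<le> (fact (2 * n + l + k) :: real)"
      using fact_fact_dvd_fact[of "2 * n + l" k] 
      by (metis (mono_tags, lifting) dvd_imp_le fact_gt_zero of_nat_fact of_nat_le_iff of_nat_mult)
    moreover have "real (2 * n + 2 * l + 1) \<le> real (2 * n + k + l + 1)" using True by simp
    ultimately have "real (2 * n + 2 * l + 1) * (fact (2 * n + l) * fact k) \<le> real (2 * n + k + l + 1) * fact (2 * n + l + k)"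
      by (intro mult_mono) auto
    also have "\<dots> = fact (2 * n + k + l + 1)"
      using fact_Suc[of "2 * n + k + l", where 'a = real] by (simp add: algebra_simps)
    finally show ?thesis by (simp add: mult.assoc)
  qed
  have "norm (jac_inv n k l) = real ((n + k) choose (n + l)) *
      (real (2 * n + 2 * l + 1) * fact (2 * n + l) * fact k / fact (2 * n + k + l + 1))"
    unfolding jac_inv_def norm_mult norm_divide norm_power norm_fact norm_of_nat by simp
  also have "\<dots> \<le> 2 ^ (n + k) * 1"
  proof (rule mult_mono)
    show "real ((n + k) choose (n + l)) \<le> 2 ^ (n + k)"
      using binomial_le_pow2[of "n + k" "n + l"] by (metis of_nat_le_iff of_nat_numeral of_nat_power)
  qed (use f in \<open>auto simp: divide_le_eq\<close>)
  finally show ?thesis by simp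
qed

lemma norm_jac_coef_le: "i \<le> l \<Longrightarrow> norm (jac_coef n l i) \<le> 8 ^ (n + l)"
proof -
  assume "i \<le> l"
  have "norm (jac_coef n l i) = real (((n + l) choose (n + i)) * ((2 * n + l + i) choose i))"
    unfolding jac_coef_def norm_mult norm_of_nat by simp
  also have "\<dots> \<le> real (2 ^ (n + l) * 2 ^ (2 * n + l + i))"
    unfolding of_nat_le_iff by (intro mult_mono binomial_le_pow2) auto
  also have "\<dots> \<le> real (2 ^ (n + l) * 2 ^ (2 * (n + l)))"
    unfolding of_nat_le_iff using \<open>i \<le> l\<close> by (intro mult_left_mono power_increasing) auto
  also have "\<dots> = (2 ^ (n + l) * (2 ^ 2) ^ (n + l))"
    by (simp only: power_mult of_nat_mult of_nat_power of_nat_numeral)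
  also have "\<dots> = (8 ^ (n + l) :: real)"
    by (simp only: power_mult_distrib[symmetric]) simp
  finally show ?thesis .
qed

lemma norm_jac_poly_le:
  assumes "norm x \<le> R" "1 \<le> R"
  shows "norm (jac_poly n l x) \<le> (16 * R) ^ (n + l)"
proof -
  have "norm (jac_poly n l x) \<le> (\<Sum>i\<le>l. norm (jac_coef n l i * x ^ i))"
    unfolding jac_poly_def by (rule norm_sum)
  also have "\<dots> \<le> (\<Sum>i\<le>l. 8 ^ (n + l) * R ^ (n + l))"
  proof (intro sum_mono)
    fix i assume i: "i \<in> {..l}"
    have "norm x ^ i \<le> R ^ i" using assms by (intro power_mono) auto
    also have "\<dots> \<le> R ^ (n + l)" using assms i by (intro power_increasing) auto
    finally show "norm (jac_coef n l i * x ^ i) \<le> 8 ^ (n + l) * R ^ (n + l)"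
      unfolding norm_mult norm_power using i by (intro mult_mono norm_jac_coef_le) auto
  qed
  also have "\<dots> = real (Suc l) * (8 * R) ^ (n + l)" by (simp add: power_mult_distrib)
  also have "\<dots> \<le> 2 ^ (n + l) * (8 * R) ^ (n + l)"
  proof (rule mult_right_mono)
    have "Suc l \<le> 2 ^ l" by (induction l) auto
    also have "(2::nat) ^ l \<le> 2 ^ (n + l)" by (intro power_increasing) auto
    finally show "real (Suc l) \<le> 2 ^ (n + l)"
      by (metis of_nat_le_iff of_nat_numeral of_nat_power)
  qed (use assms in auto)
  also have "\<dots> = (2 * (8 * R)) ^ (n + l)" by (rule power_mult_distrib[symmetric])
  also have "\<dots> = (16 * R) ^ (n + l)" by simp
  finally show ?thesis .
qed

section \<open>Splitting double series by weight\<close>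

text \<open>The equation says that the entire function \<open>E\<close> tends to \<open>L 0 = 0\<close> at infinity, so Liouville's
  theorem applies.\<close>

lemma laurent_parts_vanish:
  fixes e l :: "nat \<Rightarrow> complex"
  assumes E: "\<And>s. (\<lambda>n. e n * s ^ n) sums E s" and L: "\<And>t. (\<lambda>n. l n * t ^ n) sums L t"
    and l0: "l 0 = 0" and eq: "\<And>s. s \<noteq> 0 \<Longrightarrow> E s = L (1 / s)"
  shows "E s = 0"
proof (rule Liouville_weak[where f = E])
  have "E holomorphic_on ball 0 r" for r
    by (rule power_series_holomorphic) (use E in simp)
  then have "E field_differentiable (at z)" for z
    by (rule holomorphic_on_imp_differentiable_at[OF _ open_ball[of 0 "norm z + 1"]]) auto
  then show "E holomorphic_on UNIV" by (simp add: holomorphic_on_def)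
  have "L holomorphic_on ball 0 1"
    by (rule power_series_holomorphic) (use L in simp)
  then have "isCont L 0"
    using holomorphic_on_imp_continuous_on continuous_on_eq_continuous_at[of "ball 0 1" L] by simp
  moreover have "L 0 = 0" using L[of 0] l0 by simp
  ultimately have "(L \<longlongrightarrow> 0) (nhds 0)" by (metis isCont_def tendsto_at_iff_tendsto_nhds)
  moreover have "filterlim (\<lambda>s::complex. 1 / s) (nhds 0) at_infinity"
    using tendsto_inverse_0 by (simp add: divide_inverse)
  ultimately have "((\<lambda>s. L (1 / s)) \<longlongrightarrow> 0) at_infinity"
    by (rule filterlim_compose)
  moreover have "eventually (\<lambda>s. E s = L (1 / s)) at_infinity"
    unfolding eventually_at_infinity
  proof (intro exI[of _ 1] allI impI)
    fix s :: complex assume "1 \<le> norm s"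
    then have "s \<noteq> 0" by auto
    then show "E s = L (1 / s)" by (rule eq)
  qed
  ultimately show "(E \<longlongrightarrow> 0) at_infinity" 
    by (subst filterlim_cong[OF refl refl])
qed

text \<open>The second family starts one step below the main diagonal, which belongs to the first.\<close>

lemma has_sum_diagonals:
  fixes \<gamma> :: "nat \<times> nat \<Rightarrow> complex"
  assumes "(\<gamma> has_sum S) UNIV"
  obtains U V where "((\<lambda>n. \<Sum>\<^sub>\<infinity>k. \<gamma> (k, k + n)) has_sum U) UNIV"
    "((\<lambda>n. \<Sum>\<^sub>\<infinity>k. \<gamma> (k + Suc n, k)) has_sum V) UNIV" "S = U + V"
proof -
  have sm: "\<gamma> summable_on X" for X
    using assms has_sum_imp_summable summable_on_subset by blast
  define U where "U = infsum \<gamma> {(i, j). i \<le> j}"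
  define V where "V = infsum \<gamma> {(i, j). j < i}"
  have U: "(\<gamma> has_sum U) {(i, j). i \<le> j}" and V: "(\<gamma> has_sum V) {(i, j). j < i}"
    unfolding U_def V_def by (rule has_sum_infsum[OF sm])+
  have "(\<gamma> has_sum U + V) ({(i, j). i \<le> j} \<union> {(i, j). j < i})"
    by (rule has_sum_Un_disjoint[OF U V]) auto
  moreover have "{(i, j). i \<le> j} \<union> {(i, j). j < i} = (UNIV :: (nat \<times> nat) set)" by auto
  ultimately have S: "S = U + V" using assms has_sum_unique by metis
  have "bij_betw (\<lambda>(n, k). (k, k + n)) (UNIV \<times> UNIV) {(i, j). i \<le> (j::nat)}"
    by (rule bij_betw_byWitness[where f' = "\<lambda>(i, j). (j - i, i)"]) auto
  from has_sum_reindex_bij_betw[OF this, of \<gamma> U] U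
  have U': "((\<lambda>(n, k). \<gamma> (k, k + n)) has_sum U) (UNIV \<times> UNIV)"
    by (simp add: case_prod_beta')
  have "bij_betw (\<lambda>(n, k). (k + Suc n, k)) (UNIV \<times> UNIV) {(i, j). j < (i::nat)}"
    by (rule bij_betw_byWitness[where f' = "\<lambda>(i, j). (i - Suc j, j)"]) auto
  from has_sum_reindex_bij_betw[OF this, of \<gamma> V] V
  have V': "((\<lambda>(n, k). \<gamma> (k + Suc n, k)) has_sum V) (UNIV \<times> UNIV)"
    by (simp add: case_prod_beta')
  have "((\<lambda>n. \<Sum>\<^sub>\<infinity>k. \<gamma> (k, k + n)) has_sum U) UNIV"
    by (rule has_sum_SigmaD[OF U']) 
       (use summable_on_SigmaD1[OF has_sum_imp_summable[OF U']] in simp)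
  moreover have "((\<lambda>n. \<Sum>\<^sub>\<infinity>k. \<gamma> (k + Suc n, k)) has_sum V) UNIV"
    by (rule has_sum_SigmaD[OF V']) 
       (use summable_on_SigmaD1[OF has_sum_imp_summable[OF V']] in simp)
  ultimately show ?thesis using S that by blast
qed

text \<open>Both hypotheses are Laurent expansions of \<open>\<Phi>\<close>: in the first, \<open>(i, j)\<close> contributes to \<open>s^(j - i)\<close>,
  in the second to \<open>s^(i - j)\<close>. Subtracting them, the nonnegative powers form an entire function of
  \<open>s\<close> that equals a power series in \<open>1 / s\<close> without constant term, so both vanish. Hence the
  nonnegative powers may be taken from the first expansion and the negative ones from the second.\<close>

lemma weight_split:
  fixes \<alpha> \<beta> :: "nat \<Rightarrow> nat \<Rightarrow> complex"
  assumes \<alpha>: "\<And>s. s \<noteq> 0 \<Longrightarrow> ((\<lambda>(i, j). \<alpha> i j * (s ^ j / s ^ i)) has_sum \<Phi> s) UNIV"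
    and \<beta>: "\<And>s. s \<noteq> 0 \<Longrightarrow> ((\<lambda>(i, j). \<beta> i j * (s ^ i / s ^ j)) has_sum \<Phi> s) UNIV"
  obtains U V where "((\<lambda>n. \<Sum>\<^sub>\<infinity>k. \<alpha> k (k + n)) has_sum U) UNIV"
    "((\<lambda>n. \<Sum>\<^sub>\<infinity>k. \<beta> k (k + Suc n)) has_sum V) UNIV" "\<Phi> 1 = U + V"
proof -
  define ua da ub db where "ua n = (\<Sum>\<^sub>\<infinity>k. \<alpha> k (k + n))" and "da n = (\<Sum>\<^sub>\<infinity>k. \<alpha> (k + n) k)"
    and "ub n = (\<Sum>\<^sub>\<infinity>k. \<beta> k (k + n))" and "db n = (\<Sum>\<^sub>\<infinity>k. \<beta> (k + n) k)" for n
  have p1: "s ^ (k + n) / s ^ k = s ^ n" and p2: "s ^ k / s ^ (k + n) = (1 / s) ^ n"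
    if "s \<noteq> 0" for s :: complex and k n
    using that by (simp_all add: power_add power_divide)
  have A: "\<exists>U V. ((\<lambda>n. ua n * s ^ n) has_sum U) UNIV \<and> ((\<lambda>n. da (Suc n) * (1 / s) ^ Suc n) has_sum V) UNIV
      \<and> \<Phi> s = U + V" if s: "s \<noteq> 0" for s
  proof -
    obtain U V where "((\<lambda>n. \<Sum>\<^sub>\<infinity>k. \<alpha> k (k + n) * (s ^ (k + n) / s ^ k)) has_sum U) UNIV"
      "((\<lambda>n. \<Sum>\<^sub>\<infinity>k. \<alpha> (k + Suc n) k * (s ^ k / s ^ (k + Suc n))) has_sum V) UNIV" "\<Phi> s = U + V"
      using has_sum_diagonals[OF \<alpha>[OF s]] by (auto simp only: prod.case)
    then show ?thesis
      unfolding p1[OF s] p2[OF s] infsum_cmult_left' ua_def da_def by blast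
  qed
  have B: "\<exists>U V. ((\<lambda>n. ub n * (1 / s) ^ n) has_sum U) UNIV \<and> ((\<lambda>n. db (Suc n) * s ^ Suc n) has_sum V) UNIV
      \<and> \<Phi> s = U + V" if s: "s \<noteq> 0" for s
  proof -
    obtain U V where "((\<lambda>n. \<Sum>\<^sub>\<infinity>k. \<beta> k (k + n) * (s ^ k / s ^ (k + n))) has_sum U) UNIV"
      "((\<lambda>n. \<Sum>\<^sub>\<infinity>k. \<beta> (k + Suc n) k * (s ^ (k + Suc n) / s ^ k)) has_sum V) UNIV" "\<Phi> s = U + V"
      using has_sum_diagonals[OF \<beta>[OF s]] by (auto simp only: prod.case)
    then show ?thesis
      unfolding p1[OF s] p2[OF s] infsum_cmult_left' ub_def db_def by blast
  qed
  define e where "e n = ua n - db n" for n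
  define l where "l n = (if n = 0 then 0 else ub n - da n)" for n
  define E where "E s = (\<Sum>n. e n * s ^ n)" for s
  define L where "L s = (\<Sum>n. l n * s ^ n)" for s
  have u0: "ub 0 = db 0" by (simp add: ub_def db_def)
  have main: "(\<lambda>n. e n * s ^ n) sums E s \<and> (\<lambda>n. l n * (1 / s) ^ n) sums L (1 / s) \<and> E s = L (1 / s)"
    if s: "s \<noteq> 0" for s
  proof -
    obtain U V where UV: "((\<lambda>n. ua n * s ^ n) has_sum U) UNIV"
      "((\<lambda>n. da (Suc n) * (1 / s) ^ Suc n) has_sum V) UNIV" "\<Phi> s = U + V" using A[OF s] by blast
    obtain U' V' where UV': "((\<lambda>n. ub n * (1 / s) ^ n) has_sum U') UNIV"
      "((\<lambda>n. db (Suc n) * s ^ Suc n) has_sum V') UNIV" "\<Phi> s = U' + V'" using B[OF s] by blast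
    have 1: "(\<lambda>n. ua n * s ^ n) sums U" "(\<lambda>n. da (Suc n) * (1 / s) ^ Suc n) sums V"
      "(\<lambda>n. ub n * (1 / s) ^ n) sums U'" "(\<lambda>n. db (Suc n) * s ^ Suc n) sums V'"
      using UV UV' has_sum_imp_sums by blast+
    have 2: "(\<lambda>n. db n * s ^ n) sums (V' + db 0)"
      using 1(4) sums_Suc_iff[of "\<lambda>n. db n * s ^ n" V'] by simp
    have 3: "(\<lambda>n. ub (Suc n) * (1 / s) ^ Suc n) sums (U' - db 0)"
      using 1(3) sums_Suc_iff[of "\<lambda>n. ub n * (1 / s) ^ n" "U' - db 0"] u0 by simp
    have 4: "(\<lambda>n. e n * s ^ n) sums (U - (V' + db 0))"
      unfolding e_def left_diff_distrib by (rule sums_diff[OF 1(1) 2])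
    have "(\<lambda>n. l (Suc n) * (1 / s) ^ Suc n) sums (U' - db 0 - V)"
      using sums_diff[OF 3 1(2)] by (simp add: l_def left_diff_distrib del: power_Suc)
    then have 5: "(\<lambda>n. l n * (1 / s) ^ n) sums (U' - db 0 - V)"
      using sums_Suc_iff[of "\<lambda>n. l n * (1 / s) ^ n" "U' - db 0 - V"] by (simp add: l_def)
    have "U - (V' + db 0) = U' - db 0 - V" using UV(3) UV'(3) by (simp add: algebra_simps)
    with 4 5 show ?thesis unfolding E_def L_def by (simp add: sums_iff)
  qed
  have "(\<lambda>n. e n * s ^ n) sums E s" for s
    using main[of s] by (cases "s = 0") (simp add: E_def, blast)
  moreover have "(\<lambda>n. l n * t ^ n) sums L t" for t
    using main[of "1 / t"] by (cases "t = 0") (simp add: L_def, auto)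
  ultimately have E0: "E 1 = 0"
    using laurent_parts_vanish[of e E l L 1] main by (auto simp: l_def)
  obtain U V where UV: "(ua has_sum U) UNIV" "\<Phi> 1 = U + V" using A[of 1] by auto
  obtain U' V' where UV': "(ub has_sum U') UNIV"
    "((\<lambda>n. db (Suc n)) has_sum V') UNIV" "\<Phi> 1 = U' + V'" using B[of 1] by auto
  have s: "ua sums U" "ub sums U'" "(\<lambda>n. db (Suc n)) sums V'"
    using UV UV' has_sum_imp_sums by blast+
  have "e sums (U - (V' + db 0))"
    unfolding e_def using sums_diff[OF s(1)] s(3) sums_Suc_iff[of db V'] by simp
  moreover have "e sums 0" using main[of 1] E0 by simp
  ultimately have U: "U = V' + db 0" using sums_unique2 by force
  have "((\<lambda>n. ub (Suc n)) has_sum (U' - ub 0)) UNIV"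
  proof -
    have "ub summable_on UNIV" using UV'(1) has_sum_imp_summable by blast
    then have "(ub has_sum infsum ub {0<..}) {0<..}"
      by (intro has_sum_infsum) (rule summable_on_subset, auto)
    moreover have "bij_betw Suc UNIV {0<..}"
      by (rule bij_betw_byWitness[where f' = "\<lambda>n. n - 1"]) auto
    ultimately have "((\<lambda>n. ub (Suc n)) has_sum infsum ub {0<..}) UNIV"
      using has_sum_reindex_bij_betw by blast
    moreover from has_sum_imp_sums[OF this] have "infsum ub {0<..} = U' - ub 0"
      using s(2) sums_Suc_iff[of ub "U' - ub 0"] by (auto dest: sums_unique2)
    ultimately show ?thesis by simp
  qed
  moreover have "\<Phi> 1 = U + (U' - ub 0)" using U UV'(3) u0 by simp
  ultimately show ?thesis using UV(1) that unfolding ua_def ub_def by blast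
qed

section \<open>Charts and coordinates of Omega\<close>

definition inf_chart :: "complex \<Rightarrow> sphere" where
  "inf_chart u = (if u = 0 then None else Some (1 / u))"

lemma sphere_params_eq: "sphere_params = {Some, inf_chart}"
  by (simp add: sphere_params_def inf_chart_def[abs_def])

lemma Omega_simps [simp]:
  "(Some z, Some w) \<in> Omega \<longleftrightarrow> z * w \<noteq> 1"
  "(None, Some w) \<in> Omega \<longleftrightarrow> w \<noteq> 0"
  "(Some z, None) \<in> Omega \<longleftrightarrow> z \<noteq> 0"
  "(None, None) \<in> Omega"
  by (auto simp: Omega_def)

lemma swap_in_Omega [simp]: "prod.swap p \<in> Omega \<longleftrightarrow> p \<in> Omega"
  by (cases p; cases "fst p"; cases "snd p") (auto simp: mult.commute)

lemma chart_in_Omega [simp]: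
  "(inf_chart u, Some w) \<in> Omega \<longleftrightarrow> u \<noteq> w"
  "(Some w, inf_chart u) \<in> Omega \<longleftrightarrow> u \<noteq> w"
  "(inf_chart u, inf_chart w) \<in> Omega \<longleftrightarrow> u * w \<noteq> 1"
  by (auto simp: inf_chart_def divide_simps)

text \<open>The functions \<open>w / (1 - z w)\<close> and \<open>z w / (1 - z w)\<close>, with the values of their holomorphic
  extensions at the points with an infinite coordinate.\<close>

fun coordC :: "sphere \<times> sphere \<Rightarrow> complex" where
  "coordC (Some z, Some w) = w / (1 - z * w)"
| "coordC (Some z, None) = - 1 / z"
| "coordC (None, _) = 0"

fun coordX :: "sphere \<times> sphere \<Rightarrow> complex" where
  "coordX (Some z, Some w) = z * w / (1 - z * w)"
| "coordX _ = -1"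

definition coordB :: "sphere \<times> sphere \<Rightarrow> complex" where
  "coordB p = coordC (prod.swap p)"

lemma coordX_swap [simp]: "coordX (prod.swap p) = coordX p"
  by (cases p; cases "fst p"; cases "snd p") (auto simp: mult.commute)

lemma coordX_swap' [simp]: "coordX (w, z) = coordX (z, w)"
  using coordX_swap[of "(z, w)"] by simp

lemma coordC_chart:
  "u \<noteq> w \<Longrightarrow> coordC (inf_chart u, Some w) = u * w / (u - w)"
  "u \<noteq> w \<Longrightarrow> coordC (Some w, inf_chart u) = 1 / (u - w)"
  "u * v \<noteq> 1 \<Longrightarrow> coordC (inf_chart u, inf_chart v) = u / (u * v - 1)"
  by (auto simp: inf_chart_def divide_simps)

lemma coordX_chart:
  "u \<noteq> w \<Longrightarrow> coordX (inf_chart u, Some w) = w / (u - w)"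
  "u \<noteq> w \<Longrightarrow> coordX (Some w, inf_chart u) = w / (u - w)"
  "u * v \<noteq> 1 \<Longrightarrow> coordX (inf_chart u, inf_chart v) = 1 / (u * v - 1)"
  by (auto simp: inf_chart_def divide_simps)

section \<open>Holomorphic functions on Omega\<close>

text \<open>Holomorphy on Omega of a function whose values outside Omega are arbitrary: this class is closed
  under the pointwise operations, without restriction to Omega after each of them.\<close>

definition holo :: "(sphere \<times> sphere \<Rightarrow> complex) \<Rightarrow> bool" where
  "holo F \<longleftrightarrow> (\<forall>\<phi>\<in>sphere_params. \<forall>\<psi>\<in>sphere_params. \<forall>u v. (\<phi> u, \<psi> v) \<in> Omega \<longrightarrow>
     cdiff2 (\<lambda>x. F (\<phi> (fst x), \<psi> (snd x))) (u, v))"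

lemma hol_Omega_iff: "F \<in> hol_Omega \<longleftrightarrow> F \<in> extensional Omega \<and> holo F"
  by (auto simp: hol_Omega_def holo_def holomorphic2_on_iff_cdiff2 case_prod_beta')

lemma open_chart_Omega:
  assumes "\<phi> \<in> sphere_params" "\<psi> \<in> sphere_params"
  shows "open {x. (\<phi> (fst x), \<psi> (snd x)) \<in> Omega}"
proof -
  have "open {x :: complex \<times> complex. fst x * snd x \<noteq> 1}" "open {x :: complex \<times> complex. fst x \<noteq> snd x}"
    by (intro open_Collect_neq continuous_intros)+
  then show ?thesis
    using assms by (auto simp: sphere_params_eq eq_commute[of "snd _" "fst _"])
qed

lemma holo_cong:
  assumes "\<And>p. p \<in> Omega \<Longrightarrow> F p = G p"
  shows "holo F \<longleftrightarrow> holo G"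
proof -
  have *: "holo G" if "holo F" "\<And>p. p \<in> Omega \<Longrightarrow> F p = G p" for F G
    unfolding holo_def
  proof (intro ballI allI impI)
    fix \<phi> \<psi> u v assume *: "\<phi> \<in> sphere_params" "\<psi> \<in> sphere_params" "(\<phi> u, \<psi> v) \<in> Omega"
    then have "cdiff2 (\<lambda>x. F (\<phi> (fst x), \<psi> (snd x))) (u, v)" using that(1) by (auto simp: holo_def)
    then show "cdiff2 (\<lambda>x. G (\<phi> (fst x), \<psi> (snd x))) (u, v)"
      by (rule cdiff2_cong[OF _ open_chart_Omega[OF *(1,2)]]) (use * that(2) in auto)
  qed
  from *[of F G] *[of G F] assms show ?thesis by metis
qed

lemma restrict_hol_Omega: "holo F \<Longrightarrow> restrict F Omega \<in> hol_Omega"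
  using holo_cong[of F "restrict F Omega"] by (auto simp: hol_Omega_iff)

lemma holo_const: "holo (\<lambda>_. k)"
  by (auto simp: holo_def)

lemma holo_add: "holo F \<Longrightarrow> holo G \<Longrightarrow> holo (\<lambda>p. F p + G p)"
  unfolding holo_def by (auto intro!: cdiff2_add)

lemma holo_mult: "holo F \<Longrightarrow> holo G \<Longrightarrow> holo (\<lambda>p. F p * G p)"
  unfolding holo_def by (auto intro!: cdiff2_mult)

lemma holo_sum: "(\<And>i. i \<in> I \<Longrightarrow> holo (F i)) \<Longrightarrow> holo (\<lambda>p. \<Sum>i\<in>I. F i p)"
  by (induction I rule: infinite_finite_induct) (auto intro: holo_add holo_const)

lemma holo_power: "holo F \<Longrightarrow> holo (\<lambda>p. F p ^ n)"
  by (induction n) (auto intro: holo_mult holo_const)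

lemma holo_swap:
  assumes "holo F" shows "holo (\<lambda>p. F (prod.swap p))"
  unfolding holo_def
proof (intro ballI allI impI)
  fix \<phi> \<psi> u v assume *: "\<phi> \<in> sphere_params" "\<psi> \<in> sphere_params" "(\<phi> u, \<psi> v) \<in> Omega"
  then have "(\<psi> v, \<phi> u) \<in> Omega" using swap_in_Omega[of "(\<phi> u, \<psi> v)"] by simp
  then have "cdiff2 (\<lambda>x. F (\<psi> (fst x), \<phi> (snd x))) (snd (u, v), fst (u, v))"
    using assms * by (auto simp: holo_def)
  from cdiff2_compose[OF cdiff2_snd cdiff2_fst this]
  show "cdiff2 (\<lambda>x. F (prod.swap (\<phi> (fst x), \<psi> (snd x)))) (u, v)" by simp
qed

lemma holoI:
  assumes "\<And>u v. u * v \<noteq> 1 \<Longrightarrow> cdiff2 (\<lambda>x. F (Some (fst x), Some (snd x))) (u, v)"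
    and "\<And>u v. u \<noteq> v \<Longrightarrow> cdiff2 (\<lambda>x. F (inf_chart (fst x), Some (snd x))) (u, v)"
    and "\<And>u v. u \<noteq> v \<Longrightarrow> cdiff2 (\<lambda>x. F (Some (fst x), inf_chart (snd x))) (u, v)"
    and "\<And>u v. u * v \<noteq> 1 \<Longrightarrow> cdiff2 (\<lambda>x. F (inf_chart (fst x), inf_chart (snd x))) (u, v)"
  shows "holo F"
  using assms by (auto simp: holo_def sphere_params_eq)

lemma cdiff2_cong_Omega:
  assumes "cdiff2 f (u, v)" "\<phi> \<in> sphere_params" "\<psi> \<in> sphere_params" "(\<phi> u, \<psi> v) \<in> Omega"
    "\<And>x. (\<phi> (fst x), \<psi> (snd x)) \<in> Omega \<Longrightarrow> f x = F (\<phi> (fst x), \<psi> (snd x))"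
  shows "cdiff2 (\<lambda>x. F (\<phi> (fst x), \<psi> (snd x))) (u, v)"
  by (rule cdiff2_cong[OF assms(1) open_chart_Omega[OF assms(2,3)]]) (use assms in auto)

lemma holo_coordC: "holo coordC"
proof (rule holoI)
  fix u v :: complex
  show "cdiff2 (\<lambda>x. coordC (Some (fst x), Some (snd x))) (u, v)" if "u * v \<noteq> 1"
    using that by (auto intro!: cdiff2_intros)
  show "cdiff2 (\<lambda>x. coordC (inf_chart (fst x), Some (snd x))) (u, v)" if "u \<noteq> v"
    by (rule cdiff2_cong_Omega[where f = "\<lambda>x. fst x * snd x / (fst x - snd x)"])
       (use that in \<open>auto intro!: cdiff2_intros simp: sphere_params_eq coordC_chart\<close>)
  show "cdiff2 (\<lambda>x. coordC (Some (fst x), inf_chart (snd x))) (u, v)" if "u \<noteq> v"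
    by (rule cdiff2_cong_Omega[where f = "\<lambda>x. 1 / (snd x - fst x)"])
       (use that in \<open>auto intro!: cdiff2_intros simp: sphere_params_eq coordC_chart\<close>)
  show "cdiff2 (\<lambda>x. coordC (inf_chart (fst x), inf_chart (snd x))) (u, v)" if "u * v \<noteq> 1"
    by (rule cdiff2_cong_Omega[where f = "\<lambda>x. fst x / (fst x * snd x - 1)"])
       (use that in \<open>auto intro!: cdiff2_intros simp: sphere_params_eq coordC_chart\<close>)
qed

lemma holo_coordX: "holo coordX"
proof (rule holoI)
  fix u v :: complex
  show "cdiff2 (\<lambda>x. coordX (Some (fst x), Some (snd x))) (u, v)" if "u * v \<noteq> 1"
    using that by (auto intro!: cdiff2_intros)
  show "cdiff2 (\<lambda>x. coordX (inf_chart (fst x), Some (snd x))) (u, v)" if "u \<noteq> v"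
    by (rule cdiff2_cong_Omega[where f = "\<lambda>x. snd x / (fst x - snd x)"])
       (use that in \<open>auto intro!: cdiff2_intros simp: sphere_params_eq coordX_chart\<close>)
  show "cdiff2 (\<lambda>x. coordX (Some (fst x), inf_chart (snd x))) (u, v)" if "u \<noteq> v"
    by (rule cdiff2_cong_Omega[where f = "\<lambda>x. fst x / (snd x - fst x)"])
       (use that in \<open>auto intro!: cdiff2_intros simp: sphere_params_eq coordX_chart\<close>)
  show "cdiff2 (\<lambda>x. coordX (inf_chart (fst x), inf_chart (snd x))) (u, v)" if "u * v \<noteq> 1"
    by (rule cdiff2_cong_Omega[where f = "\<lambda>x. 1 / (fst x * snd x - 1)"])
       (use that in \<open>auto intro!: cdiff2_intros simp: sphere_params_eq coordX_chart\<close>)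
qed

lemma holo_coordB: "holo coordB"
  unfolding coordB_def by (rule holo_swap[OF holo_coordC])

section \<open>Parametrisation of the part with finite first coordinate\<close>

text \<open>The inverse of \<open>(z, w) \<mapsto> (z, c)\<close> on the points of Omega with finite \<open>z\<close>. Solving
  \<open>c = w / (1 - z w)\<close> gives \<open>w = c / (1 + z c)\<close>, and \<open>w = \<infinity>\<close> is reached exactly where
  \<open>1 + z c = 0\<close>.\<close>

definition param :: "complex \<times> complex \<Rightarrow> sphere \<times> sphere" where
  "param p = (Some (fst p), if 1 + fst p * snd p = 0 then None else Some (snd p / (1 + fst p * snd p)))"

lemma param_in_Omega [simp]: "param p \<in> Omega"
  by (auto simp: param_def divide_simps)

lemma coordC_param: "coordC (param p) = snd p"
proof (cases "1 + fst p * snd p = 0")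
  case True
  then have "fst p * snd p = - 1" by (simp add: add_eq_0_iff)
  then show ?thesis using True by (auto simp: param_def divide_simps mult.commute)
next
  case False
  then show ?thesis by (auto simp: param_def divide_simps)
qed

lemma coordX_param: "coordX (param p) = fst p * snd p"
proof (cases "1 + fst p * snd p = 0")
  case True
  then show ?thesis by (simp add: param_def add_eq_0_iff)
next
  case False
  then show ?thesis by (auto simp: param_def divide_simps)
qed

lemma param_coordC: "(Some z, w) \<in> Omega \<Longrightarrow> param (z, coordC (Some z, w)) = (Some z, w)"
  by (cases w) (auto simp: param_def divide_simps)

lemma param_coordB: "(z, Some w) \<in> Omega \<Longrightarrow> prod.swap (param (w, coordB (z, Some w))) = (z, Some w)"
  using param_coordC[of w z] swap_in_Omega[of "(z, Some w)"] by (simp add: coordB_def)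

lemma param_chart:
  "1 + fst p * snd p \<noteq> 0 \<Longrightarrow> param p = (Some (fst p), Some (snd p / (1 + fst p * snd p)))"
  "snd p \<noteq> 0 \<Longrightarrow> param p = (Some (fst p), inf_chart ((1 + fst p * snd p) / snd p))"
  by (auto simp: param_def inf_chart_def)

lemma open_param_charts:
  "open {p :: complex \<times> complex. 1 + fst p * snd p \<noteq> 0}" "open {p :: complex \<times> complex. snd p \<noteq> 0}"
  by (intro open_Collect_neq continuous_intros)+

text \<open>Near every point one of \<open>1 + z c\<close> and \<open>c\<close> is nonzero, and then the first or the second chart,
  respectively, describes the second component of \<open>param\<close> by a quotient of polynomials.\<close>

lemma holomorphic_param:
  assumes "holo F" shows "holomorphic2_on (\<lambda>p. F (param p)) UNIV"
  unfolding holomorphic2_on_iff_cdiff2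
proof
  fix p :: "complex \<times> complex"
  show "cdiff2 (\<lambda>p. F (param p)) p"
  proof (cases "snd p = 0")
    case True
    then have p: "1 + fst p * snd p \<noteq> 0" by simp
    have "cdiff2 (\<lambda>x. F (Some (fst x), Some (snd x))) (fst p, snd p / (1 + fst p * snd p))"
      using assms param_in_Omega[of p] p by (auto simp: holo_def sphere_params_eq param_chart)
    from cdiff2_compose[where f = fst and g = "\<lambda>p. snd p / (1 + fst p * snd p)", OF cdiff2_fst _ this]
    have "cdiff2 (\<lambda>p. F (Some (fst p), Some (snd p / (1 + fst p * snd p)))) p"
      using p by (simp add: cdiff2_intros)
    then show ?thesis
      by (rule cdiff2_cong[OF _ open_param_charts(1)]) (use p in \<open>auto simp: param_chart\<close>)
  next
    case p: False
    have "cdiff2 (\<lambda>x. F (Some (fst x), inf_chart (snd x))) (fst p, (1 + fst p * snd p) / snd p)"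
      using assms param_in_Omega[of p] p by (auto simp: holo_def sphere_params_eq param_chart)
    from cdiff2_compose[where f = fst and g = "\<lambda>p. (1 + fst p * snd p) / snd p", OF cdiff2_fst _ this]
    have "cdiff2 (\<lambda>p. F (Some (fst p), inf_chart ((1 + fst p * snd p) / snd p))) p"
      using p by (simp add: cdiff2_intros)
    then show ?thesis
      by (rule cdiff2_cong[OF _ open_param_charts(2)]) (use p in \<open>auto simp: param_chart\<close>)
  qed
qed

section \<open>Topology of Omega\<close>

abbreviation sphere2_topology :: "(sphere \<times> sphere) topology" where
  "sphere2_topology \<equiv> prod_topology sphere_topology sphere_topology"

lemma openin_sphere_iff:
  "openin sphere_topology V \<longleftrightarrow>
     (\<exists>U. open U \<and> V = Some ` U) \<or> (\<exists>C. compact C \<and> V = insert None (Some ` (- C)))"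
  unfolding sphere_topology_def openin_Alexandroff_compactification
  by (auto simp: compactin_euclidean_iff open_openin[symmetric] closed_closedin[symmetric]
      compact_imp_closed Compl_eq_Diff_UNIV)

lemma topspace_sphere [simp]: "topspace sphere_topology = UNIV"
  by (simp add: sphere_topology_def UNIV_option_conv)

lemma open_inverse_image:
  assumes "open A" shows "open {z :: complex. z \<noteq> 0 \<and> 1 / z \<in> A}"
proof -
  have "open (- {0} \<inter> (\<lambda>z::complex. 1 / z) -` A)"
    by (intro continuous_open_preimage assms continuous_intros) auto
  then show ?thesis by (simp add: vimage_def Int_def conj_commute)
qed

lemma open_inf_chart_image:
  assumes "open A" shows "openin sphere_topology (inf_chart ` A)"
proof (cases "0 \<in> A")
  case False
  have "inf_chart ` A = Some ` {z. z \<noteq> 0 \<and> 1 / z \<in> A}"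
    using False by (force simp: inf_chart_def image_iff)
  then show ?thesis
    unfolding openin_sphere_iff using open_inverse_image[OF assms] by blast
next
  case True
  \<comment> \<open>A set containing infinity is open exactly if its complement, here \<open>C\<close>, is compact.\<close>
  define C where "C = - {z. z \<noteq> 0 \<and> 1 / z \<in> A}"
  obtain e where e: "e > 0" "ball 0 e \<subseteq> A"
    using assms True open_contains_ball by blast
  have "norm z \<le> 1 / e" if "z \<in> C" for z
  proof (cases "z = 0")
    case False
    then have "1 / z \<notin> ball 0 e" using that e by (auto simp: C_def)
    then show ?thesis using False e(1) by (auto simp: norm_divide field_simps)
  qed (use e in auto)
  then have "compact C"
    unfolding compact_eq_bounded_closed C_def
    using open_inverse_image[OF assms] by (auto simp: bounded_iff)
  moreover have "inf_chart ` A = insert None (Some ` (- C))"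
  proof -
    have "inf_chart ` A \<subseteq> insert None (Some ` (- C))"
      by (auto simp: inf_chart_def C_def)
    moreover have "None \<in> inf_chart ` A" using True by (force simp: inf_chart_def image_iff)
    moreover have "Some z \<in> inf_chart ` A" if "z \<in> - C" for z
      using that by (auto simp: inf_chart_def C_def image_iff intro!: bexI[of _ "1 / z"])
    ultimately show ?thesis by blast
  qed
  ultimately show ?thesis unfolding openin_sphere_iff by blast
qed

lemma open_chart_image:
  assumes "\<phi> \<in> sphere_params" "open A" shows "openin sphere_topology (\<phi> ` A)"
  using assms open_inf_chart_image by (auto simp: sphere_params_eq openin_sphere_iff)

lemma open_chart_vimage:
  assumes "\<phi> \<in> sphere_params" "openin sphere_topology V" shows "open (\<phi> -` V)"
proof -
  consider U where "open U" "V = Some ` U" | C where "compact C" "V = insert None (Some ` (- C))"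
    using assms(2) unfolding openin_sphere_iff by blast
  then have "open (Some -` V) \<and> open (inf_chart -` V)"
  proof cases
    case 1
    have "Some -` V = U" "inf_chart -` V = {z. z \<noteq> 0 \<and> 1 / z \<in> U}"
      using 1(2) by (auto simp: inf_chart_def split: if_splits)
    then show ?thesis
      using 1(1) open_inverse_image[OF 1(1)] by simp_all
  next
    case 2
    have "Some -` V = - C" using 2 by auto
    then have *: "open (Some -` V)" using 2 compact_imp_closed by auto
    obtain B where B: "B > 0" "\<And>x. x \<in> C \<Longrightarrow> norm x \<le> B"
      using compact_imp_bounded[OF 2(1)] bounded_pos by metis
    have "inf_chart -` V = {z. z \<noteq> 0 \<and> 1 / z \<in> - C} \<union> ball 0 (1 / B)"
    proof -
      have "1 / z \<notin> C" if "norm z < 1 / B" "z \<noteq> 0" for z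
      proof
        assume "1 / z \<in> C"
        from B(2)[OF this] that B(1) show False by (simp add: norm_divide field_simps)
      qed
      then show ?thesis using 2 B(1) by (auto simp: inf_chart_def split: if_splits)
    qed
    with * show ?thesis
      using open_inverse_image[of "- C"] 2 compact_imp_closed by auto
  qed
  then show ?thesis using assms(1) by (auto simp: sphere_params_eq)
qed

text \<open>The charts are open maps and cover the sphere, so openness can be tested in the charts.\<close>

lemma openin_sphere2I:
  assumes "\<And>\<phi> \<psi>. \<phi> \<in> sphere_params \<Longrightarrow> \<psi> \<in> sphere_params \<Longrightarrow> open {x. (\<phi> (fst x), \<psi> (snd x)) \<in> X}"
  shows "openin sphere2_topology X"
  unfolding openin_prod_topology_alt
proof (intro allI impI)
  fix p q assume pq: "(p, q) \<in> X"
  have cover: "\<exists>\<phi>\<in>sphere_params. \<exists>u. p = \<phi> u" for p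
    by (cases p) (auto simp: sphere_params_eq inf_chart_def)
  obtain \<phi> u where \<phi>: "\<phi> \<in> sphere_params" "p = \<phi> u" using cover by blast
  obtain \<psi> v where \<psi>: "\<psi> \<in> sphere_params" "q = \<psi> v" using cover by blast
  obtain A B where AB: "open A" "open B" "(u, v) \<in> A \<times> B" "A \<times> B \<subseteq> {x. (\<phi> (fst x), \<psi> (snd x)) \<in> X}"
    using open_prod_elim[OF assms[OF \<phi>(1) \<psi>(1)], of "(u, v)"] pq \<phi> \<psi> by auto
  show "\<exists>U V. openin sphere_topology U \<and> openin sphere_topology V \<and> p \<in> U \<and> q \<in> V \<and> U \<times> V \<subseteq> X"
    by (rule exI[of _ "\<phi> ` A"], rule exI[of _ "\<psi> ` B"])
       (use open_chart_image[OF \<phi>(1) AB(1)] open_chart_image[OF \<psi>(1) AB(2)] AB(3,4) \<phi> \<psi> in \<open>auto simp: subset_iff\<close>)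
qed

lemma holo_continuous_map:
  assumes "holo F" shows "continuous_map (subtopology sphere2_topology Omega) euclidean F"
  unfolding continuous_map_def
proof (intro conjI allI impI)
  fix U :: "complex set" assume "openin euclidean U"
  then have U: "open U" by simp
  have "openin sphere2_topology {p \<in> Omega. F p \<in> U}"
  proof (rule openin_sphere2I)
    fix \<phi> \<psi> assume *: "\<phi> \<in> sphere_params" "\<psi> \<in> sphere_params"
    have "continuous_on {x. (\<phi> (fst x), \<psi> (snd x)) \<in> Omega} (\<lambda>x. F (\<phi> (fst x), \<psi> (snd x)))"
    proof (intro continuous_at_imp_continuous_on ballI cdiff2_isCont)
      fix x assume "x \<in> {x. (\<phi> (fst x), \<psi> (snd x)) \<in> Omega}"
      then show "cdiff2 (\<lambda>x. F (\<phi> (fst x), \<psi> (snd x))) x"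
        using assms * unfolding holo_def by (cases x) simp
    qed
    then have "open ({x. (\<phi> (fst x), \<psi> (snd x)) \<in> Omega} \<inter> (\<lambda>x. F (\<phi> (fst x), \<psi> (snd x))) -` U)"
      using open_chart_Omega[OF *] U by (rule continuous_open_preimage)
    then show "open {x. (\<phi> (fst x), \<psi> (snd x)) \<in> {p \<in> Omega. F p \<in> U}}"
      by (simp add: vimage_def Int_def conj_commute)
  qed
  then have "openin (subtopology sphere2_topology Omega) {p \<in> Omega. F p \<in> U}"
    unfolding openin_subtopology by (intro exI[of _ "{p \<in> Omega. F p \<in> U}"]) auto
  then show "openin (subtopology sphere2_topology Omega) {x \<in> topspace (subtopology sphere2_topology Omega). F x \<in> U}"
    by (simp add: topspace_subtopology)
qed auto

definition compact_Omega :: "(sphere \<times> sphere) set \<Rightarrow> bool" where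
  "compact_Omega K \<longleftrightarrow> compactin sphere2_topology K \<and> K \<subseteq> Omega"

lemma compact_image_holo:
  assumes "holo F" "compact_Omega K" shows "compact (F ` K)"
proof -
  have "compactin (subtopology sphere2_topology Omega) K"
    using assms by (simp add: compactin_subtopology compact_Omega_def)
  from image_compactin[OF this holo_continuous_map[OF assms(1)]]
  show ?thesis by (simp add: compactin_euclidean_iff)
qed

lemma continuous_param: "continuous_map euclidean sphere2_topology param"
proof -
  have "continuous_map euclidean sphere_topology (\<lambda>p. fst (param p))"
    unfolding continuous_map_def
  proof (intro conjI allI impI)
    fix V assume "openin sphere_topology V"
    then have "open (Some -` V)" by (intro open_chart_vimage) (auto simp: sphere_params_eq)
    then have "open (fst -` (Some -` V) :: (complex \<times> complex) set)" by (rule open_vimage_fst)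
    then show "openin euclidean {x :: complex \<times> complex \<in> topspace euclidean. fst (param x) \<in> V}"
      by (simp add: param_def vimage_def)
  qed auto
  moreover have "continuous_map euclidean sphere_topology (\<lambda>p. snd (param p))"
    unfolding continuous_map_def
  proof (intro conjI allI impI)
    fix V assume V: "openin sphere_topology V"
    have 1: "open ({p. 1 + fst p * snd p \<noteq> 0} \<inter> (\<lambda>p::complex \<times> complex. snd p / (1 + fst p * snd p)) -` (Some -` V))"
      by (intro continuous_open_preimage open_chart_vimage V open_param_charts continuous_intros)
         (auto simp: sphere_params_eq)
    have 2: "open ({p. snd p \<noteq> 0} \<inter> (\<lambda>p::complex \<times> complex. (1 + fst p * snd p) / snd p) -` (inf_chart -` V))"
      by (intro continuous_open_preimage open_chart_vimage V open_param_charts continuous_intros)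
         (auto simp: sphere_params_eq)
    have "{p. snd (param p) \<in> V} =
        ({p. 1 + fst p * snd p \<noteq> 0} \<inter> (\<lambda>p. snd p / (1 + fst p * snd p)) -` (Some -` V))
      \<union> ({p. snd p \<noteq> 0} \<inter> (\<lambda>p. (1 + fst p * snd p) / snd p) -` (inf_chart -` V))"
    proof (intro equalityI subsetI)
      fix p assume p: "p \<in> {p. snd (param p) \<in> V}"
      show "p \<in> ({p. 1 + fst p * snd p \<noteq> 0} \<inter> (\<lambda>p. snd p / (1 + fst p * snd p)) -` (Some -` V))
      \<union> ({p. snd p \<noteq> 0} \<inter> (\<lambda>p. (1 + fst p * snd p) / snd p) -` (inf_chart -` V))"
      proof (cases "snd p = 0")
        case True
        then show ?thesis using p param_chart(1)[of p] by simp
      next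
        case False
        then show ?thesis using p param_chart(2)[of p] by simp
      qed
    qed (auto simp: param_chart)
    with open_Un[OF 1 2] show "openin euclidean {x \<in> topspace euclidean. snd (param x) \<in> V}"
      by simp
  qed auto
  ultimately show ?thesis
    by (simp add: continuous_map_pairwise comp_def)
qed

text \<open>The image of the distinguished boundary of a polydisc, where Cauchy's inequality takes its bounds.\<close>

definition torus :: "real \<Rightarrow> (sphere \<times> sphere) set" where
  "torus R = param ` (sphere 0 R \<times> sphere 0 R)"

lemma compact_torus: "compact_Omega (torus R)"
proof -
  have "compactin euclidean (sphere 0 R \<times> sphere 0 R :: (complex \<times> complex) set)"
    by (simp add: compactin_euclidean_iff compact_Times)
  from image_compactin[OF this continuous_param] show ?thesis
    by (auto simp: compact_Omega_def torus_def)
qed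

lemma compact_Omega_swap:
  assumes "compact_Omega K" shows "compact_Omega (prod.swap ` K)"
proof -
  have "continuous_map sphere2_topology sphere2_topology prod.swap"
    unfolding prod.swap_def by (intro continuous_map_pairedI continuous_map_fst continuous_map_snd)
  from image_compactin[OF _ this] have "compactin sphere2_topology (prod.swap ` K)"
    using assms by (simp add: compact_Omega_def)
  moreover have "prod.swap ` K \<subseteq> Omega"
    using assms swap_in_Omega unfolding compact_Omega_def by blast
  ultimately show ?thesis by (simp add: compact_Omega_def)
qed

section \<open>Uniform convergence on compact sets\<close>

lemma hol_Omega_topology_basic_open:
  assumes "compact_Omega K" "G \<in> hol_Omega" "e > 0"
  shows "openin hol_Omega_topology {F \<in> hol_Omega. \<forall>p\<in>K. dist (F p) (G p) < e}"
  unfolding hol_Omega_topology_def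
  using assms by (intro topology_generated_by_Basis) (auto simp: compact_Omega_def)

lemma topspace_hol_Omega_topology: "topspace hol_Omega_topology = hol_Omega"
proof -
  have "F \<in> topspace hol_Omega_topology" if "F \<in> hol_Omega" for F
  proof -
    have "openin hol_Omega_topology {F' \<in> hol_Omega. \<forall>p\<in>{}. dist (F' p) (F p) < 1}"
      by (rule hol_Omega_topology_basic_open) (use that in \<open>auto simp: compact_Omega_def\<close>)
    from openin_subset[OF this] that show ?thesis by auto
  qed
  moreover have "topspace hol_Omega_topology \<subseteq> hol_Omega"
    unfolding hol_Omega_topology_def topology_generated_by_topspace by auto
  ultimately show ?thesis by blast
qed

text \<open>A subbasic neighbourhood of \<open>F\<close> may be centred at another function \<open>G\<close>. Since \<open>F - G\<close> is
  continuous and \<open>K\<close> is compact, the distance of \<open>F\<close> and \<open>G\<close> on \<open>K\<close> stays below \<open>e\<close> by a positive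
  margin \<open>d\<close>, and functions closer than \<open>d\<close> to \<open>F\<close> on \<open>K\<close> remain in the neighbourhood.\<close>

lemma eventually_in_open_hol_Omega:
  assumes S: "\<And>n. S n \<in> hol_Omega" and F: "F \<in> hol_Omega"
    and lim: "\<And>K e. compact_Omega K \<Longrightarrow> e > 0 \<Longrightarrow>
       \<forall>\<^sub>F n in sequentially. \<forall>p\<in>K. dist (S n p) (F p) < (e::real)"
    and U: "openin hol_Omega_topology U" "F \<in> U"
  shows "\<forall>\<^sub>F n in sequentially. S n \<in> U"
proof -
  let ?B = "{{F \<in> hol_Omega. \<forall>p\<in>K. dist (F p) (G p) < e} | K G e.
        compactin (prod_topology sphere_topology sphere_topology) K \<and> K \<subseteq> Omega \<and>
        G \<in> hol_Omega \<and> 0 < (e::real)}"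
  have "generate_topology_on ?B U"
    using U(1) unfolding hol_Omega_topology_def by (rule openin_topology_generated_by)
  then show ?thesis using U(2)
  proof (induction rule: generate_topology_on.induct)
    case Empty then show ?case by simp
  next
    case (Int a b) then show ?case by (auto intro: eventually_conj)
  next
    case (UN \<K>)
    then obtain k where "k \<in> \<K>" "F \<in> k" by blast
    with UN have "\<forall>\<^sub>F n in sequentially. S n \<in> k" by blast
    then show ?case by (rule eventually_mono) (use \<open>k \<in> \<K>\<close> in blast)
  next
    case (Basis s)
    then obtain K G e where s: "s = {F \<in> hol_Omega. \<forall>p\<in>K. dist (F p) (G p) < e}"
      "compact_Omega K" "G \<in> hol_Omega" "0 < e" by (auto simp: compact_Omega_def)
    have lt: "\<forall>p\<in>K. dist (F p) (G p) < e" using Basis s by auto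
    have "holo (\<lambda>p. F p + (-1) * G p)"
      using F s(3) by (intro holo_add holo_mult holo_const) (auto simp: hol_Omega_iff)
    then have "compact ((\<lambda>p. F p + (-1) * G p) ` K)" by (rule compact_image_holo) (rule s)
    then have c: "compact (norm ` (\<lambda>p. F p + (-1) * G p) ` K)"
      by (intro compact_continuous_image continuous_intros)
    obtain d where d: "d > 0" "\<And>p. p \<in> K \<Longrightarrow> dist (F p) (G p) \<le> e - d"
    proof (cases "K = {}")
      case True
      then show ?thesis using that[of 1] by auto
    next
      case False
      obtain t where t: "t \<in> norm ` (\<lambda>p. F p + (-1) * G p) ` K" "\<And>x. x \<in> norm ` (\<lambda>p. F p + (-1) * G p) ` K \<Longrightarrow> x \<le> t"
        using compact_attains_sup[OF c] False by auto
      have "t < e" using t(1) lt by (auto simp: dist_norm)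
      then show ?thesis using that[of "e - t"] t(2) by (auto simp: dist_norm)
    qed
    from lim[OF s(2) d(1)] show ?case
    proof eventually_elim
      case (elim n)
      have "dist (S n p) (G p) < e" if "p \<in> K" for p
        using elim[rule_format, OF that] d(2)[OF that] dist_triangle[of "S n p" "G p" "F p"] by linarith
      then show ?case using S s by auto
    qed
  qed
qed

section \<open>The expansion in the coordinates b, c and x\<close>

lemma holo_bounded:
  assumes "holo F" "compact_Omega K"
  obtains B where "B \<ge> 0" "\<And>p. p \<in> K \<Longrightarrow> norm (F p) \<le> B"
proof -
  obtain B where "\<And>x. x \<in> F ` K \<Longrightarrow> norm x \<le> B"
    using compact_imp_bounded[OF compact_image_holo[OF assms]] bounded_iff by metis
  then show ?thesis by (intro that[of "max B 0"]) (auto simp: le_max_iff_disj)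
qed

text \<open>The coefficient of \<open>z^i c^j\<close> of \<open>F\<close> in the coordinates \<open>(z, c)\<close>. Since \<open>x = z c\<close>, for
  \<open>i = k\<close> and \<open>j = k + n\<close> this monomial is \<open>c^n x^k\<close>.\<close>

definition gcoef :: "(sphere \<times> sphere \<Rightarrow> complex) \<Rightarrow> nat \<Rightarrow> nat \<Rightarrow> complex" where
  "gcoef F = tcoef (\<lambda>p. F (param p))"

lemma norm_gcoef_le:
  assumes "holo F" "R > 0" "\<And>p. p \<in> torus R \<Longrightarrow> norm (F p) \<le> B"
  shows "norm (gcoef F i j) \<le> B / R ^ (i + j)"
  unfolding gcoef_def
  by (rule tcoef_bound[OF holomorphic_param[OF assms(1)] assms(2)])
     (use assms(3) in \<open>auto simp: torus_def\<close>)

text \<open>The coefficient of \<open>c^n\<close> times the Jacobi polynomial of degree \<open>l\<close>, obtained by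
  substituting the expansion of each power \<open>x^k\<close>.\<close>

definition pcoef :: "(sphere \<times> sphere \<Rightarrow> complex) \<Rightarrow> nat \<Rightarrow> nat \<Rightarrow> complex" where
  "pcoef F n l = (\<Sum>\<^sub>\<infinity>k. gcoef F k (k + n) * jac_inv n k l)"

text \<open>Cauchy's inequality on the torus of radius \<open>R\<close> gives \<open>R^-(2 k + n)\<close>, the inverse matrix costs
  \<open>2^(n + k)\<close>, and the terms with \<open>k < l\<close> vanish. The factor \<open>(1 / 2)^k\<close> is set aside for the summation over \<open>k\<close>.\<close>

lemma norm_pcoef_term_le:
  assumes "holo F" "R \<ge> 4" "\<And>p. p \<in> torus R \<Longrightarrow> norm (F p) \<le> B" "B \<ge> 0"
  shows "norm (gcoef F k (k + n) * jac_inv n k l) \<le> B * (4 / R) ^ (n + l) * (1 / 2) ^ k"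
proof (cases "k < l")
  case True
  then show ?thesis using assms by (simp add: jac_inv_eq_0)
next
  case False
  have "norm (gcoef F k (k + n) * jac_inv n k l) \<le> B / R ^ (k + (k + n)) * 2 ^ (n + k)"
    unfolding norm_mult using assms
    by (intro mult_mono norm_gcoef_le norm_jac_inv_le) (auto intro: order_trans[OF _ norm_gcoef_le])
  also have "\<dots> \<le> B / R ^ (n + k) * 2 ^ (n + k)"
    using assms by (intro mult_right_mono divide_left_mono power_increasing) auto
  also have "\<dots> = B * ((4 / R) ^ (n + k) * (1 / 2) ^ (n + k))"
  proof -
    have "(4 / R) ^ (n + k) * (1 / 2) ^ (n + k) = (4 / R * (1 / 2)) ^ (n + k)"
      by (rule power_mult_distrib[symmetric])
    also have "\<dots> = (2 / R) ^ (n + k)" by simp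
    finally show ?thesis by (simp only: power_divide) simp
  qed
  also have "\<dots> \<le> B * ((4 / R) ^ (n + l) * (1 / 2) ^ k)"
    using assms False by (intro mult_left_mono mult_mono power_decreasing) auto
  finally show ?thesis by simp
qed

lemma has_sum_half_powers: "((\<lambda>k. c * (1 / 2) ^ k) has_sum (c * 2)) (UNIV :: nat set)" for c :: real
  by (intro has_sum_cmult_right sums_nonneg_imp_has_sum) (use geometric_sums[of "1 / 2 :: real"] in auto)

lemma pcoef_summable:
  assumes "holo F"
  shows "(\<lambda>k. gcoef F k (k + n) * jac_inv n k l) summable_on UNIV"
proof -
  obtain B where B: "B \<ge> 0" "\<And>p. p \<in> torus 4 \<Longrightarrow> norm (F p) \<le> B"
    using holo_bounded[OF assms compact_torus] by blast
  show ?thesis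
    by (rule abs_summable_summable)
       (rule Infinite_Sum.abs_summable_on_comparison_test'[OF has_sum_imp_summable[OF has_sum_half_powers]],
        rule norm_pcoef_term_le[OF assms _ B(2) B(1)], simp_all)
qed

lemma norm_pcoef_le:
  assumes "holo F" "R \<ge> 4" "\<And>p. p \<in> torus R \<Longrightarrow> norm (F p) \<le> B" "B \<ge> 0"
  shows "norm (pcoef F n l) \<le> 2 * B * (4 / R) ^ (n + l)"
proof -
  have "norm (pcoef F n l) \<le> B * (4 / R) ^ (n + l) * 2"
    unfolding pcoef_def
    by (rule norm_infsum_le[OF has_sum_infsum[OF pcoef_summable[OF assms(1)]] has_sum_half_powers])
       (rule norm_pcoef_term_le[OF assms])
  then show ?thesis by simp
qed

lemma summable_half_powers2: "(\<lambda>(n, l). c * (1 / 2) ^ (n + l)) summable_on (UNIV :: (nat \<times> nat) set)" for c :: real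
  using summable_on_cmult_right[OF geometric_summable_on[of "1/2"], of c]
  by (simp add: case_prod_beta' power_add mult.assoc)

text \<open>Substitute the expansion of \<open>x^k\<close> in Jacobi polynomials into the power series and exchange the
  sums.\<close>

lemma weight_expansion:
  assumes F: "holo F"
  shows "((\<lambda>l. pcoef F n l * jac_poly n l x) has_sum (\<Sum>\<^sub>\<infinity>k. gcoef F k (k + n) * x ^ k)) UNIV"
proof -
  define \<rho> where "\<rho> = max 1 (norm x)"
  have \<rho>: "\<rho> \<ge> 1" "norm x \<le> \<rho>" by (auto simp: \<rho>_def)
  \<comment> \<open>The Jacobi polynomials grow like powers of \<open>16 * \<rho>\<close>, and \<open>(4 / R) * (16 * \<rho>) = 1/2\<close>.\<close>
  define R where "R = 128 * \<rho>"
  have R: "R \<ge> 4" using \<rho> by (simp add: R_def)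
  obtain B where B: "B \<ge> 0" "\<And>p. p \<in> torus R \<Longrightarrow> norm (F p) \<le> B"
    using holo_bounded[OF F compact_torus] by blast
  define t where "t k l = gcoef F k (k + n) * jac_inv n k l * jac_poly n l x" for k l
  have tb: "norm (t k l) \<le> B * (1 / 2) ^ (k + l)" for k l
  proof -
    have "norm (t k l) \<le> (B * (4 / R) ^ (n + l) * (1 / 2) ^ k) * (16 * \<rho>) ^ (n + l)"
      unfolding t_def norm_mult[of "_ * _"]
      using R B \<rho> by (intro mult_mono norm_pcoef_term_le F norm_jac_poly_le) auto
    also have "\<dots> = B * (1 / 2) ^ k * ((4 / R) * (16 * \<rho>)) ^ (n + l)"
      by (simp only: power_mult_distrib) simp
    also have "(4 / R) * (16 * \<rho>) = 1 / 2" using \<rho> by (simp add: R_def)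
    also have "B * (1 / 2) ^ k * (1 / 2) ^ (n + l) \<le> B * (1 / 2) ^ k * (1 / 2) ^ l"
      using B by (intro mult_left_mono power_decreasing) auto
    finally show ?thesis by (simp add: power_add)
  qed
  have "(\<lambda>(k, l). t k l) summable_on UNIV"
    by (rule abs_summable_summable, rule Infinite_Sum.abs_summable_on_comparison_test'[OF summable_half_powers2[of B]])
       (use tb in auto)
  then have s: "(\<lambda>(k, l). t k l) summable_on UNIV \<times> UNIV" by simp
  define L where "L = infsum (\<lambda>(k, l). t k l) (UNIV \<times> UNIV)"
  have L: "((\<lambda>(k, l). t k l) has_sum L) (UNIV \<times> UNIV)"
    unfolding L_def by (rule has_sum_infsum[OF s])
  have inner: "((\<lambda>l. t k l) has_sum gcoef F k (k + n) * x ^ k) UNIV" for k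
  proof -
    have "(\<Sum>l\<le>k. t k l) = gcoef F k (k + n) * x ^ k"
      unfolding power_eq_jac_poly_sum[of x k n] sum_distrib_left t_def by (simp add: mult.assoc)
    then show ?thesis
      by (intro has_sum_finite_neutralI[of "{..k}"]) (auto simp: t_def jac_inv_eq_0)
  qed
  have "((\<lambda>k. gcoef F k (k + n) * x ^ k) has_sum L) UNIV"
    using has_sum_SigmaD[OF L] inner by auto
  then have L_eq: "(\<Sum>\<^sub>\<infinity>k. gcoef F k (k + n) * x ^ k) = L" by (rule infsumI)
  have "((\<lambda>(l, k). t k l) has_sum L) (UNIV \<times> UNIV)"
    using has_sum_swap[of "\<lambda>(k, l). t k l" UNIV UNIV L] L by (simp add: case_prod_beta')
  moreover have "((\<lambda>k. t k l) has_sum pcoef F n l * jac_poly n l x) UNIV" for l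
    unfolding t_def pcoef_def
    by (intro has_sum_cmult_left has_sum_infsum pcoef_summable F)
  ultimately have "((\<lambda>l. pcoef F n l * jac_poly n l x) has_sum L) UNIV"
    using has_sum_SigmaD[where f = "\<lambda>(l, k). t k l" and A = UNIV and B = "\<lambda>_. UNIV"] by auto
  then show ?thesis using L_eq by simp
qed

definition pterm :: "(sphere \<times> sphere \<Rightarrow> complex) \<Rightarrow> nat \<Rightarrow> nat \<Rightarrow> sphere \<times> sphere \<Rightarrow> complex" where
  "pterm F n l p = pcoef F n l * (coordC p ^ n * jac_poly n l (coordX p))"

lemma norm_pterm_le:
  assumes "holo F" "\<rho> \<ge> 1"
  obtains B where "B \<ge> 0"
    "\<And>p n l. norm (coordC p) \<le> \<rho> \<Longrightarrow> norm (coordX p) \<le> \<rho> \<Longrightarrow> norm (pterm F n l p) \<le> B * (1 / 2) ^ (n + l)"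
proof -
  \<comment> \<open>The extra factor \<open>\<rho>\<close> absorbs the power of \<open>coordC p\<close>.\<close>
  define R where "R = 128 * \<rho>\<^sup>2"
  have \<rho>2: "\<rho>\<^sup>2 \<ge> 1" using assms by (simp add: one_le_power)
  then have R: "R \<ge> 4" by (simp add: R_def)
  obtain B where B: "B \<ge> 0" "\<And>p. p \<in> torus R \<Longrightarrow> norm (F p) \<le> B"
    using holo_bounded[OF assms(1) compact_torus] by blast
  have "norm (pterm F n l p) \<le> 2 * B * (1 / 2) ^ (n + l)"
    if p: "norm (coordC p) \<le> \<rho>" "norm (coordX p) \<le> \<rho>" for n l p
  proof -
    have "norm (coordC p) ^ n \<le> \<rho> ^ n" using p by (intro power_mono) auto
    also have "\<dots> \<le> \<rho> ^ (n + l)" using assms by (intro power_increasing) auto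
    finally have "norm (pterm F n l p) \<le> (2 * B * (4 / R) ^ (n + l)) * (\<rho> ^ (n + l) * (16 * \<rho>) ^ (n + l))"
      unfolding pterm_def norm_mult norm_power
      using p R B assms by (intro mult_mono norm_pcoef_le norm_jac_poly_le) auto
    also have "\<dots> = 2 * B * ((4 / R) * (\<rho> * (16 * \<rho>))) ^ (n + l)"
      by (simp only: power_mult_distrib mult.assoc)
    also have "(4 / R) * (\<rho> * (16 * \<rho>)) = 1 / 2"
      using assms by (simp add: R_def power2_eq_square)
    finally show ?thesis .
  qed
  then show ?thesis using that[of "2 * B"] B by auto
qed

lemma pterm_summable:
  assumes "holo F" shows "(\<lambda>(n, l). pterm F n l p) summable_on UNIV"
proof -
  define \<rho> where "\<rho> = Max {1, norm (coordC p), norm (coordX p)}"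
  have \<rho>: "\<rho> \<ge> 1" "norm (coordC p) \<le> \<rho>" "norm (coordX p) \<le> \<rho>" by (auto simp: \<rho>_def)
  obtain B where B: "B \<ge> 0"
    "\<And>p n l. norm (coordC p) \<le> \<rho> \<Longrightarrow> norm (coordX p) \<le> \<rho> \<Longrightarrow> norm (pterm F n l p) \<le> B * (1 / 2) ^ (n + l)"
    using norm_pterm_le[OF assms \<rho>(1)] by blast
  show ?thesis
    by (rule abs_summable_summable, rule Infinite_Sum.abs_summable_on_comparison_test'[OF summable_half_powers2[of B]])
       (use B(2)[OF \<rho>(2,3)] in auto)
qed

lemma pterm_has_sum_weights:
  assumes F: "holo F"
    and U: "((\<lambda>n. coordC p ^ (n + m) * (\<Sum>\<^sub>\<infinity>k. gcoef F k (k + (n + m)) * coordX p ^ k)) has_sum U) UNIV"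
  shows "((\<lambda>(n, l). pterm F (n + m) l p) has_sum U) UNIV"
proof -
  have "(\<lambda>(n, l). pterm F n l p) summable_on (\<lambda>(n, l). (n + m, l)) ` UNIV"
    by (rule summable_on_subset[OF pterm_summable[OF F]]) auto
  then have "(\<lambda>(n, l). pterm F (n + m) l p) summable_on UNIV"
    by (subst (asm) summable_on_reindex) (auto simp: inj_on_def comp_def case_prod_beta')
  then have s: "(\<lambda>(n, l). pterm F (n + m) l p) summable_on UNIV \<times> UNIV" by simp
  have inner: "((\<lambda>l. pterm F (n + m) l p) has_sum
      coordC p ^ (n + m) * (\<Sum>\<^sub>\<infinity>k. gcoef F k (k + (n + m)) * coordX p ^ k)) UNIV" for n
    using has_sum_cmult_right[OF weight_expansion[OF F, of "n + m" "coordX p"], of "coordC p ^ (n + m)"]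
    by (simp add: pterm_def algebra_simps)
  have "((\<lambda>(n, l). pterm F (n + m) l p) has_sum U) (UNIV \<times> UNIV)"
    by (rule has_sum_SigmaI[OF _ U s]) (use inner in auto)
  then show ?thesis by simp
qed

text \<open>The candidate for the mode expansion: the weights \<open>n \<ge> 0\<close> come from \<open>F\<close> itself and the negative
  ones from \<open>F\<close> with exchanged coordinates, whose weights are shifted by one so that weight \<open>0\<close> is not
  counted twice.\<close>

definition mode_series :: "(sphere \<times> sphere \<Rightarrow> complex) \<Rightarrow> sphere \<times> sphere \<Rightarrow> complex" where
  "mode_series F p = (\<Sum>\<^sub>\<infinity>(n, l). pterm F n l p) + (\<Sum>\<^sub>\<infinity>(n, l). pterm (\<lambda>p. F (prod.swap p)) (n + 1) l (prod.swap p))"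

text \<open>The function \<open>s \<mapsto> F (z / s, s w)\<close> has the coordinates \<open>(z / s, s c)\<close> in the first
  parametrisation and \<open>(s w, b / s)\<close> in the one with exchanged coordinates. The two Taylor series
  are the Laurent expansions that \<open>weight_split\<close> combines.\<close>

lemma mode_series_finite:
  assumes F: "holo F" and zw: "z * w \<noteq> 1"
  shows "F (Some z, Some w) = mode_series F (Some z, Some w)"
proof -
  let ?F' = "\<lambda>p. F (prod.swap p)"
  note F' = holo_swap[OF F]
  define c where "c = w / (1 - z * w)"
  define b where "b = z / (1 - w * z)"
  have wz: "w * z \<noteq> 1" using zw by (simp add: mult.commute)
  \<comment> \<open>The orbit of \<open>(z, w)\<close> under the rotations.\<close>
  define \<Phi> where "\<Phi> s = F (Some (z / s), Some (s * w))" for s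
  have G: "\<Phi> s = F (param (z / s, s * c))" and H: "\<Phi> s = ?F' (param (s * w, b / s))" if "s \<noteq> 0" for s
  proof -
    have "(Some (z / s), Some (s * w)) \<in> Omega" using zw that by simp
    from param_coordC[OF this] param_coordB[OF this] that
    show "\<Phi> s = F (param (z / s, s * c))" "\<Phi> s = ?F' (param (s * w, b / s))"
      by (simp_all add: \<Phi>_def c_def b_def coordB_def mult.commute)
  qed
  have \<alpha>: "((\<lambda>(i, j). (gcoef F i j * z ^ i * c ^ j) * (s ^ j / s ^ i)) has_sum \<Phi> s) UNIV" if "s \<noteq> 0" for s
    using taylor2_has_sum[OF holomorphic_param[OF F], of "z / s" "s * c"] G[OF that]
    by (simp add: gcoef_def power_divide power_mult_distrib ac_simps case_prod_beta')
  have \<beta>: "((\<lambda>(i, j). (gcoef ?F' i j * w ^ i * b ^ j) * (s ^ i / s ^ j)) has_sum \<Phi> s) UNIV" if "s \<noteq> 0" for s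
    using taylor2_has_sum[OF holomorphic_param[OF F'], of "s * w" "b / s"] H[OF that]
    by (simp add: gcoef_def power_divide power_mult_distrib ac_simps case_prod_beta')
  obtain U V where UV: "((\<lambda>n. \<Sum>\<^sub>\<infinity>k. gcoef F k (k + n) * z ^ k * c ^ (k + n)) has_sum U) UNIV"
    "((\<lambda>n. \<Sum>\<^sub>\<infinity>k. gcoef ?F' k (k + Suc n) * w ^ k * b ^ (k + Suc n)) has_sum V) UNIV" "\<Phi> 1 = U + V"
    using weight_split[of "\<lambda>i j. gcoef F i j * z ^ i * c ^ j" \<Phi> "\<lambda>i j. gcoef ?F' i j * w ^ i * b ^ j", OF \<alpha> \<beta>]
    by blast
  let ?p = "(Some z, Some w)"
  have e1: "gcoef F k (k + n) * z ^ k * c ^ (k + n) = coordC ?p ^ n * (gcoef F k (k + n) * coordX ?p ^ k)" for k n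
    by (simp add: c_def power_add power_mult_distrib power_divide ac_simps)
  have e2: "gcoef ?F' k (k + Suc n) * w ^ k * b ^ (k + Suc n)
      = coordC (prod.swap ?p) ^ (n + 1) * (gcoef ?F' k (k + (n + 1)) * coordX (prod.swap ?p) ^ k)" for k n
    by (simp add: b_def power_add power_mult_distrib power_divide ac_simps)
  have 1: "((\<lambda>(n, l). pterm F (n + 0) l ?p) has_sum U) UNIV"
    by (rule pterm_has_sum_weights[OF F]) (use UV(1) in \<open>simp add: e1 infsum_cmult_right'\<close>)
  have 2: "((\<lambda>(n, l). pterm ?F' (n + 1) l (prod.swap ?p)) has_sum V) UNIV"
    by (rule pterm_has_sum_weights[OF F']) (use UV(2) in \<open>simp only: e2 infsum_cmult_right'\<close>)
  have "F ?p = \<Phi> 1" by (simp add: \<Phi>_def)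
  also have "\<dots> = mode_series F ?p"
    unfolding mode_series_def UV(3) using infsumI[OF 1] infsumI[OF 2] by simp
  finally show ?thesis .
qed

lemma continuous_on_pterm_sum:
  fixes q :: "complex \<Rightarrow> sphere \<times> sphere"
  assumes F: "holo F" and q: "continuous_on Y (\<lambda>t. coordC (q t))" "continuous_on Y (\<lambda>t. coordX (q t))"
    and Y: "compact Y"
  shows "continuous_on Y (\<lambda>t. \<Sum>\<^sub>\<infinity>(n, l). pterm F (n + m) l (q t))"
proof -
  obtain B1 where B1: "\<And>t. t \<in> Y \<Longrightarrow> norm (coordC (q t)) \<le> B1"
    using compact_imp_bounded[OF compact_continuous_image[OF q(1) Y]] by (auto simp: bounded_iff)
  obtain B2 where B2: "\<And>t. t \<in> Y \<Longrightarrow> norm (coordX (q t)) \<le> B2"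
    using compact_imp_bounded[OF compact_continuous_image[OF q(2) Y]] by (auto simp: bounded_iff)
  define \<rho> where "\<rho> = Max {1, B1, B2}"
  have \<rho>: "\<rho> \<ge> 1" "B1 \<le> \<rho>" "B2 \<le> \<rho>" by (auto simp: \<rho>_def)
  obtain B where B: "B \<ge> 0"
    "\<And>p n l. norm (coordC p) \<le> \<rho> \<Longrightarrow> norm (coordX p) \<le> \<rho> \<Longrightarrow> norm (pterm F n l p) \<le> B * (1 / 2) ^ (n + l)"
    using norm_pterm_le[OF F \<rho>(1)] by blast
  define f where "f nl t = pterm F (fst nl + m) (snd nl) (q t)" for nl t
  have "norm (f nl t) \<le> B * (1 / 2) ^ (fst nl + snd nl)" if "t \<in> Y" for nl t
  proof -
    have "norm (f nl t) \<le> B * (1 / 2) ^ (fst nl + m + snd nl)"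
      unfolding f_def using B1[OF that] B2[OF that] \<rho> by (intro B) auto
    also have "\<dots> \<le> B * (1 / 2) ^ (fst nl + snd nl)"
      using B(1) by (intro mult_left_mono power_decreasing) auto
    finally show ?thesis .
  qed
  moreover have "(\<lambda>nl. B * (1 / 2) ^ (fst nl + snd nl)) summable_on (UNIV :: (nat \<times> nat) set)"
    using summable_half_powers2[of B] by (simp add: case_prod_beta')
  ultimately have "uniform_limit Y (\<lambda>X t. \<Sum>nl\<in>X. f nl t) (\<lambda>t. \<Sum>\<^sub>\<infinity>nl. f nl t) (finite_subsets_at_top UNIV)"
    by (rule Weierstrass_m_test_general)
  moreover have "continuous_on Y (\<lambda>t. \<Sum>nl\<in>X. f nl t)" for X
    unfolding f_def pterm_def jac_poly_def by (intro continuous_intros q)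
  ultimately have "continuous_on Y (\<lambda>t. \<Sum>\<^sub>\<infinity>nl. f nl t)"
    by (intro uniform_limit_theorem[where F = "finite_subsets_at_top UNIV"]) auto
  then show ?thesis by (simp add: f_def case_prod_beta')
qed

lemma holo_curve_continuous:
  assumes F: "holo F" and "\<phi> \<in> sphere_params" "\<psi> \<in> sphere_params"
    and "\<And>t. t \<in> Y \<Longrightarrow> (\<phi> (u + t), \<psi> (v + t)) \<in> Omega"
  shows "continuous_on Y (\<lambda>t. F (\<phi> (u + t), \<psi> (v + t)))"
proof (intro continuous_at_imp_continuous_on ballI)
  fix t assume "t \<in> Y"
  then have "isCont (\<lambda>x. F (\<phi> (fst x), \<psi> (snd x))) (u + t, v + t)"
    using assms by (intro cdiff2_isCont) (auto simp: holo_def)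
  from isCont_o2[where f = "\<lambda>t. (u + t, v + t)" and a = t, OF _ this]
  show "isCont (\<lambda>t. F (\<phi> (u + t), \<psi> (v + t))) t" by simp
qed

text \<open>Points with an infinite coordinate are limits of finite points: in charts move both coordinates
  by a small \<open>t\<close>. Both sides are continuous in \<open>t\<close>, the series by the Weierstrass test.\<close>

lemma mode_series_eq:
  assumes F: "holo F" and p: "p \<in> Omega"
  shows "F p = mode_series F p"
proof -
  have cover: "\<exists>\<phi>\<in>sphere_params. \<exists>u. p = \<phi> u" for p
    by (cases p) (auto simp: sphere_params_eq inf_chart_def)
  obtain \<phi> u where \<phi>: "\<phi> \<in> sphere_params" "fst p = \<phi> u" using cover by blast
  obtain \<psi> v where \<psi>: "\<psi> \<in> sphere_params" "snd p = \<psi> v" using cover by blast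
  define q where "q t = (\<phi> (u + t), \<psi> (v + t))" for t
  have q0: "q 0 = p" using \<phi>(2) \<psi>(2) by (simp add: q_def flip: \<phi>(2) \<psi>(2))
  have "open ((\<lambda>t. (u + t, v + t)) -` {x. (\<phi> (fst x), \<psi> (snd x)) \<in> Omega})"
    by (intro open_vimage open_chart_Omega \<phi>(1) \<psi>(1) continuous_intros)
  then have "open {t. q t \<in> Omega}" by (simp add: q_def vimage_def)
  then obtain \<delta> where \<delta>: "\<delta> > 0" "cball 0 \<delta> \<subseteq> {t. q t \<in> Omega}"
    using open_contains_cball[of "{t. q t \<in> Omega}"] q0 p by auto
  have Y: "q t \<in> Omega" if "t \<in> cball 0 \<delta>" for t using \<delta> that by blast
  have cont: "continuous_on (cball 0 \<delta>) (\<lambda>t. G (q t))" if "holo G" for G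
    unfolding q_def by (rule holo_curve_continuous[OF that \<phi>(1) \<psi>(1)]) (use Y in \<open>simp add: q_def\<close>)
  have c1: "continuous_on (cball 0 \<delta>) (\<lambda>t. \<Sum>\<^sub>\<infinity>(n, l). pterm F (n + 0) l (q t))"
    by (intro continuous_on_pterm_sum F cont holo_coordC holo_coordX compact_cball)
  have c2: "continuous_on (cball 0 \<delta>)
      (\<lambda>t. \<Sum>\<^sub>\<infinity>(n, l). pterm (\<lambda>p. F (prod.swap p)) (n + 1) l (prod.swap (q t)))"
    by (intro continuous_on_pterm_sum holo_swap F
          cont[OF holo_swap[OF holo_coordC]] cont[OF holo_swap[OF holo_coordX]] compact_cball)
  have "continuous_on (cball 0 \<delta>) (\<lambda>t. F (q t) - mode_series F (q t))"
    unfolding mode_series_def using c1 c2 cont[OF F] by (intro continuous_intros) auto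
  then have "continuous_on (ball 0 \<delta>) (\<lambda>t. F (q t) - mode_series F (q t))"
    by (rule continuous_on_subset) auto
  then have "isCont (\<lambda>t. F (q t) - mode_series F (q t)) 0"
    using \<delta>(1) by (simp add: continuous_on_eq_continuous_at)
  then have lim: "((\<lambda>t. F (q t) - mode_series F (q t)) \<longlongrightarrow> F p - mode_series F p) (at 0)"
    by (simp add: isCont_def q0)
  have fin: "\<exists>z. \<phi>' x = Some z" if "\<phi>' \<in> sphere_params" "x \<noteq> 0" for \<phi>' and x :: complex
    using that by (auto simp: sphere_params_eq inf_chart_def)
  have "\<forall>\<^sub>F t in at 0. u + t \<noteq> 0"
  proof (cases "u = 0")
    case True then show ?thesis by (simp add: eventually_at_filter)
  next
    case False
    have "((\<lambda>t. u + t) \<longlongrightarrow> u + 0) (at 0)" by (intro tendsto_intros)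
    then show ?thesis using False by (auto dest: tendsto_imp_eventually_ne)
  qed
  moreover have "\<forall>\<^sub>F t in at 0. v + t \<noteq> 0"
  proof (cases "v = 0")
    case True then show ?thesis by (simp add: eventually_at_filter)
  next
    case False
    have "((\<lambda>t. v + t) \<longlongrightarrow> v + 0) (at 0)" by (intro tendsto_intros)
    then show ?thesis using False by (auto dest: tendsto_imp_eventually_ne)
  qed
  moreover have "\<forall>\<^sub>F t in at 0. t \<in> ball 0 \<delta>"
    using \<delta>(1) by (intro eventually_at_in_open') auto
  ultimately have "\<forall>\<^sub>F t in at 0. F (q t) - mode_series F (q t) = 0"
  proof eventually_elim
    case (elim t)
    obtain z w where zw: "q t = (Some z, Some w)"
      using fin[OF \<phi>(1) elim(1)] fin[OF \<psi>(1) elim(2)] by (auto simp: q_def)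
    with Y[of t] elim(3) have "z * w \<noteq> 1" by simp
    with mode_series_finite[OF F, of z w] zw show ?case by simp
  qed
  then have "((\<lambda>t. F (q t) - mode_series F (q t)) \<longlongrightarrow> 0) (at 0)"
    by (rule tendsto_eventually)
  with lim have "F p - mode_series F p = 0" by (intro LIM_unique[of _ _ 0])
  then show ?thesis by simp
qed

lemma pterm_shift_summable:
  assumes "holo F"
  shows "(\<lambda>(n, l). pterm F (n + m) l p) summable_on UNIV"
proof -
  have "(\<lambda>(n, l). pterm F n l p) summable_on (\<lambda>(n, l). (n + m, l)) ` UNIV"
    by (rule summable_on_subset[OF pterm_summable[OF assms]]) auto
  then show ?thesis
    by (subst (asm) summable_on_reindex) (auto simp: inj_on_def comp_def case_prod_beta')
qed

text \<open>The identity principle on Omega. A small torus is mapped near the origin, so Cauchy's inequality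
  with bound \<open>0\<close> kills all Taylor coefficients, and these determine \<open>F\<close> everywhere.\<close>

lemma holo_zero_near_origin:
  assumes F: "holo F" and r: "r > 0" "r < 1"
    and 0: "\<And>z w. norm z < r \<Longrightarrow> norm w < r \<Longrightarrow> F (Some z, Some w) = 0" and p: "p \<in> Omega"
  shows "F p = 0"
proof -
  define R where "R = r / 2"
  have R: "R > 0" "R < 1/2" using r by (auto simp: R_def)
  have small: "F (param x) = 0 \<and> F (prod.swap (param x)) = 0" if "x \<in> sphere 0 R \<times> sphere 0 R" for x
  proof -
    have n: "norm (fst x) = R" "norm (snd x) = R" using that by auto
    have "R * R \<le> 1/2 * 1/2" using R by (intro order_trans[OF mult_mono[of R "1/2" R "1/2"]]) auto
    then have n1: "norm (fst x * snd x) \<le> 1/4" by (simp add: norm_mult n)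
    have "norm (1 + fst x * snd x) \<ge> norm (1::complex) - norm (fst x * snd x)"
      using norm_diff_ineq[of 1 "fst x * snd x"] by simp
    with n1 have n2: "norm (1 + fst x * snd x) \<ge> 3/4" by simp
    then have ne: "1 + fst x * snd x \<noteq> 0" by auto
    have "norm (snd x / (1 + fst x * snd x)) \<le> R / (3/4)"
      unfolding norm_divide n using n2 R by (intro divide_left_mono mult_pos_pos) auto
    also have "\<dots> < r" using R by (simp add: R_def)
    finally have "norm (snd x / (1 + fst x * snd x)) < r" .
    moreover have "norm (fst x) < r" using n R r by (simp add: R_def)
    ultimately show ?thesis using 0 by (simp add: param_chart(1)[OF ne])
  qed
  have t0: "F x = 0 \<and> F (prod.swap x) = 0" if "x \<in> torus R" for x
    using that small unfolding torus_def by blast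
  have "norm (gcoef F i j) \<le> 0 / R ^ (i + j)" for i j
    by (rule norm_gcoef_le[OF F R(1)]) (use t0 in auto)
  then have g: "gcoef F i j = 0" for i j by simp
  have "norm (gcoef (\<lambda>p. F (prod.swap p)) i j) \<le> 0 / R ^ (i + j)" for i j
    by (rule norm_gcoef_le[OF holo_swap[OF F] R(1)]) (use t0 in auto)
  then have h: "gcoef (\<lambda>p. F (prod.swap p)) i j = 0" for i j by simp
  show ?thesis unfolding mode_series_eq[OF F p] by (simp add: mode_series_def pterm_def pcoef_def g h case_prod_beta')
qed

section \<open>The modes as polynomials in b, c and x\<close>

text \<open>The modes in the coordinates of the quadric; \<open>PFM_eq\<close> identifies them.\<close>

definition mode_fun :: "nat \<Rightarrow> int \<Rightarrow> sphere \<times> sphere \<Rightarrow> complex" where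
  "mode_fun m n p = (-1) ^ nat \<bar>n\<bar> * ((if n \<ge> 0 then coordC p else coordB p) ^ nat \<bar>n\<bar>
     * jac_poly (nat \<bar>n\<bar>) (m - nat \<bar>n\<bar>) (coordX p))"

lemma holo_mode_fun: "holo (mode_fun m n)"
proof -
  have "holo (\<lambda>p. if n \<ge> 0 then coordC p else coordB p)"
    using holo_coordC holo_coordB by (cases "n \<ge> 0") simp_all
  then show ?thesis
    unfolding mode_fun_def[abs_def] jac_poly_def
    by (intro holo_mult holo_const holo_power holo_sum holo_coordX)
qed

lemma mode_fun_swap: "mode_fun m n (prod.swap p) = mode_fun m (- n) p"
  by (auto simp: mode_fun_def coordB_def)

text \<open>With \<open>x = t / (1 - t)\<close> this is the Pfaff transformation of the hypergeometric polynomial in \<open>t\<close>.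
  Expanding \<open>(1 + x)^(l - k)\<close> and comparing coefficients reduces it to Vandermonde's convolution.\<close>

lemma binomial_product_expansion:
  "(\<Sum>k\<le>l. of_nat ((N + l) choose k) * of_nat ((N + l) choose (N + k)) * (x ^ k * (1 + x) ^ (l - k)))
   = jac_poly N l x"
proof -
  let ?a = "\<lambda>k. of_nat ((N + l) choose k) * of_nat ((N + l) choose (N + k)) :: complex"
  have "(\<Sum>k\<le>l. ?a k * (x ^ k * (1 + x) ^ (l - k)))
      = (\<Sum>k\<le>l. \<Sum>j\<le>l - k. ?a k * of_nat ((l - k) choose j) * x ^ (k + j))"
  proof (rule sum.cong[OF refl])
    fix k
    have "(1 + x) ^ (l - k) = (\<Sum>j\<le>l - k. of_nat ((l - k) choose j) * x ^ j)"
      using binomial_ring[of x 1 "l - k"] by (simp add: add.commute)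
    then show "?a k * (x ^ k * (1 + x) ^ (l - k)) = (\<Sum>j\<le>l - k. ?a k * of_nat ((l - k) choose j) * x ^ (k + j))"
      by (simp add: sum_distrib_left power_add algebra_simps)
  qed
  also have "\<dots> = (\<Sum>(k, j)\<in>(SIGMA k:{..l}. {..l - k}). ?a k * of_nat ((l - k) choose j) * x ^ (k + j))"
    by (rule sum.Sigma) auto
  also have "\<dots> = (\<Sum>(i, k)\<in>(SIGMA i:{..l}. {..i}). ?a k * of_nat ((l - k) choose (i - k)) * x ^ i)"
    by (rule sum.reindex_bij_witness[where i = "\<lambda>(i, k). (k, i - k)" and j = "\<lambda>(k, j). (k + j, k)"]) auto
  also have "\<dots> = (\<Sum>i\<le>l. \<Sum>k\<le>i. ?a k * of_nat ((l - k) choose (i - k)) * x ^ i)"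
    by (rule sum.Sigma[symmetric]) auto
  also have "\<dots> = (\<Sum>i\<le>l. jac_coef N l i * x ^ i)"
  proof (rule sum.cong[OF refl])
    fix i assume "i \<in> {..l}"
    then have i: "i \<le> l" by simp
    have "((N + l) choose k) * ((N + l) choose (N + k)) * ((l - k) choose (i - k))
        = ((N + l) choose (N + i)) * (((N + l) choose k) * ((N + i) choose (i - k)))" if k: "k \<le> i" for k
    proof -
      have "((N + l) choose (N + i)) * ((N + i) choose (N + k))
          = ((N + l) choose (N + k)) * ((N + l - (N + k)) choose (N + i - (N + k)))"
        by (rule choose_mult) (use k i in auto)
      moreover have "(N + i) choose (N + k) = (N + i) choose (i - k)"
        using binomial_symmetric[of "N + k" "N + i"] k by simp
      ultimately show ?thesis by (simp add: algebra_simps)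
    qed
    then have "(\<Sum>k\<le>i. ((N + l) choose k) * ((N + l) choose (N + k)) * ((l - k) choose (i - k)))
        = ((N + l) choose (N + i)) * (\<Sum>k\<le>i. ((N + l) choose k) * ((N + i) choose (i - k)))"
      unfolding sum_distrib_left by (intro sum.cong[OF refl]) simp
    also have "(\<Sum>k\<le>i. ((N + l) choose k) * ((N + i) choose (i - k))) = (N + l + (N + i)) choose i"
      by (rule vandermonde)
    also have "N + l + (N + i) = 2 * N + l + i" by simp
    finally have "(of_nat (\<Sum>k\<le>i. ((N + l) choose k) * ((N + l) choose (N + k)) * ((l - k) choose (i - k))) :: complex)
        = jac_coef N l i" unfolding jac_coef_def by simp
    then show "(\<Sum>k\<le>i. ?a k * of_nat ((l - k) choose (i - k)) * x ^ i) = jac_coef N l i * x ^ i"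
      by (simp add: sum_distrib_right[symmetric])
  qed
  finally show ?thesis by (simp add: jac_poly_def)
qed

lemma pochhammer_minus_nat:
  "k \<le> m \<Longrightarrow> pochhammer (- of_nat m :: complex) k = (-1) ^ k * (fact m / fact (m - k))"
proof (induction k)
  case (Suc k)
  then have 1: "m - k = Suc (m - Suc k)" by simp
  have 2: "(- of_nat m + of_nat k :: complex) = - of_nat (m - k)" using Suc.prems by (simp add: of_nat_diff)
  have "pochhammer (- of_nat m :: complex) (Suc k) = (-1) ^ k * (fact m / fact (m - k)) * (- of_nat (m - k))"
    using Suc by (simp only: pochhammer_Suc 2)
  also have "\<dots> = (-1) ^ Suc k * (fact m / fact (m - Suc k))"
    unfolding 1 fact_Suc using of_nat_neq_0[of "m - Suc k", where 'a = complex]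
    by (simp del: of_nat_Suc)
  finally show ?case .
qed simp

lemma pochhammer_Suc_nat: "pochhammer (of_nat N + 1 :: complex) k = fact (N + k) / fact N"
proof (induction k)
  case (Suc k)
  have "pochhammer (of_nat N + 1 :: complex) (Suc k) = fact (N + k) / fact N * of_nat (Suc (N + k))"
    unfolding pochhammer_Suc Suc by (simp add: algebra_simps)
  then show ?case by simp
qed simp

lemma hyp2F1_eq:
  assumes m: "m = N + l"
  shows "of_nat (m choose N) * hyp2F1 (- of_nat m) (- of_nat l) (of_nat N + 1) t
       = (\<Sum>k\<le>l. of_nat (m choose k) * of_nat (m choose (N + k)) * t ^ k)"
proof -
  have "(\<lambda>k. pochhammer (- of_nat m) k * pochhammer (- of_nat l) k / pochhammer (of_nat N + 1) k * (t ^ k / fact k))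
      sums (\<Sum>k\<le>l. pochhammer (- of_nat m) k * pochhammer (- of_nat l) k / pochhammer (of_nat N + 1) k * (t ^ k / fact k))"
    by (rule sums_finite) (auto simp: pochhammer_of_nat_eq_0_lemma)
  then have "hyp2F1 (- of_nat m) (- of_nat l) (of_nat N + 1) t =
      (\<Sum>k\<le>l. pochhammer (- of_nat m) k * pochhammer (- of_nat l) k / pochhammer (of_nat N + 1) k * (t ^ k / fact k))"
    unfolding hyp2F1_def by (rule sums_unique[symmetric])
  then show ?thesis
  proof (simp only: sum_distrib_left, intro sum.cong[OF refl])
    fix k assume "k \<in> {..l}"
    then have k: "k \<le> l" "k \<le> m" using m by auto
    have s: "((-1) ^ k * a) * ((-1) ^ k * b) = (a * b :: complex)" for a b
      by (simp flip: power_mult_distrib)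
    have 1: "m - N = l" "m - (N + k) = l - k" using m k by auto
    show "of_nat (m choose N) * (pochhammer (- of_nat m) k * pochhammer (- of_nat l) k / pochhammer (of_nat N + 1) k * (t ^ k / fact k))
       = of_nat (m choose k) * of_nat (m choose (N + k)) * t ^ k"
      unfolding pochhammer_minus_nat[OF k(1)] pochhammer_minus_nat[OF k(2)] pochhammer_Suc_nat s
      using k m by (simp add: binomial_fact 1 ac_simps)
  qed
qed

lemma PFM_formula_eq:
  assumes n: "\<bar>n\<bar> \<le> int m" and zw: "z * w \<noteq> 1"
  shows "PFM_formula m n z w = mode_fun m n (Some z, Some w)"
proof -
  define N where "N = nat \<bar>n\<bar>"
  define l where "l = m - N"
  have m: "m = N + l" using n by (auto simp: N_def l_def)
  have N: "\<bar>n\<bar> = int N" by (simp add: N_def)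
  define t where "t = z * w"
  define x where "x = t / (1 - t)"
  have t: "1 - t \<noteq> 0" using zw by (simp add: t_def)
  have x1: "1 + x = 1 / (1 - t)" using t by (simp add: x_def field_simps)
  have sg: "(-1) powi n = ((-1) ^ N :: complex)"
  proof (cases "n \<ge> 0")
    case True
    then show ?thesis by (simp add: power_int_def N_def)
  next
    case False
    then show ?thesis by (simp add: power_int_def N_def flip: power_inverse)
  qed
  have pw: "(1 - t) powi (- int m) = 1 / (1 - t) ^ m"
    by (simp add: power_int_minus field_simps)
  have hyp: "of_nat (m choose N) * hyp2F1 (- of_nat m) (of_int (int N - int m)) (of_int (int N + 1)) t
     = (\<Sum>k\<le>l. of_nat (m choose k) * of_nat (m choose (N + k)) * t ^ k)"
    using hyp2F1_eq[OF m, of t] by (simp add: m)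
  have "(\<Sum>k\<le>l. of_nat (m choose k) * of_nat (m choose (N + k)) * t ^ k) / (1 - t) ^ m
     = (\<Sum>k\<le>l. of_nat (m choose k) * of_nat (m choose (N + k)) * (x ^ k * (1 + x) ^ (l - k))) / (1 - t) ^ N"
    unfolding sum_divide_distrib
  proof (intro sum.cong[OF refl])
    fix k assume "k \<in> {..l}"
    then have m': "m = k + (l - k) + N" using m by simp
    have "t ^ k / (1 - t) ^ (k + (l - k) + N) = x ^ k * (1 + x) ^ (l - k) / (1 - t) ^ N"
      unfolding x1 unfolding x_def by (simp add: power_add power_divide)
    then have e: "t ^ k / (1 - t) ^ m = x ^ k * (1 + x) ^ (l - k) / (1 - t) ^ N"
      by (simp only: m'[symmetric])
    show "of_nat (m choose k) * of_nat (m choose (N + k)) * t ^ k / (1 - t) ^ m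
      = of_nat (m choose k) * of_nat (m choose (N + k)) * (x ^ k * (1 + x) ^ (l - k)) / (1 - t) ^ N"
      unfolding times_divide_eq_right[symmetric] e ..
  qed
  also have "\<dots> = jac_poly N l x / (1 - t) ^ N"
    using binomial_product_expansion[where N = N and l = l and x = x] by (simp only: m)
  finally have main: "(\<Sum>k\<le>l. of_nat (m choose k) * of_nat (m choose (N + k)) * t ^ k) / (1 - t) ^ m
     = jac_poly N l x / (1 - t) ^ N" .
  define W where "W = (if n \<ge> 0 then w else z)"
  have W: "(if n \<ge> 0 then w ^ nat n else z ^ N) = W ^ N" by (auto simp: W_def N_def)
  have "PFM_formula m n z w = (-1) ^ N * of_nat (m choose N) * (1 / (1 - t) ^ m) *
     hyp2F1 (- of_nat m) (of_int (int N - int m)) (of_int (int N + 1)) t * W ^ N"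
    unfolding PFM_formula_def t_def[symmetric] N_def[symmetric] N sg pw nat_int W .. 
  also have "\<dots> = (-1) ^ N * ((of_nat (m choose N) *
     hyp2F1 (- of_nat m) (of_int (int N - int m)) (of_int (int N + 1)) t) / (1 - t) ^ m) * W ^ N"
    by simp
  also have "\<dots> = (-1) ^ N * (jac_poly N l x / (1 - t) ^ N) * W ^ N"
    unfolding hyp main ..
  also have "\<dots> = (-1) ^ N * ((W / (1 - t)) ^ N * jac_poly N l x)"
    by (simp add: power_divide)
  also have "\<dots> = mode_fun m n (Some z, Some w)"
    by (auto simp: mode_fun_def N_def l_def W_def t_def x_def coordB_def mult.commute)
  finally show ?thesis .
qed

lemma hol_Omega_eqI:
  assumes F: "F \<in> hol_Omega" and G: "G \<in> hol_Omega" and r: "r > 0" "r < 1"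
    and eq: "\<And>z w. norm z < r \<Longrightarrow> norm w < r \<Longrightarrow> F (Some z, Some w) = G (Some z, Some w)"
  shows "F = G"
proof (rule extensionalityI[of F Omega G])
  fix p assume p: "p \<in> Omega"
  have "holo (\<lambda>p. F p + (-1) * G p)"
    using F G by (intro holo_add holo_mult holo_const) (auto simp: hol_Omega_iff)
  from holo_zero_near_origin[OF this r _ p] eq show "F p = G p" by simp
qed (use F G in \<open>auto simp: hol_Omega_iff\<close>)

lemma mult_neq_one_of_small: "norm z < 1 \<Longrightarrow> norm w < 1 \<Longrightarrow> z * w \<noteq> (1 :: complex)"
  using mult_strict_mono'[of "norm z" 1 "norm w" 1] by (metis mult_1 norm_ge_zero norm_mult norm_one order_less_irrefl)

text \<open>The description by a unique holomorphic extension is legitimate because a function in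
  \<open>hol_Omega\<close> is determined by its values near the origin.\<close>

lemma PFM_eq:
  assumes n: "\<bar>n\<bar> \<le> int m"
  shows "PFM m n = restrict (mode_fun m n) Omega"
  unfolding PFM_def
proof (rule the_equality)
  show "restrict (mode_fun m n) Omega \<in> hol_Omega \<and>
     (\<forall>z w. z * w \<noteq> 1 \<longrightarrow> restrict (mode_fun m n) Omega (Some z, Some w) = PFM_formula m n z w)"
    using restrict_hol_Omega[OF holo_mode_fun] PFM_formula_eq[OF n] by simp
  fix F assume F: "F \<in> hol_Omega \<and> (\<forall>z w. z * w \<noteq> 1 \<longrightarrow> F (Some z, Some w) = PFM_formula m n z w)"
  show "F = restrict (mode_fun m n) Omega"
    by (rule hol_Omega_eqI[where r = "1/2"])
       (use F restrict_hol_Omega[OF holo_mode_fun] PFM_formula_eq[OF n] mult_neq_one_of_small in auto)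
qed

section \<open>Coefficient functionals\<close>

lemma gcoef_cong: "(\<And>p. p \<in> Omega \<Longrightarrow> F p = G p) \<Longrightarrow> gcoef F = gcoef G"
  by (simp add: gcoef_def)

lemma pcoef_cong: "(\<And>p. p \<in> Omega \<Longrightarrow> F p = G p) \<Longrightarrow> pcoef F = pcoef G"
  using gcoef_cong[of F G] by (simp add: pcoef_def[abs_def])

lemma gcoef_linear:
  assumes "holo F" "holo G"
  shows "gcoef (\<lambda>p. a * F p + b * G p) i j = a * gcoef F i j + b * gcoef G i j"
  unfolding gcoef_def
proof (rule taylor2_unique)
  fix z c
  have "((\<lambda>x. a * (case x of (i, j) \<Rightarrow> tcoef (\<lambda>p. F (param p)) i j * z ^ i * c ^ j)
      + b * (case x of (i, j) \<Rightarrow> tcoef (\<lambda>p. G (param p)) i j * z ^ i * c ^ j))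
     has_sum (a * F (param (z, c)) + b * G (param (z, c)))) UNIV"
    by (intro has_sum_add has_sum_cmult_right taylor2_has_sum holomorphic_param assms)
  then show "((\<lambda>(i, j). (a * tcoef (\<lambda>p. F (param p)) i j + b * tcoef (\<lambda>p. G (param p)) i j) * z ^ i * c ^ j)
     has_sum (a * F (param (z, c)) + b * G (param (z, c)))) UNIV"
    by (simp add: case_prod_beta' algebra_simps)
qed

lemma pcoef_linear:
  assumes "holo F" "holo G"
  shows "pcoef (\<lambda>p. a * F p + b * G p) n l = a * pcoef F n l + b * pcoef G n l"
proof -
  have "((\<lambda>k. a * (gcoef F k (k + n) * jac_inv n k l) + b * (gcoef G k (k + n) * jac_inv n k l))
      has_sum (a * pcoef F n l + b * pcoef G n l)) UNIV"
    unfolding pcoef_def by (intro has_sum_add has_sum_cmult_right has_sum_infsum pcoef_summable assms)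
  from infsumI[OF this] show ?thesis
    by (simp add: pcoef_def gcoef_linear[OF assms] algebra_simps)
qed

text \<open>The coefficient of \<open>mode_fun m n\<close> in the expansion of \<open>F\<close>. For negative \<open>n\<close> it is computed from
  \<open>F\<close> with exchanged coordinates, which turns weight \<open>n\<close> into \<open>-n\<close>.\<close>

definition coef :: "(sphere \<times> sphere \<Rightarrow> complex) \<Rightarrow> nat \<Rightarrow> int \<Rightarrow> complex" where
  "coef F m n = (-1) ^ nat \<bar>n\<bar> * pcoef (if n \<ge> 0 then F else (\<lambda>p. F (prod.swap p))) (nat \<bar>n\<bar>) (m - nat \<bar>n\<bar>)"

lemma coef_cong: "(\<And>p. p \<in> Omega \<Longrightarrow> F p = G p) \<Longrightarrow> coef F = coef G"
  unfolding coef_def[abs_def] using pcoef_cong[of F G] pcoef_cong[of "\<lambda>p. F (prod.swap p)" "\<lambda>p. G (prod.swap p)"]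
  by (auto simp: fun_eq_iff)

lemma coef_linear:
  assumes "holo F" "holo G"
  shows "coef (\<lambda>p. a * F p + b * G p) m n = a * coef F m n + b * coef G m n"
  using pcoef_linear[OF assms] pcoef_linear[OF holo_swap[OF assms(1)] holo_swap[OF assms(2)]]
  by (simp add: coef_def algebra_simps)

lemma coef_sum:
  assumes "finite I" "\<And>k. k \<in> I \<Longrightarrow> holo (F k)"
  shows "coef (\<lambda>p. \<Sum>k\<in>I. d k * F k p) m n = (\<Sum>k\<in>I. d k * coef (F k) m n)"
  using assms
proof (induction I rule: finite_induct)
  case empty
  have "coef (\<lambda>p. 0 * 0 + 0 * 0) m n = 0"
    using coef_linear[OF holo_const holo_const, of 0 0 0 0 m n] by simp
  then show ?case by simp
next
  case (insert x I)
  have "holo (\<lambda>p. \<Sum>k\<in>I. d k * F k p)"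
    using insert by (intro holo_sum holo_mult holo_const) auto
  from coef_linear[OF _ this, of "F x" "d x" 1] insert show ?case by simp
qed

text \<open>Continuity of the coefficient functional; the radius \<open>4\<close> is the smallest one for which
  \<open>norm_pcoef_le\<close> applies.\<close>

lemma coef_bounded:
  obtains K where "compact_Omega K"
    "\<And>F B. holo F \<Longrightarrow> B \<ge> 0 \<Longrightarrow> (\<And>p. p \<in> K \<Longrightarrow> norm (F p) \<le> B) \<Longrightarrow> norm (coef F m n) \<le> 2 * B"
proof
  define K where "K = (if n \<ge> 0 then torus 4 else prod.swap ` torus 4)"
  show "compact_Omega K" by (simp add: K_def compact_torus compact_Omega_swap)
  fix F B assume F: "holo F" and B: "B \<ge> 0" "\<And>p. p \<in> K \<Longrightarrow> norm (F p) \<le> B"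
  show "norm (coef F m n) \<le> 2 * B"
  proof (cases "n \<ge> 0")
    case True
    then show ?thesis
      using norm_pcoef_le[OF F, of 4 B "nat \<bar>n\<bar>" "m - nat \<bar>n\<bar>"] B
      by (simp add: coef_def K_def norm_mult norm_power)
  next
    case False
    then show ?thesis
      using norm_pcoef_le[OF holo_swap[OF F], of 4 B "nat \<bar>n\<bar>" "m - nat \<bar>n\<bar>"] B
      by (simp add: coef_def K_def norm_mult norm_power)
  qed
qed

lemma gcoef_mode_fun_pos:
  assumes "n \<ge> 0"
  shows "gcoef (mode_fun m n) i j = (if j = i + nat n then (-1) ^ nat n * jac_coef (nat n) (m - nat n) i else 0)"
  unfolding gcoef_def
proof (rule taylor2_unique)
  fix z c :: complex
  let ?N = "nat n" and ?l = "m - nat n"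
  let ?f = "\<lambda>(i, j). (if j = i + ?N then (-1) ^ ?N * jac_coef ?N ?l i else 0) * z ^ i * c ^ j"
  have "(?f has_sum mode_fun m n (param (z, c))) UNIV"
  proof (rule has_sum_finite_neutralI[of "(\<lambda>i. (i, i + ?N)) ` {..?l}"])
    have "mode_fun m n (param (z, c)) = (\<Sum>i\<le>?l. ?f (i, i + ?N))"
      using assms by (simp add: mode_fun_def coordC_param coordX_param jac_poly_def sum_distrib_left power_mult_distrib power_add algebra_simps)
    also have "\<dots> = sum ?f ((\<lambda>i. (i, i + ?N)) ` {..?l})"
      by (subst sum.reindex) (auto simp: inj_on_def)
    finally show "mode_fun m n (param (z, c)) = sum ?f ((\<lambda>i. (i, i + ?N)) ` {..?l})" .
  qed (auto simp: jac_coef_eq_0 image_iff not_le)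
  then show "(?f has_sum mode_fun m n (param (z, c))) UNIV" .
qed

lemma coordB_param: "coordB (param p) = fst p * (1 + fst p * snd p)"
  by (auto simp: coordB_def param_def divide_simps)

text \<open>A mode of negative weight \<open>n\<close> is multiplied by \<open>2^\<bar>n\<bar>\<close> under \<open>(z, c) \<mapsto> (2 z, c / 2)\<close>, while
  its Taylor monomial \<open>z^i c^j\<close> is multiplied by \<open>2^(i - j)\<close>. So only monomials with
  \<open>i - j = \<bar>n\<bar> > 0\<close> occur.\<close>

lemma gcoef_mode_fun_neg:
  assumes n: "n < 0" and ij: "i \<le> j"
  shows "gcoef (mode_fun m n) i j = 0"
proof -
  let ?N = "nat \<bar>n\<bar>"
  have scale: "mode_fun m n (param (2 * z, c / 2)) = 2 ^ ?N * mode_fun m n (param (z, c))" for z c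
    using n by (simp add: mode_fun_def coordB_param coordX_param power_mult_distrib)
  have "tcoef (\<lambda>p. mode_fun m n (param p)) i j = tcoef (\<lambda>p. mode_fun m n (param p)) i j * 2 ^ i / 2 ^ j / 2 ^ ?N"
  proof (rule taylor2_unique)
    fix z c
    have "((\<lambda>x. (case x of (i, j) \<Rightarrow> tcoef (\<lambda>p. mode_fun m n (param p)) i j * (2 * z) ^ i * (c / 2) ^ j) * (1 / 2 ^ ?N))
       has_sum mode_fun m n (param (2 * z, c / 2)) * (1 / 2 ^ ?N)) UNIV"
      by (intro has_sum_cmult_left taylor2_has_sum holomorphic_param holo_mode_fun)
    then show "((\<lambda>(i, j). tcoef (\<lambda>p. mode_fun m n (param p)) i j * 2 ^ i / 2 ^ j / 2 ^ ?N * z ^ i * c ^ j)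
       has_sum mode_fun m n (param (z, c))) UNIV"
      unfolding scale by (simp add: case_prod_beta' power_mult_distrib power_divide ac_simps)
  qed
  then have eq: "gcoef (mode_fun m n) i j * (2 ^ j * 2 ^ ?N) = gcoef (mode_fun m n) i j * 2 ^ i"
    by (simp add: gcoef_def field_simps)
  have "(2::nat) ^ i < 2 ^ (j + ?N)" using n ij by (intro power_strict_increasing) auto
  then have "of_nat (2 ^ i) \<noteq> (of_nat (2 ^ (j + ?N)) :: complex)" unfolding of_nat_eq_iff by simp
  then have "2 ^ j * 2 ^ ?N \<noteq> (2 ^ i :: complex)" by (simp add: power_add)
  with eq show ?thesis by auto
qed

lemma pcoef_mode_fun_pos:
  assumes "n \<ge> 0"
  shows "pcoef (mode_fun m n) n' l = (if n' = nat n \<and> l = m - nat n then (-1) ^ nat n else 0)"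
proof (cases "n' = nat n")
  case False
  then show ?thesis by (auto simp: pcoef_def gcoef_mode_fun_pos[OF assms])
next
  case True
  let ?N = "nat n" and ?l = "m - nat n"
  have "((\<lambda>k. (-1) ^ ?N * (jac_coef ?N ?l k * jac_inv ?N k l)) has_sum
      (-1) ^ ?N * (if ?l = l then 1 else 0)) UNIV"
  proof (intro has_sum_cmult_right has_sum_finite_neutralI[of "{l..?l}"])
    show "(if ?l = l then 1 else 0) = (\<Sum>k\<in>{l..?l}. jac_coef ?N ?l k * jac_inv ?N k l)"
      using jac_coef_inv[of l ?l ?N] by (cases "l \<le> ?l") auto
  qed (auto simp: jac_coef_eq_0 jac_inv_eq_0 not_le)
  from infsumI[OF this] show ?thesis
    unfolding pcoef_def by (simp add: True gcoef_mode_fun_pos[OF assms] mult.assoc)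
qed

lemma pcoef_mode_fun_neg: "n < 0 \<Longrightarrow> pcoef (mode_fun m n) n' l = 0"
  by (simp add: pcoef_def gcoef_mode_fun_neg)

definition mode_index :: "(nat \<times> int) set" where
  "mode_index = {(m, n). \<bar>n\<bar> \<le> int m}"

text \<open>Biorthogonality: different weights do not interact, and within one weight the coefficient is an
  entry of the product of the two inverse matrices.\<close>

lemma coef_mode_fun:
  assumes "(m, n) \<in> mode_index" "(m', n') \<in> mode_index"
  shows "coef (mode_fun m' n') m n = (if m = m' \<and> n = n' then 1 else 0)"
proof (cases "n \<ge> 0")
  case True
  then show ?thesis
    using assms pcoef_mode_fun_pos[of n' m' "nat n" "m - nat n"] pcoef_mode_fun_neg[of n' m' "nat n" "m - nat n"]
    by (cases "n' \<ge> 0") (auto simp: coef_def mode_index_def simp flip: power_mult_distrib)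
next
  case False
  then show ?thesis
    using assms pcoef_mode_fun_pos[of "- n'" m' "nat (- n)" "m - nat (- n)"] pcoef_mode_fun_neg[of "- n'" m' "nat (- n)" "m - nat (- n)"]
    by (cases "n' \<le> 0") (auto simp: coef_def mode_index_def mode_fun_swap simp flip: power_mult_distrib)
qed

section \<open>Unconditional expansion in modes\<close>

lemma bij_mode_index_pos: "bij_betw (\<lambda>(n, l). (n + l, int n)) UNIV {(m, n). \<bar>n\<bar> \<le> int m \<and> n \<ge> 0}"
  by (rule bij_betw_byWitness[where f' = "\<lambda>(m, n). (nat n, m - nat n)"]) auto

lemma bij_mode_index_neg:
  "bij_betw (\<lambda>(n, l). (n + 1 + l, - int (n + 1))) UNIV {(m, n). \<bar>n\<bar> \<le> int m \<and> n < 0}"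
  by (rule bij_betw_byWitness[where f' = "\<lambda>(m, n). (nat (- n) - 1, m - nat (- n))"]) auto

lemma mode_index_Un: "mode_index = {(m, n). \<bar>n\<bar> \<le> int m \<and> n \<ge> 0} \<union> {(m, n). \<bar>n\<bar> \<le> int m \<and> n < 0}"
  by (auto simp: mode_index_def)

lemma mode_index_disjoint: "{(m, n). \<bar>n\<bar> \<le> int m \<and> n \<ge> 0} \<inter> {(m, n). \<bar>n\<bar> \<le> int m \<and> n < 0} = {}"
  by auto

lemma coef_mode_fun_eq_pterm:
  "coef F (n + l) (int n) * mode_fun (n + l) (int n) p = pterm F n l p"
  "coef F (n + 1 + l) (- int (n + 1)) * mode_fun (n + 1 + l) (- int (n + 1)) p
     = pterm (\<lambda>p. F (prod.swap p)) (n + 1) l (prod.swap p)"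
proof -
  have s: "((-1) ^ k * a) * ((-1) ^ k * b) = (a * b :: complex)" for a b k
    by (simp flip: power_mult_distrib)
  show "coef F (n + l) (int n) * mode_fun (n + l) (int n) p = pterm F n l p"
    unfolding coef_def mode_fun_def s pterm_def by simp
  have 1: "\<not> - int (n + 1) \<ge> 0" "nat \<bar>- int (n + 1)\<bar> = n + 1" "n + 1 + l - (n + 1) = l" by auto
  show "coef F (n + 1 + l) (- int (n + 1)) * mode_fun (n + 1 + l) (- int (n + 1)) p
     = pterm (\<lambda>p. F (prod.swap p)) (n + 1) l (prod.swap p)"
    unfolding coef_def mode_fun_def 1 s pterm_def by (simp only: if_False 1 coordB_def coordX_swap)
qed

lemma mode_expansion:
  assumes F: "holo F" and p: "p \<in> Omega"
  shows "((\<lambda>(m, n). coef F m n * mode_fun m n p) has_sum F p) mode_index"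
proof -
  let ?F' = "\<lambda>p. F (prod.swap p)" and ?f = "\<lambda>(m, n). coef F m n * mode_fun m n p"
  have "((\<lambda>(n, l). pterm F n l p) has_sum (\<Sum>\<^sub>\<infinity>(n, l). pterm F n l p)) UNIV"
    by (intro has_sum_infsum pterm_summable F)
  then have 1: "(?f has_sum (\<Sum>\<^sub>\<infinity>(n, l). pterm F n l p)) {(m, n). \<bar>n\<bar> \<le> int m \<and> n \<ge> 0}"
    by (subst has_sum_reindex_bij_betw[OF bij_mode_index_pos, symmetric])
       (simp add: case_prod_beta' coef_mode_fun_eq_pterm(1))
  have "((\<lambda>(n, l). pterm ?F' (n + 1) l (prod.swap p)) has_sum (\<Sum>\<^sub>\<infinity>(n, l). pterm ?F' (n + 1) l (prod.swap p))) UNIV"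
    by (intro has_sum_infsum pterm_shift_summable holo_swap F)
  then have 2: "(?f has_sum (\<Sum>\<^sub>\<infinity>(n, l). pterm ?F' (n + 1) l (prod.swap p))) {(m, n). \<bar>n\<bar> \<le> int m \<and> n < 0}"
    by (subst has_sum_reindex_bij_betw[OF bij_mode_index_neg, symmetric])
       (simp only: case_prod_beta' coef_mode_fun_eq_pterm(2) fst_conv snd_conv)
  show ?thesis
    using has_sum_Un_disjoint[OF 1 2 mode_index_disjoint]
    unfolding mode_index_Un[symmetric] mode_series_def[symmetric] mode_series_eq[OF F p, symmetric] .
qed

text \<open>There are \<open>2 m + 1\<close> indices for each \<open>m\<close>, which the geometric decay outweighs.\<close>

lemma summable_mode_index: "(\<lambda>(m, n). B * (1 / 2) ^ m) summable_on mode_index" for B :: real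
  unfolding mode_index_Un
proof (rule summable_on_Un_disjoint[OF _ _ mode_index_disjoint])
  show "(\<lambda>(m, n). B * (1 / 2) ^ m) summable_on {(m, n). \<bar>n\<bar> \<le> int m \<and> n \<ge> 0}"
    using summable_half_powers2[of B]
    by (subst summable_on_reindex_bij_betw[OF bij_mode_index_pos, symmetric]) (simp add: case_prod_beta')
  have "(\<lambda>(n, l). (B / 2) * (1 / 2) ^ (n + l)) summable_on UNIV"
    by (rule summable_half_powers2)
  then show "(\<lambda>(m, n). B * (1 / 2) ^ m) summable_on {(m, n). \<bar>n\<bar> \<le> int m \<and> n < 0}"
    by (subst summable_on_reindex_bij_betw[OF bij_mode_index_neg, symmetric]) (simp add: case_prod_beta')
qed

lemma mode_expansion_bound:
  assumes F: "holo F" and K: "compact_Omega K"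
  obtains B where "B \<ge> 0"
    "\<And>p m n. p \<in> K \<Longrightarrow> (m, n) \<in> mode_index \<Longrightarrow> norm (coef F m n * mode_fun m n p) \<le> B * (1 / 2) ^ m"
proof -
  obtain b1 where b1: "\<And>p. p \<in> K \<Longrightarrow> norm (coordC p) \<le> b1" using holo_bounded[OF holo_coordC K] by blast
  obtain b2 where b2: "\<And>p. p \<in> K \<Longrightarrow> norm (coordB p) \<le> b2" using holo_bounded[OF holo_coordB K] by blast
  obtain b3 where b3: "\<And>p. p \<in> K \<Longrightarrow> norm (coordX p) \<le> b3" using holo_bounded[OF holo_coordX K] by blast
  define \<rho> where "\<rho> = Max {1, b1, b2, b3}"
  have \<rho>: "\<rho> \<ge> 1" "b1 \<le> \<rho>" "b2 \<le> \<rho>" "b3 \<le> \<rho>" by (auto simp: \<rho>_def)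
  obtain B1 where B1: "B1 \<ge> 0"
    "\<And>p n l. norm (coordC p) \<le> \<rho> \<Longrightarrow> norm (coordX p) \<le> \<rho> \<Longrightarrow> norm (pterm F n l p) \<le> B1 * (1 / 2) ^ (n + l)"
    using norm_pterm_le[OF F \<rho>(1)] by blast
  obtain B2 where B2: "B2 \<ge> 0"
    "\<And>p n l. norm (coordC p) \<le> \<rho> \<Longrightarrow> norm (coordX p) \<le> \<rho> \<Longrightarrow> norm (pterm (\<lambda>p. F (prod.swap p)) n l p) \<le> B2 * (1 / 2) ^ (n + l)"
    using norm_pterm_le[OF holo_swap[OF F] \<rho>(1)] by blast
  have "norm (coef F m n * mode_fun m n p) \<le> (B1 + B2) * (1 / 2) ^ m"
    if p: "p \<in> K" and mn: "(m, n) \<in> mode_index" for p m n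
  proof (cases "n \<ge> 0")
    case True
    then obtain N l where N: "m = N + l" "n = int N"
      using mn le_Suc_ex[of "nat n" m] by (auto simp: mode_index_def) (metis nonneg_int_cases le_Suc_ex of_nat_le_iff)
    have "norm (coef F m n * mode_fun m n p) \<le> B1 * (1 / 2) ^ m"
      unfolding N coef_mode_fun_eq_pterm using b1[OF p] b3[OF p] \<rho> by (intro B1) auto
    also have "\<dots> \<le> (B1 + B2) * (1 / 2) ^ m" using B2 by (intro mult_right_mono) auto
    finally show ?thesis .
  next
    case False
    then obtain N where N: "n = - int (N + 1)"
      by (metis add.commute negD not_le_imp_less plus_1_eq_Suc)
    with mn obtain l where l: "m = N + 1 + l"
      using le_Suc_ex[of "N + 1" m] by (auto simp: mode_index_def)
    have "norm (coef F m n * mode_fun m n p) \<le> B2 * (1 / 2) ^ m"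
      unfolding N l coef_mode_fun_eq_pterm using b2[OF p] b3[OF p] \<rho> by (intro B2) (auto simp: coordB_def)
    also have "\<dots> \<le> (B1 + B2) * (1 / 2) ^ m" using B1 by (intro mult_right_mono) auto
    finally show ?thesis .
  qed
  then show ?thesis using that[of "B1 + B2"] B1 B2 by auto
qed

section \<open>Totally real sections are uniqueness sets\<close>

lemma zero_islimpt_reals:
  assumes "r > 0" shows "(0::complex) islimpt (of_real ` {-r<..<r})"
  unfolding islimpt_approachable
proof (intro allI impI)
  fix e :: real assume "e > 0"
  define t where "t = min r e / 2"
  have t: "t > 0" "t < r" "t < e" using assms \<open>e > 0\<close> by (auto simp: t_def min_def)
  then show "\<exists>x'\<in>of_real ` {-r<..<r}. x' \<noteq> 0 \<and> dist x' (0::complex) < e"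
    by (intro bexI[of _ "of_real t"]) auto
qed

text \<open>Write \<open>z = x + \<i> y\<close> and \<open>w = s (x - \<i> y)\<close> with complex \<open>x\<close> and \<open>y\<close>. The surface
  \<open>w = s cnj z\<close> consists of the points with real \<open>x\<close> and \<open>y\<close>, so the identity theorem in one variable
  extends the vanishing from real to complex \<open>x\<close>, and then from real to complex \<open>y\<close>. The sphere uses
  \<open>s = -1\<close> and the disk \<open>s = 1\<close>.\<close>

lemma holo_zero_on_totally_real:
  assumes F: "holo F" and s: "s * s = (1::complex)"
    and 0: "\<And>z. norm z < 1 \<Longrightarrow> F (Some z, Some (s * cnj z)) = 0"
    and zw: "norm z < 1/2" "norm w < 1/2"
  shows "F (Some z, Some w) = 0"
proof -
  have "(norm s)\<^sup>2 = 1"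
    using arg_cong[OF s, of norm] by (simp add: norm_mult power2_eq_square)
  then have ns: "norm s = 1"
    using norm_ge_zero[of s] by (auto simp: power2_eq_1_iff)
  define h where "h = (\<lambda>p. F (Some (fst p + \<i> * snd p), Some (s * (fst p - \<i> * snd p))))"
  have h: "cdiff2 h (x, y)" if "norm x < 1/2" "norm y < 1/2" for x y
  proof -
    have "norm (x + \<i> * y) < 1" "norm (s * (x - \<i> * y)) < 1"
      using that norm_triangle_ineq[of x "\<i> * y"] norm_triangle_ineq4[of x "\<i> * y"]
      by (simp_all add: norm_mult ns)
    then have "(x + \<i> * y) * (s * (x - \<i> * y)) \<noteq> 1" by (rule mult_neq_one_of_small)
    then have "cdiff2 (\<lambda>x. F (Some (fst x), Some (snd x))) (x + \<i> * y, s * (x - \<i> * y))"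
      using F by (auto simp: holo_def sphere_params_eq)
    from cdiff2_compose[where p = "(x, y)" and f = "\<lambda>p. fst p + \<i> * snd p" and g = "\<lambda>p. s * (fst p - \<i> * snd p)"
        and F = "\<lambda>x. F (Some (fst x), Some (snd x))"] this
    show ?thesis unfolding h_def by (simp add: cdiff2_intros)
  qed
  let ?U = "of_real ` {-(1/2)<..<1/2} :: complex set"
  have U: "?U \<subseteq> ball 0 (1/2)" by auto
  have real: "h (of_real a, of_real b) = 0" if "\<bar>a\<bar> < 1/2" "\<bar>b\<bar> < 1/2" for a b :: real
  proof -
    have "norm (of_real a + \<i> * of_real b :: complex) < 1"
      using that norm_triangle_ineq[of "of_real a :: complex" "\<i> * of_real b"] by (simp add: norm_mult)
    from 0[OF this] show ?thesis by (simp add: h_def)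
  qed
  have step1: "h (x, of_real b) = 0" if "norm x < 1/2" "\<bar>b\<bar> < 1/2" for x and b :: real
  proof (rule analytic_continuation[where f = "\<lambda>x. h (x, of_real b)" and S = "ball 0 (1/2)" and U = ?U and \<xi> = 0])
    show "(\<lambda>x. h (x, of_real b)) holomorphic_on ball 0 (1/2)"
      using cdiff2_slice1[OF h] that(2) by (auto simp: holomorphic_on_def field_differentiable_at_within)
    show "0 islimpt ?U" by (rule zero_islimpt_reals) simp
  qed (use real that U in auto)
  have step2: "h (x, y) = 0" if "norm x < 1/2" "norm y < 1/2" for x y
  proof (rule analytic_continuation[where f = "\<lambda>y. h (x, y)" and S = "ball 0 (1/2)" and U = ?U and \<xi> = 0])
    show "(\<lambda>y. h (x, y)) holomorphic_on ball 0 (1/2)"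
      using cdiff2_slice2[OF h] that(1) by (auto simp: holomorphic_on_def field_differentiable_at_within)
    show "0 islimpt ?U" by (rule zero_islimpt_reals) simp
  qed (use step1 that U in auto)
  \<comment> \<open>The solution of \<open>z = x + \<i> y\<close> and \<open>w = s (x - \<i> y)\<close>, using that \<open>s\<close> is its own inverse.\<close>
  define x where "x = (z + s * w) / 2"
  define y where "y = (z - s * w) / (2 * \<i>)"
  have "norm x < 1/2" "norm y < 1/2"
    using zw norm_triangle_ineq[of z "s * w"] norm_triangle_ineq4[of z "s * w"]
    by (simp_all add: x_def y_def norm_divide norm_mult ns)
  then have "h (x, y) = 0" by (rule step2)
  moreover have "x + \<i> * y = z" by (simp add: x_def y_def field_simps)
  moreover have "s * (x - \<i> * y) = w"
  proof -
    have "x - \<i> * y = s * w" by (simp add: x_def y_def field_simps)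
    then show ?thesis using s by (simp add: mult.assoc[symmetric])
  qed
  ultimately show ?thesis by (simp add: h_def)
qed

lemma hol_Omega_eq_on_totally_real:
  assumes F: "F \<in> hol_Omega" and G: "G \<in> hol_Omega" and s: "s * s = (1::complex)"
    and eq: "\<And>z. norm z < 1 \<Longrightarrow> F (Some z, Some (s * cnj z)) = G (Some z, Some (s * cnj z))"
  shows "F = G"
proof (rule hol_Omega_eqI[OF F G, of "1/2"])
  fix z w :: complex assume zw: "norm z < 1/2" "norm w < 1/2"
  have "holo (\<lambda>p. F p + (-1) * G p)"
    using F G by (intro holo_add holo_mult holo_const) (auto simp: hol_Omega_iff)
  from holo_zero_on_totally_real[OF this s _ zw] eq show "F (Some z, Some w) = G (Some z, Some w)" by simp
qed auto

lemma inj_on_restrict_sphere: "inj_on restrict_sphere hol_Omega"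
proof (rule inj_onI)
  fix F G assume FG: "F \<in> hol_Omega" "G \<in> hol_Omega" "restrict_sphere F = restrict_sphere G"
  show "F = G"
    by (rule hol_Omega_eq_on_totally_real[OF FG(1,2), of "-1"])
       (use fun_cong[OF FG(3), of "Some _"] in \<open>auto simp: restrict_sphere_def\<close>)
qed

lemma inj_on_restrict_disk: "inj_on restrict_disk hol_Omega"
proof (rule inj_onI)
  fix F G assume FG: "F \<in> hol_Omega" "G \<in> hol_Omega" "restrict_disk F = restrict_disk G"
  have "F (Some z, Some (cnj z)) = G (Some z, Some (cnj z))" if "norm z < 1" for z
    using fun_cong[OF FG(3), of z] that by (simp add: restrict_disk_def)
  then show "F = G"
    by (intro hol_Omega_eq_on_totally_real[OF FG(1,2), of 1]) auto
qed

section \<open>Smoothness of the restrictions\<close>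

lemma C_k_on_continuous: "C_k_on k f S \<Longrightarrow> continuous_on S f"
  by (cases k) (auto intro!: continuous_at_imp_continuous_on dest: has_derivative_continuous)

lemma C_k_on_Suc_imp: "C_k_on (Suc k) f S \<Longrightarrow> C_k_on k f S"
proof (induction k arbitrary: f)
  case 0
  then show ?case using C_k_on_continuous[of "Suc 0" f S] by simp
next
  case (Suc k)
  from Suc.prems obtain fx fy where
    "\<forall>z\<in>S. (f has_derivative (\<lambda>h. of_real (Re h) * fx z + of_real (Im h) * fy z)) (at z)"
    "C_k_on (Suc k) fx S" "C_k_on (Suc k) fy S" by (subst (asm) C_k_on.simps(2)) blast
  with Suc.IH show ?case by (subst C_k_on.simps(2)) blast
qed

lemma C_k_on_SucI:
  assumes "\<And>z. z \<in> S \<Longrightarrow> (f has_derivative (\<lambda>h. of_real (Re h) * fx z + of_real (Im h) * fy z)) (at z)"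
    "C_k_on k fx S" "C_k_on k fy S"
  shows "C_k_on (Suc k) f S"
  using assms by auto

lemma C_k_on_SucE:
  assumes "C_k_on (Suc k) f S"
  obtains fx fy where "\<And>z. z \<in> S \<Longrightarrow> (f has_derivative (\<lambda>h. of_real (Re h) * fx z + of_real (Im h) * fy z)) (at z)"
    "C_k_on k fx S" "C_k_on k fy S"
  using assms by auto

lemma C_k_on_const: "C_k_on k (\<lambda>_. c) S"
proof (induction k arbitrary: c)
  case (Suc k)
  show ?case by (rule C_k_on_SucI[OF _ Suc[of 0] Suc[of 0]]) simp
qed auto

lemma C_k_on_id: "C_k_on k (\<lambda>z. z) S"
proof (cases k)
  case (Suc k)
  have "(\<lambda>h. of_real (Re h) * 1 + of_real (Im h) * \<i>) = (\<lambda>h. h)"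
    by (simp add: fun_eq_iff complex_eq_iff)
  then have "((\<lambda>z. z) has_derivative (\<lambda>h. of_real (Re h) * 1 + of_real (Im h) * \<i>)) (at z)" for z
    by (simp only: has_derivative_ident)
  then show ?thesis unfolding Suc by (rule C_k_on_SucI[OF _ C_k_on_const C_k_on_const])
qed auto

lemma C_k_on_cnj: "C_k_on k cnj S"
proof (cases k)
  case (Suc k)
  have "(\<lambda>h. of_real (Re h) * 1 + of_real (Im h) * (- \<i>)) = cnj"
    by (simp add: fun_eq_iff complex_eq_iff)
  then have "(cnj has_derivative (\<lambda>h. of_real (Re h) * 1 + of_real (Im h) * (- \<i>))) (at z)" for z
    by (simp only: bounded_linear_imp_has_derivative[OF bounded_linear_cnj])
  then show ?thesis unfolding Suc by (rule C_k_on_SucI[OF _ C_k_on_const C_k_on_const])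
qed (auto intro: continuous_intros)

lemma C_k_on_add: "C_k_on k f S \<Longrightarrow> C_k_on k g S \<Longrightarrow> C_k_on k (\<lambda>z. f z + g z) S"
proof (induction k arbitrary: f g)
  case 0 then show ?case by (auto intro: continuous_intros)
next
  case (Suc k)
  obtain fx fy where f: "\<And>z. z \<in> S \<Longrightarrow> (f has_derivative (\<lambda>h. of_real (Re h) * fx z + of_real (Im h) * fy z)) (at z)"
    "C_k_on k fx S" "C_k_on k fy S" using C_k_on_SucE[OF Suc.prems(1)] by blast
  obtain gx gy where g: "\<And>z. z \<in> S \<Longrightarrow> (g has_derivative (\<lambda>h. of_real (Re h) * gx z + of_real (Im h) * gy z)) (at z)"
    "C_k_on k gx S" "C_k_on k gy S" using C_k_on_SucE[OF Suc.prems(2)] by blast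
  show ?case
  proof (rule C_k_on_SucI[OF _ Suc.IH[OF f(2) g(2)] Suc.IH[OF f(3) g(3)]])
    fix z assume "z \<in> S"
    from has_derivative_add[OF f(1)[OF this] g(1)[OF this]]
    show "((\<lambda>z. f z + g z) has_derivative
        (\<lambda>h. of_real (Re h) * (fx z + gx z) + of_real (Im h) * (fy z + gy z))) (at z)"
      by (simp add: algebra_simps)
  qed
qed

lemma C_k_on_mult: "C_k_on k f S \<Longrightarrow> C_k_on k g S \<Longrightarrow> C_k_on k (\<lambda>z. f z * g z) S"
proof (induction k arbitrary: f g)
  case 0 then show ?case by (auto intro: continuous_intros)
next
  case (Suc k)
  obtain fx fy where f: "\<And>z. z \<in> S \<Longrightarrow> (f has_derivative (\<lambda>h. of_real (Re h) * fx z + of_real (Im h) * fy z)) (at z)"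
    "C_k_on k fx S" "C_k_on k fy S" using C_k_on_SucE[OF Suc.prems(1)] by blast
  obtain gx gy where g: "\<And>z. z \<in> S \<Longrightarrow> (g has_derivative (\<lambda>h. of_real (Re h) * gx z + of_real (Im h) * gy z)) (at z)"
    "C_k_on k gx S" "C_k_on k gy S" using C_k_on_SucE[OF Suc.prems(2)] by blast
  note fg = C_k_on_Suc_imp[OF Suc.prems(1)] C_k_on_Suc_imp[OF Suc.prems(2)]
  show ?case
  proof (rule C_k_on_SucI)
    fix z assume "z \<in> S"
    from has_derivative_mult[OF f(1)[OF this] g(1)[OF this]]
    show "((\<lambda>z. f z * g z) has_derivative
        (\<lambda>h. of_real (Re h) * (f z * gx z + fx z * g z) + of_real (Im h) * (f z * gy z + fy z * g z))) (at z)"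
      by (simp add: algebra_simps)
  qed (intro C_k_on_add Suc.IH fg f g)+
qed

lemma C_k_on_inverse:
  "C_k_on k f S \<Longrightarrow> (\<And>z. z \<in> S \<Longrightarrow> f z \<noteq> 0) \<Longrightarrow> C_k_on k (\<lambda>z. inverse (f z)) S"
proof (induction k)
  case 0 then show ?case by (auto intro: continuous_intros)
next
  case (Suc k)
  obtain fx fy where f: "\<And>z. z \<in> S \<Longrightarrow> (f has_derivative (\<lambda>h. of_real (Re h) * fx z + of_real (Im h) * fy z)) (at z)"
    "C_k_on k fx S" "C_k_on k fy S" using C_k_on_SucE[OF Suc.prems(1)] by blast
  have i: "C_k_on k (\<lambda>z. inverse (f z)) S"
    using Suc.IH[OF C_k_on_Suc_imp[OF Suc.prems(1)]] Suc.prems(2) by blast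
  show ?case
  proof (rule C_k_on_SucI)
    fix z assume z: "z \<in> S"
    from Deriv.has_derivative_inverse[OF Suc.prems(2)[OF z] f(1)[OF z]]
    show "((\<lambda>z. inverse (f z)) has_derivative
        (\<lambda>h. of_real (Re h) * ((- 1) * (fx z * (inverse (f z) * inverse (f z))))
           + of_real (Im h) * ((- 1) * (fy z * (inverse (f z) * inverse (f z)))))) (at z)"
      by (simp add: algebra_simps)
  qed (intro C_k_on_mult C_k_on_const i f)+
qed

text \<open>These rules make rational functions of \<open>z\<close> and \<open>cnj z\<close> without poles smooth.\<close>

lemma smooth_plane_on_intros:
  "smooth_plane_on (\<lambda>_. c) S" "smooth_plane_on (\<lambda>z. z) S" "smooth_plane_on cnj S"
  "smooth_plane_on f S \<Longrightarrow> smooth_plane_on g S \<Longrightarrow> smooth_plane_on (\<lambda>z. f z + g z) S"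
  "smooth_plane_on f S \<Longrightarrow> smooth_plane_on g S \<Longrightarrow> smooth_plane_on (\<lambda>z. f z * g z) S"
  "smooth_plane_on f S \<Longrightarrow> (\<And>z. z \<in> S \<Longrightarrow> f z \<noteq> 0) \<Longrightarrow> smooth_plane_on (\<lambda>z. inverse (f z)) S"
  by (auto simp: smooth_plane_on_def intro: C_k_on_const C_k_on_id C_k_on_cnj C_k_on_add C_k_on_mult C_k_on_inverse)

lemma smooth_plane_on_power: "smooth_plane_on f S \<Longrightarrow> smooth_plane_on (\<lambda>z. f z ^ n) S"
  by (induction n) (auto intro: smooth_plane_on_intros)

lemma smooth_plane_on_sum:
  "(\<And>i. i \<in> I \<Longrightarrow> smooth_plane_on (f i) S) \<Longrightarrow> smooth_plane_on (\<lambda>z. \<Sum>i\<in>I. f i z) S"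
  by (induction I rule: infinite_finite_induct) (auto intro: smooth_plane_on_intros)

lemma C_k_on_cong:
  assumes "open S" "\<And>z. z \<in> S \<Longrightarrow> f z = g z" "C_k_on k f S"
  shows "C_k_on k g S"
proof (cases k)
  case 0
  then show ?thesis using assms continuous_on_cong[of S S f g] by simp
next
  case (Suc k)
  obtain fx fy where f: "\<And>z. z \<in> S \<Longrightarrow> (f has_derivative (\<lambda>h. of_real (Re h) * fx z + of_real (Im h) * fy z)) (at z)"
    "C_k_on k fx S" "C_k_on k fy S" using C_k_on_SucE[OF assms(3)[unfolded Suc]] by blast
  show ?thesis unfolding Suc
    by (rule C_k_on_SucI[OF _ f(2,3)])
       (rule has_derivative_transform_within_open[OF f(1) assms(1) _ assms(2)])
qed

lemma smooth_plane_on_cong: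
  assumes "open S" "\<And>z. z \<in> S \<Longrightarrow> f z = g z" "smooth_plane_on f S"
  shows "smooth_plane_on g S"
  using assms C_k_on_cong unfolding smooth_plane_on_def by blast

lemma smooth_plane_on_mode_fun_sum:
  assumes "smooth_plane_on (\<lambda>z. coordC (q z)) S" "smooth_plane_on (\<lambda>z. coordB (q z)) S"
    "smooth_plane_on (\<lambda>z. coordX (q z)) S"
  shows "smooth_plane_on (\<lambda>z. \<Sum>i\<in>I. c i * mode_fun (m i) (n i) (q z)) S"
proof -
  have "smooth_plane_on (\<lambda>z. if n i \<ge> 0 then coordC (q z) else coordB (q z)) S" for i
    using assms by (cases "n i \<ge> 0") simp_all
  then show ?thesis
    unfolding mode_fun_def jac_poly_def
    by (intro smooth_plane_on_sum smooth_plane_on_intros smooth_plane_on_power assms)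
qed

lemma antidiagonal_in_Omega [simp]: "(z, map_option (\<lambda>x. - cnj x) z) \<in> Omega"
proof (cases z)
  case (Some x)
  have "Re (x * - cnj x) \<le> 0" by (simp add: algebra_simps)
  then have "x * - cnj x \<noteq> 1" by (metis one_complex.sel(1) not_one_le_zero)
  then show ?thesis using Some by simp
qed simp

lemma one_plus_norm_ne: "1 + z * cnj z \<noteq> 0"
proof -
  have "Re (1 + z * cnj z) > 0" by (simp add: add_pos_nonneg)
  then show ?thesis by (metis less_irrefl zero_complex.sel(1))
qed

lemma smooth_sphere_modes:
  "smooth_sphere (restrict_sphere (restrict (\<lambda>p. \<Sum>i\<in>I. c i * mode_fun (m i) (n i) p) Omega))"
proof -
  let ?P = "\<lambda>p. \<Sum>i\<in>I. c i * mode_fun (m i) (n i) p"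
  note [simp] = one_plus_norm_ne
  have eq: "restrict_sphere (restrict ?P Omega) = (\<lambda>z. ?P (z, map_option (\<lambda>x. - cnj x) z))"
    by (simp add: restrict_sphere_def)
  have ne: "z * - cnj z \<noteq> 1" for z
    using antidiagonal_in_Omega[of "Some z"] by simp
  have "smooth_plane_on (\<lambda>z. ?P (Some z, Some (- cnj z))) UNIV"
  proof (rule smooth_plane_on_mode_fun_sum)
    have "smooth_plane_on (\<lambda>z. (- 1) * cnj z * inverse (1 + z * cnj z)) UNIV"
      "smooth_plane_on (\<lambda>z. z * inverse (1 + z * cnj z)) UNIV"
      "smooth_plane_on (\<lambda>z. (- 1) * (z * cnj z) * inverse (1 + z * cnj z)) UNIV"
      by (intro smooth_plane_on_intros one_plus_norm_ne)+
    then show "smooth_plane_on (\<lambda>z. coordC (Some z, Some (- cnj z))) UNIV"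
      "smooth_plane_on (\<lambda>z. coordB (Some z, Some (- cnj z))) UNIV"
      "smooth_plane_on (\<lambda>z. coordX (Some z, Some (- cnj z))) UNIV"
      by (simp_all add: coordB_def divide_inverse mult.commute)
  qed
  moreover have "smooth_plane_on (\<lambda>u. ?P (inf_chart u, inf_chart (- cnj u))) UNIV"
  proof (rule smooth_plane_on_mode_fun_sum)
    have "smooth_plane_on (\<lambda>u. (- 1) * u * inverse (1 + u * cnj u)) UNIV"
      "smooth_plane_on (\<lambda>u. cnj u * inverse (1 + u * cnj u)) UNIV"
      "smooth_plane_on (\<lambda>u. (- 1) * inverse (1 + u * cnj u)) UNIV"
      by (intro smooth_plane_on_intros one_plus_norm_ne)+
    moreover have d: "u * - cnj u - 1 = - (1 + u * cnj u)" for u by simp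
    have "coordC (inf_chart u, inf_chart (- cnj u)) = (- 1) * u * inverse (1 + u * cnj u)"
      "coordB (inf_chart u, inf_chart (- cnj u)) = cnj u * inverse (1 + u * cnj u)"
      "coordX (inf_chart u, inf_chart (- cnj u)) = (- 1) * inverse (1 + u * cnj u)" for u
    proof -
      have ne2: "- cnj u * u \<noteq> 1" using ne[of u] by (simp add: mult.commute)
      show "coordC (inf_chart u, inf_chart (- cnj u)) = (- 1) * u * inverse (1 + u * cnj u)"
        unfolding coordC_chart(3)[OF ne] d by (simp only: divide_inverse inverse_minus_eq) simp
      show "coordX (inf_chart u, inf_chart (- cnj u)) = (- 1) * inverse (1 + u * cnj u)"
        unfolding coordX_chart(3)[OF ne] d by (simp only: divide_inverse inverse_minus_eq) simp
      have "coordB (inf_chart u, inf_chart (- cnj u)) = - cnj u / (- cnj u * u - 1)"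
        using coordC_chart(3)[OF ne2] by (simp add: coordB_def)
      also have "- cnj u * u - 1 = - (1 + u * cnj u)" by simp
      also have "- cnj u / - (1 + u * cnj u) = cnj u * inverse (1 + u * cnj u)"
        by (simp only: divide_inverse inverse_minus_eq minus_mult_minus)
      finally show "coordB (inf_chart u, inf_chart (- cnj u)) = cnj u * inverse (1 + u * cnj u)" .
    qed
    ultimately show "smooth_plane_on (\<lambda>u. coordC (inf_chart u, inf_chart (- cnj u))) UNIV"
      "smooth_plane_on (\<lambda>u. coordB (inf_chart u, inf_chart (- cnj u))) UNIV"
      "smooth_plane_on (\<lambda>u. coordX (inf_chart u, inf_chart (- cnj u))) UNIV"
      by simp_all
  qed
  moreover have "map_option (\<lambda>x. - cnj x) (inf_chart u) = inf_chart (- cnj u)" for u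
    by (simp add: inf_chart_def)
  ultimately show ?thesis
    unfolding smooth_sphere_def sphere_params_eq eq by (simp add: comp_def)
qed

lemma restrict_sphere_modes_in_A_sphere:
  "restrict_sphere (restrict (\<lambda>p. \<Sum>i\<in>I. c i * mode_fun (m i) (n i) p) Omega) \<in> A_sphere"
proof -
  have "restrict (\<lambda>p. \<Sum>i\<in>I. c i * mode_fun (m i) (n i) p) Omega \<in> hol_Omega"
    by (intro restrict_hol_Omega holo_sum holo_mult holo_const holo_mode_fun)
  then show ?thesis using smooth_sphere_modes unfolding A_sphere_def by blast
qed

lemma restrict_disk_modes_in_A_disk:
  "restrict_disk (restrict (\<lambda>p. \<Sum>i\<in>I. c i * mode_fun (m i) (n i) p) Omega) \<in> A_disk"
proof -
  let ?P = "\<lambda>p. \<Sum>i\<in>I. c i * mode_fun (m i) (n i) p"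
  have P: "restrict ?P Omega \<in> hol_Omega"
    by (intro restrict_hol_Omega holo_sum holo_mult holo_const holo_mode_fun)
  have ne: "z * cnj z \<noteq> 1" if "z \<in> ball 0 1" for z
    by (rule mult_neq_one_of_small) (use that in auto)
  have ne': "1 + (- 1) * (z * cnj z) \<noteq> 0" if "z \<in> ball 0 1" for z
    using ne[OF that] by (simp add: right_minus_eq)
  have "smooth_plane_on (\<lambda>z. ?P (Some z, Some (cnj z))) (ball 0 1)"
  proof (rule smooth_plane_on_mode_fun_sum)
    have "smooth_plane_on (\<lambda>z. cnj z * inverse (1 + (- 1) * (z * cnj z))) (ball 0 1)"
      "smooth_plane_on (\<lambda>z. z * inverse (1 + (- 1) * (z * cnj z))) (ball 0 1)"
      "smooth_plane_on (\<lambda>z. (z * cnj z) * inverse (1 + (- 1) * (z * cnj z))) (ball 0 1)"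
      by (intro smooth_plane_on_intros ne'; assumption)+
    then show "smooth_plane_on (\<lambda>z. coordC (Some z, Some (cnj z))) (ball 0 1)"
      "smooth_plane_on (\<lambda>z. coordB (Some z, Some (cnj z))) (ball 0 1)"
      "smooth_plane_on (\<lambda>z. coordX (Some z, Some (cnj z))) (ball 0 1)"
      by (simp_all add: coordB_def divide_inverse mult.commute)
  qed
  then have "smooth_plane_on (restrict_disk (restrict ?P Omega)) (ball 0 1)"
    by (rule smooth_plane_on_cong[rotated 2]) (use ne in \<open>auto simp: restrict_disk_def\<close>)
  with P show ?thesis unfolding A_disk_def by blast
qed

section \<open>Schauder bases\<close>

text \<open>The open sets are pulled back along the inverse of \<open>r\<close>, and the neighbourhoods of \<open>F\<close> are
  controlled by uniform closeness to \<open>F\<close> on compact sets.\<close>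

lemma limitin_restrictions_iff:
  assumes inj: "inj_on r hol_Omega" and S: "\<And>N. S N \<in> hol_Omega" and F: "F \<in> hol_Omega"
    and A: "\<And>N. r (S N) \<in> A" "r F \<in> A"
  shows "limitin (pullback_topology A (the_inv_into hol_Omega r) hol_Omega_topology)
           (\<lambda>N. r (S N)) (r F) sequentially
     \<longleftrightarrow> (\<forall>K e. compact_Omega K \<longrightarrow> e > 0 \<longrightarrow> (\<forall>\<^sub>F N in sequentially. \<forall>p\<in>K. dist (S N p) (F p) < (e::real)))"
    (is "limitin ?T _ _ _ \<longleftrightarrow> ?U")
proof
  have inv: "the_inv_into hol_Omega r (r G) = G" if "G \<in> hol_Omega" for G
    using the_inv_into_f_f[OF inj that] .
  {
    assume lim: "limitin ?T (\<lambda>N. r (S N)) (r F) sequentially"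
    show ?U
    proof (intro allI impI)
      fix K and e :: real assume K: "compact_Omega K" and e: "e > 0"
      define V where "V = {G \<in> hol_Omega. \<forall>p\<in>K. dist (G p) (F p) < e}"
      have "openin ?T (the_inv_into hol_Omega r -` V \<inter> A)"
        unfolding openin_pullback_topology V_def using hol_Omega_topology_basic_open[OF K F e] by blast
      moreover have "r F \<in> the_inv_into hol_Omega r -` V \<inter> A"
        using A F e by (simp add: inv V_def)
      ultimately have "\<forall>\<^sub>F N in sequentially. r (S N) \<in> the_inv_into hol_Omega r -` V \<inter> A"
        using lim unfolding limitin_def by blast
      then show "\<forall>\<^sub>F N in sequentially. \<forall>p\<in>K. dist (S N p) (F p) < e"
        by eventually_elim (simp add: inv[OF S] V_def)
    qed
  next
    assume U: ?U
    show "limitin ?T (\<lambda>N. r (S N)) (r F) sequentially"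
      unfolding limitin_def
    proof (intro conjI allI impI)
      show "r F \<in> topspace ?T"
        using A F by (simp add: topspace_pullback_topology topspace_hol_Omega_topology inv)
      fix W assume "openin ?T W \<and> r F \<in> W"
      then obtain V where V: "openin hol_Omega_topology V" "W = the_inv_into hol_Omega r -` V \<inter> A" "r F \<in> W"
        unfolding openin_pullback_topology by blast
      then have "F \<in> V" using inv[OF F] by auto
      with V have "\<forall>\<^sub>F N in sequentially. S N \<in> V"
        using U by (intro eventually_in_open_hol_Omega[OF S F]) auto
      then show "\<forall>\<^sub>F N in sequentially. r (S N) \<in> W"
        by eventually_elim (use A V in \<open>simp add: inv[OF S]\<close>)
    qed
  }
qed

text \<open>The terms are dominated on \<open>K\<close> by a summable family indexed by the modes, so the Weierstrass test
  applies to every enumeration.\<close>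

lemma mode_series_converges_uniformly:
  fixes \<sigma> :: "nat \<Rightarrow> nat \<times> int"
  assumes F: "holo F" and \<sigma>: "bij_betw \<sigma> UNIV mode_index" and K: "compact_Omega K" and e: "e > 0"
  shows "\<forall>\<^sub>F N in sequentially. \<forall>p\<in>K.
    dist (\<Sum>k<N. coef F (fst (\<sigma> k)) (snd (\<sigma> k)) * mode_fun (fst (\<sigma> k)) (snd (\<sigma> k)) p) (F p) < e"
proof -
  let ?f = "\<lambda>k p. coef F (fst (\<sigma> k)) (snd (\<sigma> k)) * mode_fun (fst (\<sigma> k)) (snd (\<sigma> k)) p"
  have \<sigma>in: "(fst (\<sigma> k), snd (\<sigma> k)) \<in> mode_index" for k using \<sigma> by (auto simp: bij_betw_def)
  obtain B where B: "B \<ge> 0"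
    "\<And>p m n. p \<in> K \<Longrightarrow> (m, n) \<in> mode_index \<Longrightarrow> norm (coef F m n * mode_fun m n p) \<le> B * (1 / 2) ^ m"
    using mode_expansion_bound[OF F K] by blast
  have "(\<lambda>k. B * (1 / 2) ^ fst (\<sigma> k)) summable_on UNIV"
    using summable_mode_index[of B] summable_on_reindex_bij_betw[OF \<sigma>, of "\<lambda>(m, n). B * (1 / 2) ^ m"]
    by (simp add: case_prod_beta')
  then have s: "summable (\<lambda>k. B * (1 / 2) ^ fst (\<sigma> k))" by (rule summable_on_imp_summable)
  have "uniform_limit K (\<lambda>N p. \<Sum>k<N. ?f k p) (\<lambda>p. \<Sum>k. ?f k p) sequentially"
    by (rule Weierstrass_m_test[OF _ s]) (use B(2) \<sigma>in in auto)
  moreover have "(\<Sum>k. ?f k p) = F p" if "p \<in> K" for p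
  proof -
    have "p \<in> Omega" using that K by (auto simp: compact_Omega_def)
    from mode_expansion[OF F this] have s: "((\<lambda>k. ?f k p) has_sum F p) UNIV"
      using has_sum_reindex_bij_betw[OF \<sigma>, of "\<lambda>(m, n). coef F m n * mode_fun m n p"]
      by (simp add: case_prod_beta')
    show ?thesis by (rule sums_unique[OF has_sum_imp_sums[OF s], symmetric])
  qed
  ultimately have "uniform_limit K (\<lambda>N p. \<Sum>k<N. ?f k p) F sequentially"
    by (simp cong: uniform_limit_cong')
  then show ?thesis using e by (auto simp: uniform_limit_iff)
qed

text \<open>Apply the continuous functional \<open>coef\<close> to the partial sums: by biorthogonality it is eventually
  constant and equal to \<open>c j\<close>, and by convergence it tends to the coefficient of \<open>F\<close>.\<close>

lemma mode_series_coefficients_unique: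
  fixes \<sigma> :: "nat \<Rightarrow> nat \<times> int"
  assumes F: "holo F" and \<sigma>: "bij_betw \<sigma> UNIV mode_index"
    and lim: "\<And>K e. compact_Omega K \<Longrightarrow> e > 0 \<Longrightarrow> \<forall>\<^sub>F N in sequentially. \<forall>p\<in>K.
      dist (\<Sum>k<N. c k * mode_fun (fst (\<sigma> k)) (snd (\<sigma> k)) p) (F p) < e"
  shows "c j = coef F (fst (\<sigma> j)) (snd (\<sigma> j))"
proof -
  let ?S = "\<lambda>N p. \<Sum>k<N. c k * mode_fun (fst (\<sigma> k)) (snd (\<sigma> k)) p"
  let ?m = "fst (\<sigma> j)" and ?n = "snd (\<sigma> j)"
  have \<sigma>in: "(fst (\<sigma> k), snd (\<sigma> k)) \<in> mode_index" for k using \<sigma> by (auto simp: bij_betw_def)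
  have \<sigma>inj: "\<sigma> j = \<sigma> k \<longleftrightarrow> j = k" for k
    using \<sigma> by (auto simp: bij_betw_def inj_on_def)
  have S: "holo (?S N)" for N
    by (intro holo_sum holo_mult holo_const holo_mode_fun)
  obtain K where K: "compact_Omega K"
    "\<And>F B. holo F \<Longrightarrow> B \<ge> 0 \<Longrightarrow> (\<And>p. p \<in> K \<Longrightarrow> norm (F p) \<le> B) \<Longrightarrow> norm (coef F ?m ?n) \<le> 2 * B"
    using coef_bounded[of ?m ?n] by blast
  have coefS: "coef (?S N) ?m ?n = c j" if "N > j" for N
  proof -
    have "coef (?S N) ?m ?n = (\<Sum>k<N. c k * coef (mode_fun (fst (\<sigma> k)) (snd (\<sigma> k))) ?m ?n)"
      by (rule coef_sum) (auto intro: holo_mode_fun)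
    also have "\<dots> = (\<Sum>k<N. if k = j then c k else 0)"
      by (intro sum.cong[OF refl])
         (use \<sigma>inj in \<open>auto simp: coef_mode_fun[OF \<sigma>in \<sigma>in] prod_eq_iff\<close>)
    also have "\<dots> = c j" using that by simp
    finally show ?thesis .
  qed
  have "norm (c j - coef F ?m ?n) \<le> 0 + e" if "e > 0" for e
  proof -
    have "\<forall>\<^sub>F N in sequentially. \<forall>p\<in>K. dist (?S N p) (F p) < e / 2"
      using lim[OF K(1), of "e / 2"] that by simp
    moreover have "\<forall>\<^sub>F N in sequentially. N > j" by (rule eventually_gt_at_top)
    ultimately have "\<forall>\<^sub>F N in sequentially. N > j \<and> (\<forall>p\<in>K. dist (?S N p) (F p) < e / 2)"
      by eventually_elim simp
    then obtain N where N: "N > j" "\<And>p. p \<in> K \<Longrightarrow> dist (?S N p) (F p) < e / 2"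
      using eventually_happens trivial_limit_sequentially by blast
    \<comment> \<open>The difference, in the shape of \<open>coef_linear\<close>.\<close>
    let ?D = "\<lambda>p. 1 * ?S N p + (-1) * F p"
    have "norm (coef ?D ?m ?n) \<le> 2 * (e / 2)"
    proof (rule K(2))
      show "holo ?D" by (intro holo_add holo_mult holo_const S F)
      show "norm (?D p) \<le> e / 2" if "p \<in> K" for p
        using N(2)[OF that] by (simp add: dist_norm)
    qed (use that in simp)
    then show ?thesis unfolding coef_linear[OF S F] coefS[OF N(1)] by simp
  qed
  then have "norm (c j - coef F ?m ?n) \<le> 0" by (rule field_le_epsilon)
  then show ?thesis by simp
qed

text \<open>The common form of both parts of the theorem, for an injective and linear restriction map \<open>r\<close> to
  functions on \<open>D\<close>.\<close>

lemma schauder_basis_of_restrictions: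
  assumes inj: "inj_on r hol_Omega" and A: "A \<subseteq> r ` hol_Omega"
    and lin: "\<And>(c :: nat \<Rightarrow> complex) G N. restrict (\<lambda>x. \<Sum>k<N. c k * r (restrict (G k) Omega) x) D
                = r (restrict (\<lambda>p. \<Sum>k<N. c k * G k p) Omega)"
    and modes: "\<And>(c :: nat \<Rightarrow> complex) m n N. r (restrict (\<lambda>p. \<Sum>k<N. c k * mode_fun (m k) (n k) p) Omega) \<in> A"
  shows "schauder_basis D A (pullback_topology A (the_inv_into hol_Omega r) hol_Omega_topology)
           {r (PFM m n) | m n. \<bar>n\<bar> \<le> int m}"
proof -
  let ?T = "pullback_topology A (the_inv_into hol_Omega r) hol_Omega_topology"
  let ?B = "{r (PFM m n) | m n. \<bar>n\<bar> \<le> int m}"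
  define h where "h = (\<lambda>mn. r (PFM (fst mn) (snd mn)))"
  have PFM: "PFM (fst mn) (snd mn) = restrict (mode_fun (fst mn) (snd mn)) Omega" if "mn \<in> mode_index" for mn
    using that PFM_eq by (auto simp: mode_index_def)
  have B: "?B = h ` mode_index"
  proof (intro equalityI subsetI)
    fix x assume "x \<in> ?B"
    then obtain m n where "x = h (m, n)" "(m, n) \<in> mode_index" by (auto simp: h_def mode_index_def)
    then show "x \<in> h ` mode_index" by blast
  qed (auto simp: h_def mode_index_def, blast)
  have inj_h: "inj_on h mode_index"
  proof (rule inj_onI)
    fix x y assume x: "x \<in> mode_index" and y: "y \<in> mode_index" and "h x = h y"
    then have "restrict (mode_fun (fst x) (snd x)) Omega = restrict (mode_fun (fst y) (snd y)) Omega"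
      using inj_onD[OF inj] restrict_hol_Omega[OF holo_mode_fun] by (simp add: h_def PFM)
    then have "coef (mode_fun (fst x) (snd x)) = coef (mode_fun (fst y) (snd y))"
      by (intro coef_cong) (metis restrict_apply')
    then show "x = y"
      using coef_mode_fun[of "fst x" "snd x" "fst x" "snd x"] coef_mode_fun[of "fst x" "snd x" "fst y" "snd y"] x y
      by (simp add: prod_eq_iff split: if_splits)
  qed
  have inf: "infinite mode_index"
  proof
    assume "finite mode_index"
    then have "finite ((\<lambda>m :: nat. (m, 0 :: int)) ` UNIV)"
      by (rule finite_subset[rotated]) (auto simp: mode_index_def)
    then show False by (auto dest: finite_imageD simp: inj_on_def)
  qed
  have "schauder_sequence D A ?T e" if e: "bij_betw e UNIV ?B" for e
  proof -
    define \<sigma> where "\<sigma> = inv_into mode_index h \<circ> e"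
    have bh: "bij_betw h mode_index ?B" unfolding B by (rule inj_on_imp_bij_betw[OF inj_h])
    have \<sigma>: "bij_betw \<sigma> UNIV mode_index"
      unfolding \<sigma>_def by (rule bij_betw_trans[OF e bij_betw_inv_into[OF bh]])
    have \<sigma>in: "\<sigma> k \<in> mode_index" for k using \<sigma> by (auto simp: bij_betw_def)
    have e_eq: "e k = r (restrict (mode_fun (fst (\<sigma> k)) (snd (\<sigma> k))) Omega)" for k
    proof -
      have "e k \<in> h ` mode_index" using e B by (auto simp: bij_betw_def)
      then have "e k = h (\<sigma> k)" by (simp add: \<sigma>_def f_inv_into_f)
      then show ?thesis by (simp add: h_def PFM[OF \<sigma>in])
    qed
    define S where "S c N = restrict (\<lambda>p. \<Sum>k<N. c k * mode_fun (fst (\<sigma> k)) (snd (\<sigma> k)) p) Omega"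
      for c :: "nat \<Rightarrow> complex" and N
    have partial: "restrict (\<lambda>x. \<Sum>k<N. c k * e k x) D = r (S c N)" for c N
      unfolding e_eq S_def by (rule lin)
    have S: "S c N \<in> hol_Omega" for c N
      unfolding S_def by (intro restrict_hol_Omega holo_sum holo_mult holo_const holo_mode_fun)
    have SA: "r (S c N) \<in> A" for c N unfolding S_def by (rule modes)
    have "range e \<subseteq> A"
    proof (clarify)
      fix k
      have "r (restrict (\<lambda>p. \<Sum>i<(1::nat). 1 * mode_fun (fst (\<sigma> k)) (snd (\<sigma> k)) p) Omega) \<in> A"
        by (rule modes[of "\<lambda>_. 1" "\<lambda>_. fst (\<sigma> k)" "\<lambda>_. snd (\<sigma> k)" 1])
      then show "e k \<in> A" by (simp add: e_eq)
    qed
    moreover have "\<exists>!c. limitin ?T (\<lambda>N. restrict (\<lambda>x. \<Sum>k<N. c k * e k x) D) f sequentially"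
      if f: "f \<in> A" for f
    proof -
      obtain F where F: "F \<in> hol_Omega" "f = r F" using f A by blast
      then have hF: "holo F" by (simp add: hol_Omega_iff)
      have lim_iff: "limitin ?T (\<lambda>N. restrict (\<lambda>x. \<Sum>k<N. c k * e k x) D) f sequentially \<longleftrightarrow>
        (\<forall>K d. compact_Omega K \<longrightarrow> d > 0 \<longrightarrow> (\<forall>\<^sub>F N in sequentially. \<forall>p\<in>K.
          dist (\<Sum>k<N. c k * mode_fun (fst (\<sigma> k)) (snd (\<sigma> k)) p) (F p) < (d::real)))" for c
      proof -
        have "(\<forall>p\<in>K. dist (S c N p) (F p) < d) \<longleftrightarrow>
           (\<forall>p\<in>K. dist (\<Sum>k<N. c k * mode_fun (fst (\<sigma> k)) (snd (\<sigma> k)) p) (F p) < d)"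
          if "compact_Omega K" for K N d
          using that by (intro ball_cong refl) (auto simp: compact_Omega_def S_def)
        then show ?thesis
          unfolding partial F(2)
          using limitin_restrictions_iff[where S = "S c", OF inj S F(1) SA] f F(2) by auto
      qed
      show ?thesis
      proof (rule ex1I)
        show "limitin ?T (\<lambda>N. restrict (\<lambda>x. \<Sum>k<N. coef F (fst (\<sigma> k)) (snd (\<sigma> k)) * e k x) D) f sequentially"
          unfolding lim_iff using mode_series_converges_uniformly[OF hF \<sigma>] by blast
        fix c assume "limitin ?T (\<lambda>N. restrict (\<lambda>x. \<Sum>k<N. c k * e k x) D) f sequentially"
        then show "c = (\<lambda>k. coef F (fst (\<sigma> k)) (snd (\<sigma> k)))"
          unfolding lim_iff using mode_series_coefficients_unique[OF hF \<sigma>] by blast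
      qed
    qed
    ultimately show ?thesis unfolding schauder_sequence_def by blast
  qed
  moreover have "countable ?B" unfolding B by (intro countable_image) simp
  moreover have "infinite ?B" unfolding B using inf finite_imageD[OF _ inj_h] by blast
  ultimately show ?thesis unfolding schauder_basis_def by blast
qed

theorem corollary3p5:
  shows "schauder_basis UNIV A_sphere A_sphere_topology
           {restrict_sphere (PFM m n) | m n. \<bar>n\<bar> \<le> int m} \<and>
         schauder_basis (ball 0 1) A_disk A_disk_topology
           {restrict_disk (PFM m n) | m n. \<bar>n\<bar> \<le> int m}"
proof
  show "schauder_basis UNIV A_sphere A_sphere_topology
           {restrict_sphere (PFM m n) | m n. \<bar>n\<bar> \<le> int m}"
    unfolding A_sphere_topology_def
  proof (rule schauder_basis_of_restrictions[OF inj_on_restrict_sphere])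
    show "A_sphere \<subseteq> restrict_sphere ` hol_Omega" by (auto simp: A_sphere_def)
  qed (simp_all add: restrict_sphere_modes_in_A_sphere, simp add: restrict_sphere_def restrict_UNIV)
  show "schauder_basis (ball 0 1) A_disk A_disk_topology
           {restrict_disk (PFM m n) | m n. \<bar>n\<bar> \<le> int m}"
    unfolding A_disk_topology_def
  proof (rule schauder_basis_of_restrictions[OF inj_on_restrict_disk])
    show "A_disk \<subseteq> restrict_disk ` hol_Omega" by (auto simp: A_disk_def)
    fix c :: "nat \<Rightarrow> complex" and G and N
    show "restrict (\<lambda>x. \<Sum>k<N. c k * restrict_disk (restrict (G k) Omega) x) (ball 0 1)
        = restrict_disk (restrict (\<lambda>p. \<Sum>k<N. c k * G k p) Omega)"
    proof
      fix x :: complex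
      have "x * cnj x \<noteq> 1" if "norm x < 1"
        using mult_neq_one_of_small[of x "cnj x"] that by simp
      then show "restrict (\<lambda>x. \<Sum>k<N. c k * restrict_disk (restrict (G k) Omega) x) (ball 0 1) x
          = restrict_disk (restrict (\<lambda>p. \<Sum>k<N. c k * G k p) Omega) x"
        by (simp add: restrict_disk_def)
    qed
  qed (rule restrict_disk_modes_in_A_disk)
qed

end
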